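(* Let $N\ge1$ and assume that the radial functions $\rho_n$ on $\mathbb{R}^N$ satisfy, for all $n\in\mathbb{N}$, $\rho_n\ge0$ and $\int_{\mathbb{R}^N}\rho_n(x)\,dx=1$, and moreover $\lim_{n\to\infty}\int_{|x|>\gamma}\rho_n(x)\,dx=0$ for every $\gamma>0$. Then, for every $u\in L^1(\mathbb{R}^N)$, $$\Gamma^-_{L^1(\mathbb{R}^N)}\text{-}\lim_{n\to\infty}\int_{\mathbb{R}^N}|\mathfrak{H}_nu|\,dx=|D^2u|(\mathbb{R}^N),$$ where the $\Gamma$-limit is taken with respect to the strong convergence $u_n\to u$ in $L^1(\mathbb{R}^N)$.
   Context: For $\varphi\in C_c^2(\mathbb{R}^N)$ the non-local Hessian is $$H_n\varphi(x):=\frac{N(N+2)}{2}\int_{\mathbb{R}^N}\frac{\varphi(x+h)-2\varphi(x)+\varphi(x-h)}{|h|^2}\,\frac{h\otimes h-\frac{|h|^2}{N+2}I_N}{|h|^2}\,\rho_n(h)\,dh\in\mathbb{R}^{N\times N},$$ with entries $H_n^{ij}\varphi$, where $I_N$ is the $N\times N$ identity matrix and $h\otimes h=hh^{\top}$. For $u\in L^1(\mathbb{R}^N)$ the distributional non-local Hessian $\mathfrak{H}_nu$ is given componentwise by $\langle\mathfrak{H}_n^{ij}u,\varphi\rangle:=\int_{\mathbb{R}^N}u\,H_n^{ij}\varphi\,dx$ for $\varphi\in C_c^\infty(\mathbb{R}^N)$. Set $F_n(u):=\int_{\mathbb{R}^N}|\mathfrak{H}_nu|\,dx$, understood as $+\infty$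 if $\mathfrak{H}_nu$ is not represented by a function in $L^1(\mathbb{R}^N,\mathbb{R}^{N\times N})$. $\mathrm{BV}^2(\mathbb{R}^N)$ is the space of $u\in W^{1,1}(\mathbb{R}^N)$ with $\nabla u\in\mathrm{BV}(\mathbb{R}^N,\mathbb{R}^N)$; $D^2u:=D(\nabla u)$, and $|D^2u|(\mathbb{R}^N)$ is its total variation, understood as $+\infty$ if $u\notin\mathrm{BV}^2(\mathbb{R}^N)$. $|\cdot|$ is the Frobenius norm on matrices. $\Gamma$-convergence: for functionals $F_n,F:X\to\mathbb{R}\cup\{+\infty\}$ on a metric space $X$, $\Gamma_X^-\text{-}\lim_{n\to\infty}F_n(x)=F(x)$ means: (1) for every sequence $x_n\to x$ in $X$, $F(x)\le\liminf_{n\to\infty}F_n(x_n)$; (2) there exists a sequence $x_n\to x$ in $X$ with $F(x)\ge\limsup_{n\to\infty}F_n(x_n)$. *)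

theory Defs
  imports "HOL-Analysis.Analysis"
begin

section \<open>Test functions\<close>

definition pderivative :: "'n \<Rightarrow> (real^'n::finite \<Rightarrow> real) \<Rightarrow> real^'n \<Rightarrow> real" where
  "pderivative i f x = frechet_derivative f (at x) (axis i 1)"

primrec Ck :: "nat \<Rightarrow> (real^'n::finite \<Rightarrow> real) \<Rightarrow> bool" where
  "Ck 0 f \<longleftrightarrow> continuous_on UNIV f"
| "Ck (Suc k) f \<longleftrightarrow> (\<forall>x. f differentiable (at x)) \<and> (\<forall>i. Ck k (pderivative i f))"

definition test_function :: "(real^'n::finite \<Rightarrow> real) \<Rightarrow> bool" where
  "test_function \<phi> \<longleftrightarrow> (\<forall>k. Ck k \<phi>) \<and> compact (closure {x. \<phi> x \<noteq> 0})"


section \<open>The space \<open>L\<^sup>1\<close> and Gamma-convergence\<close>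

text \<open>Elements of \<open>L\<^sup>1\<close> are represented by Lebesgue integrable functions; the distance is zero
  exactly for functions that agree almost everywhere, and all functionals below depend only
  on the class of their argument.\<close>

definition L1 :: "(real^'n::finite \<Rightarrow> real) set" where
  "L1 = {u. integrable lebesgue u}"

definition L1_dist :: "(real^'n::finite \<Rightarrow> real) \<Rightarrow> (real^'n \<Rightarrow> real) \<Rightarrow> real" where
  "L1_dist u v = (LINT x|lebesgue. \<bar>u x - v x\<bar>)"

text \<open>The Gamma-limit of \<open>Fs\<close> at the point \<open>x\<close> exists and equals \<open>F x\<close>.\<close>

definition Gamma_lim_at ::
  "'a set \<Rightarrow> ('a \<Rightarrow> 'a \<Rightarrow> real) \<Rightarrow> (nat \<Rightarrow> 'a \<Rightarrow> ereal) \<Rightarrow> ('a \<Rightarrow> ereal) \<Rightarrow> 'a \<Rightarrow> bool" where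
  "Gamma_lim_at X d Fs F x \<longleftrightarrow>
     (\<forall>xs. (\<forall>n. xs n \<in> X) \<longrightarrow> (\<lambda>n. d (xs n) x) \<longlonglongrightarrow> 0 \<longrightarrow>
           F x \<le> liminf (\<lambda>n. Fs n (xs n))) \<and>
     (\<exists>xs. (\<forall>n. xs n \<in> X) \<and> (\<lambda>n. d (xs n) x) \<longlonglongrightarrow> 0 \<and>
           limsup (\<lambda>n. Fs n (xs n)) \<le> F x)"


section \<open>The non-local Hessian\<close>

definition radial :: "(real^'n::finite \<Rightarrow> real) \<Rightarrow> bool" where
  "radial \<rho> \<longleftrightarrow> (\<forall>x y. norm x = norm y \<longrightarrow> \<rho> x = \<rho> y)"

definition outer :: "real^'n \<Rightarrow> real^'n \<Rightarrow> real^'n^'n::finite" where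
  "outer h k = (\<chi> i j. h $ i * k $ j)"

definition nonlocal_hessian ::
  "(real^'n::finite \<Rightarrow> real) \<Rightarrow> (real^'n \<Rightarrow> real) \<Rightarrow> real^'n \<Rightarrow> real^'n^'n" where
  "nonlocal_hessian \<rho> \<phi> x =
     (real CARD('n) * (real CARD('n) + 2) / 2) *\<^sub>R
     (LINT h|lebesgue.
        ((\<phi> (x + h) - 2 * \<phi> x + \<phi> (x - h)) / (norm h)\<^sup>2 * (1 / (norm h)\<^sup>2) * \<rho> h) *\<^sub>R
        (outer h h - ((norm h)\<^sup>2 / (real CARD('n) + 2)) *\<^sub>R mat 1))"

definition dist_nonlocal_hessian ::
  "(real^'n::finite \<Rightarrow> real) \<Rightarrow> (real^'n \<Rightarrow> real) \<Rightarrow> 'n \<Rightarrow> 'n \<Rightarrow> (real^'n \<Rightarrow> real) \<Rightarrow> real" where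
  "dist_nonlocal_hessian \<rho> u i j \<phi> = (LINT x|lebesgue. u x * nonlocal_hessian \<rho> \<phi> x $ i $ j)"

definition represents_nonlocal_hessian ::
  "(real^'n::finite \<Rightarrow> real) \<Rightarrow> (real^'n \<Rightarrow> real) \<Rightarrow> (real^'n \<Rightarrow> real^'n^'n) \<Rightarrow> bool" where
  "represents_nonlocal_hessian \<rho> u G \<longleftrightarrow> integrable lebesgue G \<and>
     (\<forall>i j \<phi>. test_function \<phi> \<longrightarrow>
        dist_nonlocal_hessian \<rho> u i j \<phi> = (LINT x|lebesgue. G x $ i $ j * \<phi> x))"

text \<open>The representing function is unique up to null sets, so the choice is immaterial.
  The norm of \<open>real^'n^'n\<close> is the Frobenius norm.\<close>

definition nonlocal_energy :: "(real^'n::finite \<Rightarrow> real) \<Rightarrow> (real^'n \<Rightarrow> real) \<Rightarrow> ereal" where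
  "nonlocal_energy \<rho> u =
     (if \<exists>G. represents_nonlocal_hessian \<rho> u G
      then ereal (LINT x|lebesgue. norm ((SOME G. represents_nonlocal_hessian \<rho> u G) x))
      else \<infinity>)"


section \<open>The space \<open>BV\<^sup>2\<close>\<close>

definition is_weak_gradient :: "(real^'n::finite \<Rightarrow> real) \<Rightarrow> (real^'n \<Rightarrow> real^'n) \<Rightarrow> bool" where
  "is_weak_gradient u g \<longleftrightarrow>
     (\<forall>i \<phi>. test_function \<phi> \<longrightarrow>
        (LINT x|lebesgue. u x * pderivative i \<phi> x) = - (LINT x|lebesgue. g x $ i * \<phi> x))"

definition W11 :: "(real^'n::finite \<Rightarrow> real) set" where
  "W11 = {u. integrable lebesgue u \<and> (\<exists>g. integrable lebesgue g \<and> is_weak_gradient u g)}"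

definition weak_gradient :: "(real^'n::finite \<Rightarrow> real) \<Rightarrow> real^'n \<Rightarrow> real^'n" where
  "weak_gradient u = (SOME g. integrable lebesgue g \<and> is_weak_gradient u g)"

text \<open>The total variation \<open>|Dv|(\<real>\<^sup>N)\<close> of the distributional derivative of \<open>v\<close>: the supremum of
  the integral of \<open>\<Sum>\<^sub>i v\<^sub>i div \<psi>\<^sub>i\<close> over the matrix-valued test fields \<open>\<psi>\<close> with rows \<open>\<psi>\<^sub>i\<close>
  whose Frobenius norm is at most 1 everywhere.\<close>

definition total_variation :: "(real^'n::finite \<Rightarrow> real^'m::finite) \<Rightarrow> ereal" where
  "total_variation v =
     (SUP \<psi> \<in> {\<psi> :: real^'n \<Rightarrow> real^'n^'m.
                 (\<forall>i j. test_function (\<lambda>x. \<psi> x $ i $ j)) \<and> (\<forall>x. norm (\<psi> x) \<le> 1)}.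
        ereal (LINT x|lebesgue.
          (\<Sum>i\<in>UNIV. v x $ i * (\<Sum>j\<in>UNIV. pderivative j (\<lambda>y. \<psi> y $ i $ j) x))))"

definition BV :: "(real^'n::finite \<Rightarrow> real^'m::finite) set" where
  "BV = {v. integrable lebesgue v \<and> total_variation v < \<infinity>}"

definition BV2 :: "(real^'n::finite \<Rightarrow> real) set" where
  "BV2 = {u \<in> W11. weak_gradient u \<in> BV}"

definition D2_variation :: "(real^'n::finite \<Rightarrow> real) \<Rightarrow> ereal" where
  "D2_variation u = (if u \<in> BV2 then total_variation (weak_gradient u) else \<infinity>)"

end

theory Submission
  imports Defs
begin

text \<open>Both sides of the Gamma-limit are controlled by duality. Write \<open>\<langle>u, \<psi>\<rangle>\<close> for the sum over i, j of
  the integrals of \<open>u \<partial>\<^sub>i\<partial>\<^sub>j\<psi>\<^sub>i\<^sub>j\<close> (hess_pairing), where \<open>\<psi>\<close> is a matrix-valued test field with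
  \<open>|\<psi>| \<le> 1\<close>. The total variation of \<open>D\<^sup>2u\<close> is the supremum of \<open>\<langle>u, \<psi>\<rangle>\<close> over such fields. The
  non-local energy dominates the same expression with the non-local Hessian \<open>H\<^sub>n\<psi>\<close> in place of the
  second derivatives of \<open>\<psi>\<close>, and equals its supremum as soon as a representing function exists. So
  everything rests on the convergence \<open>H\<^sub>n\<phi> \<longlongrightarrow> D\<^sup>2\<phi>\<close> for a test function \<open>\<phi>\<close>, which is needed both
  uniformly and in \<open>L\<^sup>1\<close> (nlh_tendsto_hess_uniformly, nlh_tendsto_hess_L1).

  This convergence has an analytic and an algebraic part. With \<open>\<theta> = h/|h|\<close>, Taylor's formula
  replaces the second difference quotient by the quadratic form \<open>\<theta> \<bullet> D\<^sup>2\<phi>(x) \<theta>\<close>, with an error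
  that is bounded for all h and small for small h; as the kernels concentrate at 0, the averaged
  error tends to 0. The main term is reproduced exactly, for every kernel: rotation invariance
  forces the fourth angular moments to be \<open>(\<delta>\<^sub>k\<^sub>l\<delta>\<^sub>i\<^sub>j + \<delta>\<^sub>k\<^sub>i\<delta>\<^sub>l\<^sub>j + \<delta>\<^sub>k\<^sub>j\<delta>\<^sub>l\<^sub>i) / (N(N+2))\<close>, and
  the weight \<open>\<theta>\<^sub>i\<theta>\<^sub>j - \<delta>\<^sub>i\<^sub>j/(N+2)\<close> is chosen so that averaging the quadratic form of a symmetric
  matrix A against it returns \<open>2 A\<^sub>i\<^sub>j / (N(N+2))\<close> (average_directional_hess).

  Lower bound. If \<open>u\<^sub>n \<longlongrightarrow> u\<close> in \<open>L\<^sup>1\<close>, uniform convergence of \<open>H\<^sub>n\<psi>\<close> gives \<open>\<langle>u, \<psi>\<rangle> \<le> liminf\<close> of the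
  energies (hess_pairing_le_liminf). If the liminf is a finite number C, all pairings are at most
  C, and the point is that u then has an integrable gradient. The difference quotients of u in a
  coordinate direction are Cauchy in \<open>L\<^sup>1\<close>: tested against \<open>\<phi>\<close>, the error of a quotient of step d
  is the integral of u against a pure second derivative of a test function of size at most d,
  hence at most \<open>C d\<close> (difference_quotient_as_second_derivative, weak_partial_derivative_exists).

  Upper bound. For a mollifier \<open>\<eta>\<close> the function \<open>u * \<eta>\<close> has the non-local Hessian \<open>u * H\<^sub>n\<eta>\<close>,
  because \<open>H\<^sub>n\<close> is self-adjoint and commutes with translations. It converges in \<open>L\<^sup>1\<close> to
  \<open>u * D\<^sup>2\<eta>\<close>, whose norm is at most the total variation of \<open>D\<^sup>2u\<close>, again by duality
  (conv_hess_L1_le). Letting \<open>\<eta>\<close> shrink slowly with n gives the recovery sequence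
  (diagonal_recovery_sequence).\<close>

section \<open>Calculus of test functions\<close>

lemma pderivative_eqI:
  assumes "(f has_derivative D) (at x)"
  shows "pderivative i f x = D (axis i 1)"
  using frechet_derivative_at[OF assms] by (simp add: pderivative_def)

lemma has_derivative_pderivative:
  fixes f :: "real^'n::finite \<Rightarrow> real"
  assumes "f differentiable (at x)"
  shows "(f has_derivative (\<lambda>h. \<Sum>i\<in>UNIV. h$i * pderivative i f x)) (at x)"
proof -
  let ?D = "frechet_derivative f (at x)"
  have D: "(f has_derivative ?D) (at x)"
    using assms frechet_derivative_works by blast
  have lin: "linear ?D" using D has_derivative_linear by blast
  have "?D h = (\<Sum>i\<in>UNIV. h$i * pderivative i f x)" for h
  proof -
    have "?D h = ?D (\<Sum>i\<in>UNIV. h$i *\<^sub>R axis i 1)"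
      using basis_expansion[of h] by (simp add: scalar_mult_eq_scaleR)
    also have "\<dots> = (\<Sum>i\<in>UNIV. h$i * pderivative i f x)"
      using lin by (simp add: linear_sum linear_cmul pderivative_def)
    finally show ?thesis .
  qed
  then show ?thesis using D by (metis (no_types, lifting) ext)
qed

lemma Ck_imp_continuous: "Ck k f \<Longrightarrow> continuous_on UNIV f"
  by (cases k) (auto intro!: continuous_at_imp_continuous_on differentiable_imp_continuous_within)

lemma Ck_Suc_imp_Ck: "Ck (Suc k) f \<Longrightarrow> Ck k f"
proof (induction k arbitrary: f)
  case 0 then show ?case using Ck_imp_continuous[of "Suc 0"] by simp
next
  case (Suc k) then show ?case by (metis Ck.simps(2))
qed

lemma pderivative_const: "pderivative i (\<lambda>_. c) = (\<lambda>_. 0)"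
  by (rule ext, subst pderivative_eqI[OF has_derivative_const]) simp

lemma pderivative_nth: "pderivative i (\<lambda>x. x $ j) = (\<lambda>_. axis i 1 $ j)"
  by (rule ext, subst pderivative_eqI[OF bounded_linear_imp_has_derivative[OF
      bounded_linear_vec_nth]]) simp

lemma pderivative_add:
  assumes "f differentiable (at x)" "g differentiable (at x)"
  shows "pderivative i (\<lambda>x. f x + g x) x = pderivative i f x + pderivative i g x"
  using pderivative_eqI[OF has_derivative_add[OF assms[unfolded frechet_derivative_works]]]
  by (simp add: pderivative_def)

lemma pderivative_mult:
  assumes "f differentiable (at x)" "g differentiable (at x)"
  shows "pderivative i (\<lambda>x. f x * g x) x = f x * pderivative i g x + pderivative i f x * g x"
  using pderivative_eqI[OF has_derivative_mult[OF assms[unfolded frechet_derivative_works]]]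
  by (simp add: pderivative_def)

lemma Ck_const: "Ck k (\<lambda>_. c)"
  by (induction k arbitrary: c) (auto simp: pderivative_const)

lemma Ck_nth: "Ck k (\<lambda>x. x $ j)"
  by (cases k) (auto simp: pderivative_nth Ck_const intro!: bounded_linear_imp_differentiable
      bounded_linear_vec_nth continuous_intros)

lemma Ck_add: "Ck k f \<Longrightarrow> Ck k g \<Longrightarrow> Ck k (\<lambda>x. f x + g x)"
proof (induction k arbitrary: f g)
  case 0 then show ?case by (auto intro!: continuous_intros)
next
  case (Suc k)
  then have "pderivative i (\<lambda>x. f x + g x) = (\<lambda>x. pderivative i f x + pderivative i g x)" for i
    by (intro ext pderivative_add) auto
  with Suc show ?case by auto
qed

lemma Ck_mult: "Ck k f \<Longrightarrow> Ck k g \<Longrightarrow> Ck k (\<lambda>x. f x * g x)"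
proof (induction k arbitrary: f g)
  case 0 then show ?case by (auto intro!: continuous_intros)
next
  case (Suc k)
  then have "pderivative i (\<lambda>x. f x * g x)
      = (\<lambda>x. f x * pderivative i g x + pderivative i f x * g x)" for i
    by (intro ext pderivative_mult) auto
  moreover have "Ck k f" "Ck k g" using Suc.prems Ck_Suc_imp_Ck by blast+
  ultimately show ?case using Suc by (auto intro!: Ck_add)
qed

lemma compact_closure_iff_bounded:
  "compact (closure (S::(real^'n::finite) set)) \<longleftrightarrow> bounded S"
  by (metis bounded_closure bounded_subset closed_closure closure_subset compact_eq_bounded_closed)

lemma test_function_iff:
  "test_function \<phi> \<longleftrightarrow> (\<forall>k. Ck k \<phi>) \<and> (\<exists>R. \<forall>x. R < norm x \<longrightarrow> \<phi> x = 0)"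
  unfolding test_function_def compact_closure_iff_bounded bounded_iff
  by (auto simp: not_less[symmetric])

lemma test_function_Ck: "test_function \<phi> \<Longrightarrow> Ck k \<phi>"
  by (simp add: test_function_def)

lemma test_function_differentiable: "test_function \<phi> \<Longrightarrow> \<phi> differentiable (at x)"
  using test_function_Ck[of \<phi> "Suc 0"] by simp

lemma test_function_continuous: "test_function \<phi> \<Longrightarrow> continuous_on S \<phi>"
  using test_function_Ck[of \<phi> 0] by (auto intro: continuous_on_subset)

lemma test_function_vanishes:
  assumes "test_function \<phi>" shows "\<exists>R>0. \<forall>x. R < norm x \<longrightarrow> \<phi> x = 0"
proof -
  obtain R where "\<forall>x. R < norm x \<longrightarrow> \<phi> x = 0" using assms unfolding test_function_iff by auto
  then show ?thesis by (intro exI[of _ "max R 1"]) auto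
qed

lemma pderivative_vanishes:
  fixes \<phi> :: "real^'n::finite \<Rightarrow> real"
  assumes "\<And>x. R < norm x \<Longrightarrow> \<phi> x = 0" "R < norm x"
  shows "pderivative i \<phi> x = 0"
proof -
  have "open {y::real^'n. R < norm y}" by (intro open_Collect_less continuous_intros)
  then have "(\<phi> has_derivative (\<lambda>_. 0)) (at x)"
    using has_derivative_transform_within_open[of "\<lambda>_. 0" "\<lambda>_. 0" x UNIV "{y. R < norm y}" \<phi>]
      assms by simp
  from pderivative_eqI[OF this] show ?thesis .
qed

lemma test_function_pderivative:
  assumes "test_function \<phi>" shows "test_function (pderivative i \<phi>)"
proof -
  obtain R where R: "R > 0" "\<And>x. R < norm x \<Longrightarrow> \<phi> x = 0" using test_function_vanishes[OF assms] by metis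
  have "Ck k (pderivative i \<phi>)" for k using test_function_Ck[OF assms, of "Suc k"] by simp
  moreover have "pderivative i \<phi> x = 0" if "R < norm x" for x
    using pderivative_vanishes[OF R(2) that] .
  ultimately show ?thesis unfolding test_function_iff by blast
qed

lemma test_function_cmult:
  assumes "test_function \<phi>" shows "test_function (\<lambda>x. c * \<phi> x)"
  using assms unfolding test_function_iff by (auto intro!: Ck_mult Ck_const)

lemma test_function_zero: "test_function (\<lambda>_. 0)"
  unfolding test_function_iff by (auto intro: Ck_const)

lemma pderivative_cmult:
  assumes "test_function \<phi>"
  shows "pderivative i (\<lambda>x. c * \<phi> x) = (\<lambda>x. c * pderivative i \<phi> x)"
  by (rule ext, subst pderivative_mult)
     (auto simp: pderivative_const test_function_differentiable[OF assms])

lemma test_function_bounded: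
  assumes "test_function \<phi>" shows "\<exists>B>0. \<forall>x. \<bar>\<phi> x\<bar> \<le> B"
proof -
  obtain R where R: "R > 0" "\<And>x. R < norm x \<Longrightarrow> \<phi> x = 0" using test_function_vanishes[OF assms] by metis
  have "compact (\<phi> ` cball 0 R)"
    by (intro compact_continuous_image test_function_continuous assms compact_cball)
  then obtain B where B: "B > 0" "\<forall>y\<in>\<phi> ` cball 0 R. norm y \<le> B"
    using bounded_pos[of "\<phi> ` cball 0 R"] compact_imp_bounded by blast
  have "\<bar>\<phi> x\<bar> \<le> B" for x
    using R(2)[of x] B by (cases "R < norm x") auto
  then show ?thesis using \<open>B > 0\<close> by blast
qed

lemma test_function_uniformly_continuous:
  fixes \<phi> :: "real^'n::finite \<Rightarrow> real"
  assumes "test_function \<phi>" and "e > 0"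
  shows "\<exists>d>0. \<forall>x y. norm (x - y) < d \<longrightarrow> \<bar>\<phi> x - \<phi> y\<bar> < e"
proof -
  obtain R where R: "R > 0" "\<And>x. R < norm x \<Longrightarrow> \<phi> x = 0" using test_function_vanishes[OF assms(1)]
    by metis
  have "uniformly_continuous_on (cball 0 (R+1)) \<phi>"
    by (intro compact_uniformly_continuous test_function_continuous assms compact_cball)
  then obtain d where d: "d > 0" "\<And>x y. x \<in> cball 0 (R+1) \<Longrightarrow> y \<in> cball 0 (R+1) \<Longrightarrow> dist x y < d
      \<Longrightarrow> dist (\<phi> x) (\<phi> y) < e"
    using \<open>e > 0\<close> unfolding uniformly_continuous_on_def by (metis dist_commute)
  show ?thesis
  proof (intro exI[of _ "min d 1"] conjI allI impI)
    fix x y :: "real^'n" assume xy: "norm (x - y) < min d 1"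
    then have n: "norm x \<le> norm y + 1" "norm y \<le> norm x + 1"
      using norm_triangle_ineq2[of x y] norm_triangle_ineq2[of y x] by (auto simp: norm_minus_commute)
    show "\<bar>\<phi> x - \<phi> y\<bar> < e"
    proof (cases "norm x \<le> R \<or> norm y \<le> R")
      case True
      then have "norm x \<le> R+1" "norm y \<le> R+1" using n by auto
      with d(2)[of x y] xy show ?thesis by (auto simp: dist_norm)
    next
      case False then show ?thesis using R \<open>e > 0\<close> by simp
    qed
  qed (use d in auto)
qed

lemma test_function_borel_measurable [measurable_dest]:
  "test_function \<phi> \<Longrightarrow> \<phi> \<in> borel_measurable borel"
  using borel_measurable_continuous_onI test_function_continuous by blast

lemma test_function_integrable:
  fixes \<phi> :: "real^'n::finite \<Rightarrow> real"
  assumes "test_function \<phi>" shows "integrable lborel \<phi>"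
proof -
  obtain R where R: "R > 0" "\<And>x. R < norm x \<Longrightarrow> \<phi> x = 0" using test_function_vanishes[OF assms] by metis
  have "integrable lborel (\<lambda>x. indicator (cball 0 R) x *\<^sub>R \<phi> x)"
    by (intro borel_integrable_compact test_function_continuous assms compact_cball)
  moreover have "(\<lambda>x. indicator (cball 0 R) x *\<^sub>R \<phi> x) = \<phi>"
    using R(2) by (intro ext) (auto simp: indicator_def)
  ultimately show ?thesis by metis
qed

lemma test_function_line_derivative:
  fixes \<phi> :: "real^'n::finite \<Rightarrow> real"
  assumes "test_function \<phi>"
  shows "((\<lambda>t. \<phi> (x + t *\<^sub>R k)) has_real_derivative (\<Sum>i\<in>UNIV. k$i * pderivative i \<phi> (x
      + t *\<^sub>R k))) (at t)"
proof -
  have "((\<lambda>t. \<phi> (x + t *\<^sub>R k)) has_derivative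
      (\<lambda>s. \<Sum>i\<in>UNIV. (s *\<^sub>R k)$i * pderivative i \<phi> (x + t *\<^sub>R k))) (at t)"
    by (rule has_derivative_compose[OF _ has_derivative_pderivative[OF
        test_function_differentiable[OF assms]],
          of "\<lambda>t. x + t *\<^sub>R k" "\<lambda>s. s *\<^sub>R k"])
       (auto intro!: derivative_eq_intros)
  then show ?thesis
    unfolding has_field_derivative_def
    by (rule has_derivative_eq_rhs) (auto simp: sum_distrib_left mult_ac)
qed

text \<open>The expansion is uniform in the base point because the partial derivatives are uniformly
  continuous; this is what permits differentiation under an integral.\<close>

lemma test_function_uniform_taylor:
  fixes \<phi> :: "real^'n::finite \<Rightarrow> real"
  assumes \<phi>: "test_function \<phi>" and "e > 0"
  shows "\<exists>d>0. \<forall>x k. norm k < d \<longrightarrow>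
    \<bar>\<phi> (x + k) - \<phi> x - (\<Sum>i\<in>UNIV. k$i * pderivative i \<phi> x)\<bar> \<le> e * norm k"
proof -
  define e' where "e' = e / real CARD('n)"
  have e': "e' > 0" using \<open>e > 0\<close> by (simp add: e'_def)
  have "\<exists>d>0. \<forall>x y. norm (x - y) < d \<longrightarrow> \<bar>pderivative i \<phi> x - pderivative i \<phi> y\<bar> < e'" for i
    using test_function_uniformly_continuous[OF test_function_pderivative[OF \<phi>] e'] by metis
  then obtain d where d: "\<And>i. d i > 0"
    "\<And>i x y. norm (x - y) < d i \<Longrightarrow> \<bar>pderivative i \<phi> x - pderivative i \<phi> y\<bar> < e'" by metis
  define \<delta> where "\<delta> = Min (range d)"
  have \<delta>: "\<delta> > 0" "\<And>i. \<delta> \<le> d i" using d by (auto simp: \<delta>_def)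
  show ?thesis
  proof (intro exI[of _ \<delta>] conjI allI impI \<delta>(1))
    fix x k :: "real^'n" assume k: "norm k < \<delta>"
    obtain t where t: "0 < t" "t < 1"
      and eq: "\<phi> (x + 1 *\<^sub>R k) - \<phi> (x + 0 *\<^sub>R k)
          = (1 - 0) * (\<Sum>i\<in>UNIV. k$i * pderivative i \<phi> (x + t *\<^sub>R k))"
      using MVT2[of 0 1 "\<lambda>t. \<phi> (x + t *\<^sub>R k)", OF _ test_function_line_derivative[OF \<phi>]] by auto
    have "\<bar>\<phi> (x + k) - \<phi> x - (\<Sum>i\<in>UNIV. k$i * pderivative i \<phi> x)\<bar>
        = \<bar>\<Sum>i\<in>UNIV. k$i * (pderivative i \<phi> (x + t *\<^sub>R k) - pderivative i \<phi> x)\<bar>"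
      using eq by (simp add: right_diff_distrib sum_subtractf)
    also have "\<dots> \<le> (\<Sum>i\<in>(UNIV::'n set). norm k * e')"
    proof (rule order_trans[OF sum_abs sum_mono])
      fix i
      have "norm (t *\<^sub>R k) \<le> norm k" using t by (simp add: mult_left_le_one_le)
      then have "norm (x + t *\<^sub>R k - x) < d i" using k \<delta>(2)[of i] by simp
      from d(2)[OF this] have "\<bar>pderivative i \<phi> (x + t *\<^sub>R k) - pderivative i \<phi> x\<bar> \<le> e'" by simp
      then show "\<bar>k$i * (pderivative i \<phi> (x + t *\<^sub>R k) - pderivative i \<phi> x)\<bar> \<le> norm k * e'"
        unfolding abs_mult by (intro mult_mono component_le_norm_cart) auto
    qed
    also have "\<dots> = e * norm k" by (simp add: e'_def)
    finally show "\<bar>\<phi> (x + k) - \<phi> x - (\<Sum>i\<in>UNIV. k$i * pderivative i \<phi> x)\<bar> \<le> e * norm k" .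
  qed
qed

text \<open>A superposition of translates of a test function, with bounded shifts and integrable weights, is
  again a test function. Keeping the parameter space abstract covers mollification (shifts by
  points of space), the averages along a segment that occur for difference quotients, and a single
  translation.\<close>

lemma
  fixes \<phi> :: "real^'n::finite \<Rightarrow> real" and T :: "'a \<Rightarrow> real^'n" and w :: "'a \<Rightarrow> real"
  assumes \<phi>: "test_function \<phi>" and T [measurable]: "T \<in> borel_measurable M"
    and w: "integrable M w" and R: "\<And>\<omega>. w \<omega> \<noteq> 0 \<Longrightarrow> norm (T \<omega>) \<le> R"
  shows superposition_integrable: "integrable M (\<lambda>\<omega>. \<phi> (x - T \<omega>) * w \<omega>)"
    and pderivative_superposition:
      "pderivative i (\<lambda>x. \<integral>\<omega>. \<phi> (x - T \<omega>) * w \<omega> \<partial>M) = (\<lambda>x. \<integral>\<omega>. pderivative i \<phi> (x - T \<omega>) * w \<omega> \<partial>M)"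
    and test_function_superposition: "test_function (\<lambda>x. \<integral>\<omega>. \<phi> (x - T \<omega>) * w \<omega> \<partial>M)"
proof -
  have [measurable]: "w \<in> borel_measurable M" using w by auto
  have int: "integrable M (\<lambda>\<omega>. \<psi> (x - T \<omega>) * w \<omega>)" if \<psi>: "test_function \<psi>" for \<psi> x
  proof -
    obtain B where B: "B > 0" "\<forall>x. \<bar>\<psi> x\<bar> \<le> B" using test_function_bounded[OF \<psi>] by blast
    have [measurable]: "\<psi> \<in> borel_measurable borel" using \<psi> by measurable
    show ?thesis
      by (rule Bochner_Integration.integrable_bound[where f="\<lambda>\<omega>. B * w \<omega>"])
         (use w B in \<open>auto simp: abs_mult intro!: mult_right_mono AE_I2 abs_le_self_iff[THEN iffD2]
             order_trans[OF B(2)[rule_format]]\<close>)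
  qed
  show "integrable M (\<lambda>\<omega>. \<phi> (x - T \<omega>) * w \<omega>)" by (rule int[OF \<phi>])
  have der: "((\<lambda>x. \<integral>\<omega>. \<psi> (x - T \<omega>) * w \<omega> \<partial>M) has_derivative
      (\<lambda>h. \<Sum>i\<in>UNIV. h$i * (\<integral>\<omega>. pderivative i \<psi> (x - T \<omega>) * w \<omega> \<partial>M))) (at x)" if \<psi>: "test_function \<psi>"
          for \<psi> x
    unfolding has_derivative_at_alt
  proof (intro conjI allI impI)
    show "bounded_linear (\<lambda>h. \<Sum>i\<in>UNIV. h$i * (\<integral>\<omega>. pderivative i \<psi> (x - T \<omega>) * w \<omega> \<partial>M))"
      by (intro bounded_linear_sum bounded_linear_mult_left[THEN bounded_linear_compose]
          bounded_linear_vec_nth)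
    fix e :: real assume "e > 0"
    define W where "W = (\<integral>\<omega>. \<bar>w \<omega>\<bar> \<partial>M)"
    have W: "W \<ge> 0" by (simp add: W_def)
    define e' where "e' = e / (W + 1)"
    have e': "e' > 0" "e' * W \<le> e" using W \<open>e > 0\<close> by (auto simp: e'_def field_simps)
    obtain d where d: "d > 0" and taylor: "\<And>x k. norm k < d \<Longrightarrow>
        \<bar>\<psi> (x + k) - \<psi> x - (\<Sum>i\<in>UNIV. k$i * pderivative i \<psi> x)\<bar> \<le> e' * norm k"
      using test_function_uniform_taylor[OF \<psi> e'(1)] by blast
    show "\<exists>d>0. \<forall>y. norm (y - x) < d \<longrightarrow>
       norm ((\<integral>\<omega>. \<psi> (y - T \<omega>) * w \<omega> \<partial>M) - (\<integral>\<omega>. \<psi> (x - T \<omega>) * w \<omega> \<partial>M)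
         - (\<Sum>i\<in>UNIV. (y - x)$i * (\<integral>\<omega>. pderivative i \<psi> (x - T \<omega>) * w \<omega> \<partial>M))) \<le> e * norm (y - x)"
    proof (intro exI[of _ d] conjI d allI impI)
      fix y assume y: "norm (y - x) < d"
      have "(\<integral>\<omega>. \<psi> (y - T \<omega>) * w \<omega> \<partial>M) - (\<integral>\<omega>. \<psi> (x - T \<omega>) * w \<omega> \<partial>M)
         - (\<Sum>i\<in>UNIV. (y - x)$i * (\<integral>\<omega>. pderivative i \<psi> (x - T \<omega>) * w \<omega> \<partial>M))
         = (\<integral>\<omega>. \<psi> (y - T \<omega>) * w \<omega> - \<psi> (x - T \<omega>) * w \<omega>
             - (\<Sum>i\<in>UNIV. (y - x)$i * (pderivative i \<psi> (x - T \<omega>) * w \<omega>)) \<partial>M)"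
        using int[OF \<psi>] int[OF test_function_pderivative[OF \<psi>]] by simp
      also have "norm \<dots> \<le> (\<integral>\<omega>. (e' * norm (y - x)) * \<bar>w \<omega>\<bar> \<partial>M)"
      proof (rule order_trans[OF integral_norm_bound integral_mono])
        fix \<omega>
        have "\<psi> (y - T \<omega>) * w \<omega> - \<psi> (x - T \<omega>) * w \<omega>
             - (\<Sum>i\<in>UNIV. (y - x)$i * (pderivative i \<psi> (x - T \<omega>) * w \<omega>))
           = (\<psi> ((x - T \<omega>) + (y - x)) - \<psi> (x - T \<omega>)
               - (\<Sum>i\<in>UNIV. (y - x)$i * pderivative i \<psi> (x - T \<omega>))) * w \<omega>"
          by (simp add: algebra_simps sum_distrib_left)
        also have "norm \<dots> \<le> e' * norm (y - x) * \<bar>w \<omega>\<bar>"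
          using taylor[OF y, of "x - T \<omega>"] by (simp add: abs_mult mult_right_mono)
        finally show "norm (\<psi> (y - T \<omega>) * w \<omega> - \<psi> (x - T \<omega>) * w \<omega>
             - (\<Sum>i\<in>UNIV. (y - x)$i * (pderivative i \<psi> (x - T \<omega>) * w \<omega>))) \<le> e' * norm (y - x) * \<bar>w \<omega>\<bar>" .
      qed (use int[OF \<psi>] int[OF test_function_pderivative[OF \<psi>]] w in \<open>auto intro!:
          Bochner_Integration.integrable_diff Bochner_Integration.integrable_sum\<close>)
      also have "\<dots> = (e' * W) * norm (y - x)" by (simp add: W_def)
      also have "\<dots> \<le> e * norm (y - x)" using e'(2) by (intro mult_right_mono) auto
      finally show "norm ((\<integral>\<omega>. \<psi> (y - T \<omega>) * w \<omega> \<partial>M) - (\<integral>\<omega>. \<psi> (x - T \<omega>) * w \<omega> \<partial>M)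
         - (\<Sum>i\<in>UNIV. (y - x)$i * (\<integral>\<omega>. pderivative i \<psi> (x - T \<omega>) * w \<omega> \<partial>M))) \<le> e * norm (y - x)" .
    qed
  qed
  have pd: "pderivative i (\<lambda>x. \<integral>\<omega>. \<psi> (x - T \<omega>) * w \<omega> \<partial>M) = (\<lambda>x. \<integral>\<omega>. pderivative i \<psi> (x - T \<omega>) * w \<omega> \<partial>M)"
    if "test_function \<psi>" for \<psi> i
    by (rule ext, subst pderivative_eqI[OF der[OF that]]) (simp add: axis_def if_distrib[of
        "\<lambda>a. a * _"] cong: if_cong)
  show "pderivative i (\<lambda>x. \<integral>\<omega>. \<phi> (x - T \<omega>) * w \<omega> \<partial>M) = (\<lambda>x. \<integral>\<omega>. pderivative i \<phi> (x - T \<omega>) * w \<omega> \<partial>M)"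
    by (rule pd[OF \<phi>])
  have "Ck k (\<lambda>x. \<integral>\<omega>. \<psi> (x - T \<omega>) * w \<omega> \<partial>M)" if "test_function \<psi>" for \<psi> k
    using that
  proof (induction k arbitrary: \<psi>)
    case 0
    then show ?case
      by (auto intro!: continuous_at_imp_continuous_on has_derivative_continuous der)
  next
    case (Suc k)
    then show ?case
      using der[OF Suc.prems] pd[OF Suc.prems] test_function_pderivative[OF Suc.prems]
      by (auto simp: differentiable_def)
  qed
  moreover
  obtain S where S: "S > 0" "\<And>x. S < norm x \<Longrightarrow> \<phi> x = 0" using test_function_vanishes[OF \<phi>] by metis
  have "(\<integral>\<omega>. \<phi> (x - T \<omega>) * w \<omega> \<partial>M) = 0" if "S + R < norm x" for x
  proof -
    have "\<phi> (x - T \<omega>) * w \<omega> = 0" for \<omega>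
    proof (cases "w \<omega> = 0")
      case False
      then have "S < norm (x - T \<omega>)" using R[OF False] that norm_triangle_ineq2[of x "T \<omega>"] by linarith
      then show ?thesis using S by simp
    qed simp
    then show ?thesis by (simp only: Bochner_Integration.integral_zero)
  qed
  ultimately show "test_function (\<lambda>x. \<integral>\<omega>. \<phi> (x - T \<omega>) * w \<omega> \<partial>M)"
    using \<phi> unfolding test_function_iff by blast
qed

section \<open>Second derivatives of test functions\<close>

definition hess :: "(real^'n::finite \<Rightarrow> real) \<Rightarrow> 'n \<Rightarrow> 'n \<Rightarrow> real^'n \<Rightarrow> real" where
  "hess \<phi> i j = pderivative i (pderivative j \<phi>)"

lemma test_function_hess: "test_function \<phi> \<Longrightarrow> test_function (hess \<phi> i j)"
  by (simp add: hess_def test_function_pderivative)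

lemma mixed_difference_mvt:
  fixes \<phi> :: "real^'n::finite \<Rightarrow> real"
  assumes \<phi>: "test_function \<phi>" and s: "s > 0"
  shows "\<exists>a b. norm a \<le> s \<and> norm b \<le> s \<and>
    \<phi> (x + s *\<^sub>R axis i 1 + s *\<^sub>R axis j 1) - \<phi> (x + s *\<^sub>R axis i 1) - \<phi> (x + s *\<^sub>R axis j 1) + \<phi> x
     = s\<^sup>2 * hess \<phi> j i (x + a + b)"
proof -
  let ?ei = "axis i 1 :: real^'n" and ?ej = "axis j 1 :: real^'n"
  have ax: "(\<Sum>k\<in>UNIV. axis i 1 $ k * f k) = f i" for i and f :: "'n \<Rightarrow> real"
    by (simp add: axis_def if_distrib[of "\<lambda>a. a * _"] cong: if_cong)
  have d1: "((\<lambda>t. \<phi> ((x + s *\<^sub>R ?ej) + t *\<^sub>R ?ei) - \<phi> (x + t *\<^sub>R ?ei)) has_real_derivative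
     pderivative i \<phi> ((x + s *\<^sub>R ?ej) + t *\<^sub>R ?ei) - pderivative i \<phi> (x + t *\<^sub>R ?ei)) (at t)" for t
    using DERIV_diff[OF test_function_line_derivative[OF \<phi>, of
        "x + s *\<^sub>R ?ej" ?ei] test_function_line_derivative[OF \<phi>, of x ?ei]]
    by (simp add: ax)
  obtain t where t: "0 < t" "t < s" and
    eq1: "(\<phi> ((x + s *\<^sub>R ?ej) + s *\<^sub>R ?ei) - \<phi> (x + s *\<^sub>R ?ei)) - (\<phi> ((x + s *\<^sub>R ?ej) + 0 *\<^sub>R ?ei)
        - \<phi> (x + 0 *\<^sub>R ?ei))
      = (s - 0) * (pderivative i \<phi> ((x + s *\<^sub>R ?ej) + t *\<^sub>R ?ei) - pderivative i \<phi> (x + t *\<^sub>R ?ei))"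
    using MVT2[OF s d1] by blast
  have d2: "((\<lambda>r. pderivative i \<phi> ((x + t *\<^sub>R ?ei) + r *\<^sub>R ?ej)) has_real_derivative
     hess \<phi> j i ((x + t *\<^sub>R ?ei) + r *\<^sub>R ?ej)) (at r)" for r
    using test_function_line_derivative[OF test_function_pderivative[OF \<phi>], of i "x + t *\<^sub>R ?ei" ?ej]
    by (simp add: ax hess_def)
  obtain r where r: "0 < r" "r < s" and
    eq2: "pderivative i \<phi> ((x + t *\<^sub>R ?ei) + s *\<^sub>R ?ej) - pderivative i \<phi> ((x + t *\<^sub>R ?ei) + 0 *\<^sub>R ?ej)
      = (s - 0) * hess \<phi> j i ((x + t *\<^sub>R ?ei) + r *\<^sub>R ?ej)"
    using MVT2[OF s d2] by blast
  show ?thesis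
    using t r eq1 eq2
    by (intro exI[of _ "t *\<^sub>R ?ei"] exI[of _
        "r *\<^sub>R ?ej"]) (simp add: norm_axis_1 algebra_simps power2_eq_square)
qed

text \<open>The mixed second difference over a small square is symmetric in the two directions, and it
  equals either mixed derivative at some point of the square.\<close>

lemma hess_symmetric:
  fixes \<phi> :: "real^'n::finite \<Rightarrow> real"
  assumes \<phi>: "test_function \<phi>" shows "hess \<phi> i j x = hess \<phi> j i x"
proof (rule ccontr)
  assume neq: "hess \<phi> i j x \<noteq> hess \<phi> j i x"
  define e where "e = \<bar>hess \<phi> i j x - hess \<phi> j i x\<bar> / 2"
  have e: "e > 0" using neq by (simp add: e_def)
  obtain d1 where d1: "d1 > 0" "\<And>x y. norm (x - y) < d1 \<Longrightarrow> \<bar>hess \<phi> i j x - hess \<phi> i j y\<bar> < e"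
    using test_function_uniformly_continuous[OF test_function_hess[OF \<phi>] e] by blast
  obtain d2 where d2: "d2 > 0" "\<And>x y. norm (x - y) < d2 \<Longrightarrow> \<bar>hess \<phi> j i x - hess \<phi> j i y\<bar> < e"
    using test_function_uniformly_continuous[OF test_function_hess[OF \<phi>] e] by blast
  define s where "s = min d1 d2 / 3"
  have s: "s > 0" "2 * s < d1" "2 * s < d2" using d1 d2 by (auto simp: s_def)
  obtain a b where ab: "norm a \<le> s" "norm b \<le> s"
    "\<phi> (x + s *\<^sub>R axis i 1 + s *\<^sub>R axis j 1) - \<phi> (x + s *\<^sub>R axis i 1) - \<phi> (x + s *\<^sub>R axis j 1) + \<phi> x
     = s\<^sup>2 * hess \<phi> j i (x + a + b)"
    using mixed_difference_mvt[OF \<phi> s(1)] by blast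
  obtain a' b' where ab': "norm a' \<le> s" "norm b' \<le> s"
    "\<phi> (x + s *\<^sub>R axis j 1 + s *\<^sub>R axis i 1) - \<phi> (x + s *\<^sub>R axis j 1) - \<phi> (x + s *\<^sub>R axis i 1) + \<phi> x
     = s\<^sup>2 * hess \<phi> i j (x + a' + b')"
    using mixed_difference_mvt[OF \<phi> s(1)] by blast
  have "s\<^sup>2 * hess \<phi> i j (x + a' + b') = s\<^sup>2 * hess \<phi> j i (x + a + b)"
    unfolding ab(3)[symmetric] ab'(3)[symmetric] by (simp add: algebra_simps)
  then have "hess \<phi> i j (x + a' + b') = hess \<phi> j i (x + a + b)" using s by simp
  moreover have "\<bar>hess \<phi> i j (x + a' + b') - hess \<phi> i j x\<bar> < e"
    using ab' s norm_triangle_ineq[of a' b'] by (intro d1(2)) (simp add: add.assoc)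
  moreover have "\<bar>hess \<phi> j i (x + a + b) - hess \<phi> j i x\<bar> < e"
    using ab s norm_triangle_ineq[of a b] by (intro d2(2)) (simp add: add.assoc)
  ultimately show False unfolding e_def by (smt (verit) field_sum_of_halves)
qed

section \<open>Mollifiers\<close>

text \<open>The whole family is needed, since it is closed under differentiation up to linear combinations;
  smoothness is then an induction over the order of differentiability, simultaneously for all m.\<close>

definition flat :: "nat \<Rightarrow> real \<Rightarrow> real" where
  "flat m t = (if t > 0 then exp (- (1 / t)) / t ^ m else 0)"

lemma flat_tendsto_0: "((\<lambda>t. flat m t) \<longlongrightarrow> 0) (at 0)"
proof -
  have "((\<lambda>s::real. s ^ m / exp s) \<longlongrightarrow> 0) at_top" by (rule tendsto_power_div_exp_0)
  then have "((\<lambda>t::real. inverse t ^ m / exp (inverse t)) \<longlongrightarrow> 0) (at_right 0)"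
    by (rule filterlim_compose[OF _ filterlim_inverse_at_top_right])
  then have "((\<lambda>t. flat m t) \<longlongrightarrow> 0) (at_right 0)"
    by (rule Lim_transform_eventually)
       (auto simp: flat_def eventually_at_right_less divide_simps exp_minus
           eventually_at_right_field intro!: exI[of _ 1])
  moreover have "((\<lambda>t. flat m t) \<longlongrightarrow> 0) (at_left 0)"
    by (rule Lim_transform_eventually[OF tendsto_const])
       (auto simp: flat_def eventually_at_left_field intro!: exI[of _ "-1"])
  ultimately show ?thesis by (simp add: filterlim_split_at)
qed

lemma flat_has_derivative:
  "(flat m has_real_derivative (flat (m+2) t - real m * flat (m+1) t)) (at t)"
proof -
  consider "t > 0" | "t < 0" | "t = 0" by linarith
  then show ?thesis
  proof cases
    case 1
    have "((\<lambda>t. exp (- (1 / t)) / t ^ m) has_real_derivative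
        (exp (- (1 / t)) * (1 / t\<^sup>2) * t ^ m
            - exp (- (1 / t)) * (real m * t ^ (m - 1))) / (t ^ m * t ^ m)) (at t)"
      using 1 by (auto intro!: derivative_eq_intros simp: power2_eq_square)
    moreover have "(exp (- (1 / t)) * (1 / t\<^sup>2) * t ^ m
        - exp (- (1 / t)) * (real m * t ^ (m - 1))) / (t ^ m * t ^ m)
        = flat (m+2) t - real m * flat (m+1) t"
      using 1 by (cases m) (auto simp: flat_def field_simps power2_eq_square)
    ultimately have "((\<lambda>t. exp (- (1 / t)) / t ^ m) has_real_derivative (flat (m+2) t
        - real m * flat (m+1) t)) (at t)"
      by metis
    then show ?thesis
      by (rule has_field_derivative_transform_within_open[where S="{0<..}"])
          (use 1 in \<open>auto simp: flat_def\<close>)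
  next
    case 2
    have "((\<lambda>t. 0) has_real_derivative (flat (m+2) t - real m * flat (m+1) t)) (at t)"
      using 2 by (auto simp: flat_def)
    then show ?thesis
      by (rule has_field_derivative_transform_within_open[where S="{..<0}"])
          (use 2 in \<open>auto simp: flat_def\<close>)
  next
    case 3
    have "((\<lambda>h. flat (m+1) h) \<longlongrightarrow> 0) (at 0)" by (rule flat_tendsto_0)
    moreover have "flat (m+1) h = (flat m (0 + h) - flat m 0) / h" for h
      by (auto simp: flat_def)
    ultimately show ?thesis using 3 unfolding DERIV_def by (simp add: flat_def)
  qed
qed

lemma Ck_flat: "Ck k (\<lambda>x::real^'n::finite. flat m (c - x \<bullet> x))"
proof -
  have der: "((\<lambda>x::real^'n. flat m (c - x \<bullet> x)) has_derivative
      (\<lambda>h. (flat (m+2) (c - x \<bullet> x) - real m * flat (m+1) (c - x \<bullet> x)) * (- 2 * (x \<bullet> h)))) (at x)"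
          for x m
    by (rule has_derivative_compose[OF _ flat_has_derivative[unfolded has_field_derivative_def],
        THEN has_derivative_eq_rhs])
       (auto intro!: derivative_eq_intros simp: inner_commute algebra_simps)
  have pd: "pderivative i (\<lambda>x::real^'n. flat m (c - x \<bullet> x)) =
      (\<lambda>x. (flat (m+2) (c - x \<bullet> x) + (- real m) * flat (m+1) (c - x \<bullet> x)) * (- 2 * x $ i))" for i m
    by (rule ext, subst pderivative_eqI[OF der]) (simp add: inner_axis)
  show ?thesis
  proof (induction k arbitrary: m)
    case 0
    show ?case using has_derivative_continuous[OF der] by (auto intro!: continuous_at_imp_continuous_on)
  next
    case (Suc k)
    have "(\<lambda>x::real^'n. flat m (c - x \<bullet> x)) differentiable (at x)" for x
      using der differentiable_def by blast
    then show ?case unfolding Ck.simps pd by (intro conjI allI Ck_mult Ck_add Ck_const Ck_nth Suc)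
  qed
qed

definition mollifier :: "real \<Rightarrow> (real^'n::finite \<Rightarrow> real) \<Rightarrow> bool" where
  "mollifier d \<eta> \<longleftrightarrow> test_function \<eta> \<and> (\<forall>x. \<eta> x \<ge> 0) \<and> (\<forall>x. d < norm x \<longrightarrow> \<eta> x
      = 0) \<and> (LINT x|lborel. \<eta> x) = 1"

lemma mollifier_exists:
  assumes "d > 0" shows "\<exists>\<eta>::real^'n::finite \<Rightarrow> real. mollifier d \<eta>"
proof -
  define b where "b x = flat 0 (d\<^sup>2 - x \<bullet> x)" for x :: "real^'n"
  have sq: "x \<bullet> x < d\<^sup>2 \<longleftrightarrow> norm x < d" for x :: "real^'n"
    using assms by (simp add: dot_square_norm power_mono_iff)
       (metis assms less_eq_real_def norm_ge_zero power_strict_mono power_less_imp_less_base pos2)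
  have b: "test_function b"
    unfolding test_function_iff b_def using sq
    by (intro conjI allI Ck_flat exI[of _ d]) (auto simp: flat_def not_less[symmetric])
  have pos: "b x \<ge> 0" for x by (simp add: b_def flat_def)
  have "(LINT x|lborel. b x) > 0"
  proof -
    have "(LINT x|lborel. b x) \<noteq> 0"
    proof
      assume "(LINT x|lborel. b x) = 0"
      then have "AE x in lborel. b x = 0"
        using integral_nonneg_eq_0_iff_AE[OF test_function_integrable[OF b]] pos by simp
      then have "ball (0::real^'n) d \<in> null_sets lborel"
        by (subst AE_iff_null_sets, simp, elim AE_mp) (auto simp: b_def flat_def sq)
      then show False using assms content_ball_pos[of d "0::real^'n"]
        by (simp add: null_sets_def measure_def)
    qed
    then show ?thesis using pos by (simp add: less_le)
  qed
  then show ?thesis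
    unfolding mollifier_def using test_function_cmult[OF b, of "1 / (LINT x|lborel. b x)"] pos sq
    by (intro exI[of _ "\<lambda>x. 1 / (LINT x|lborel. b x) * b x"]) (auto simp: b_def flat_def)
qed

section \<open>Integrable functions: translation, mollification, duality\<close>

text \<open>Translations and the point reflections \<open>x \<mapsto> t - x\<close> preserve Lebesgue measure; both are cases of
  one affine map with factor \<open>c = \<plusminus>1\<close>.\<close>

lemma lborel_distr_affine_isometry:
  fixes t :: "'a::euclidean_space"
  assumes "\<bar>c\<bar> = 1"
  shows "distr lborel borel (\<lambda>x. t + c *\<^sub>R x) = lborel"
  using lborel_affine[of c t] assms by (auto simp: density_1)

lemma
  fixes f :: "'a::euclidean_space \<Rightarrow> 'b::{banach, second_countable_topology}"
  assumes [measurable]: "f \<in> borel_measurable borel"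
  shows integral_lborel_shift: "(LINT x|lborel. f (x + a)) = (LINT x|lborel. f x)"
    and integral_lborel_reflect: "(LINT x|lborel. f (a - x)) = (LINT x|lborel. f x)"
    and integrable_lborel_shift: "integrable lborel (\<lambda>x. f (x + a)) \<longleftrightarrow> integrable lborel f"
    and integrable_lborel_reflect: "integrable lborel (\<lambda>x. f (a - x)) \<longleftrightarrow> integrable lborel f"
proof -
  have s: "distr lborel borel (\<lambda>x. x + a) = lborel"
    using lborel_distr_affine_isometry[of 1 a] by (simp add: add.commute)
  have r: "distr lborel borel (\<lambda>x. a - x) = lborel"
    using lborel_distr_affine_isometry[of "-1" a] by simp
  have "(LINT x|distr lborel borel (\<lambda>x. x + a). f x) = (LINT x|lborel. f (x + a))"
    by (rule integral_distr) auto
  then show "(LINT x|lborel. f (x + a)) = (LINT x|lborel. f x)" unfolding s ..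
  have "(LINT x|distr lborel borel (\<lambda>x. a - x). f x) = (LINT x|lborel. f (a - x))"
    by (rule integral_distr) auto
  then show "(LINT x|lborel. f (a - x)) = (LINT x|lborel. f x)" unfolding r ..
  have "integrable (distr lborel borel (\<lambda>x. x + a)) f \<longleftrightarrow> integrable lborel (\<lambda>x. f (x + a))"
    by (rule integrable_distr_eq) auto
  then show "integrable lborel (\<lambda>x. f (x + a)) \<longleftrightarrow> integrable lborel f" unfolding s ..
  have "integrable (distr lborel borel (\<lambda>x. a - x)) f \<longleftrightarrow> integrable lborel (\<lambda>x. f (a - x))"
    by (rule integrable_distr_eq) auto
  then show "integrable lborel (\<lambda>x. f (a - x)) \<longleftrightarrow> integrable lborel f" unfolding r ..
qed

definition shift_error :: "('a::euclidean_space \<Rightarrow> 'b::euclidean_space) \<Rightarrow> 'a \<Rightarrow> real" where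
  "shift_error f h = (LINT x|lborel. norm (f (x + h) - f x))"

lemma shift_error_nonneg: "shift_error f h \<ge> 0"
  by (simp add: shift_error_def)

lemma integrable_shift_lborel [simp, intro]:
  fixes f :: "'a::euclidean_space \<Rightarrow> 'b::euclidean_space"
  shows "integrable lborel f \<Longrightarrow> integrable lborel (\<lambda>x. f (x + h))"
  by (subst integrable_lborel_shift) auto

lemma shift_error_add:
  fixes f g :: "'a::euclidean_space \<Rightarrow> 'b::euclidean_space"
  assumes "integrable lborel f" "integrable lborel g"
  shows "shift_error (\<lambda>x. f x + g x) h \<le> shift_error f h + shift_error g h"
proof -
  have "shift_error (\<lambda>x. f x + g x) h
      \<le> (LINT x|lborel. norm (f (x + h) - f x) + norm (g (x + h) - g x))"
    unfolding shift_error_def using assms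
    by (intro integral_mono) (auto simp: add_diff_add norm_triangle_ineq)
  also have "\<dots> = shift_error f h + shift_error g h"
    unfolding shift_error_def using assms by (intro Bochner_Integration.integral_add) auto
  finally show ?thesis .
qed

lemma shift_error_approx:
  fixes f g :: "'a::euclidean_space \<Rightarrow> 'b::euclidean_space"
  assumes f: "integrable lborel f" and g: "integrable lborel g"
  shows "shift_error f h \<le> 2 * (LINT x|lborel. norm (f x - g x)) + shift_error g h"
proof -
  have "shift_error (\<lambda>x. f x - g x) h \<le> (LINT x|lborel. norm (f (x+h) - g (x+h)) + norm (f x - g x))"
    unfolding shift_error_def using f g by (intro integral_mono) (auto simp: norm_triangle_ineq4)
  also have "\<dots> = (LINT x|lborel. norm (f (x+h) - g (x+h))) + (LINT x|lborel. norm (f x - g x))"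
    using f g by (intro Bochner_Integration.integral_add) auto
  also have "(LINT x|lborel. norm (f (x+h) - g (x+h))) = (LINT x|lborel. norm (f x - g x))"
    using f g by (intro integral_lborel_shift[where f="\<lambda>x. norm (f x - g x)"]) auto
  finally have "shift_error (\<lambda>x. f x - g x) h \<le> 2 * (LINT x|lborel. norm (f x - g x))" by simp
  moreover have "shift_error f h \<le> shift_error (\<lambda>x. f x - g x) h + shift_error g h"
    using shift_error_add[of "\<lambda>x. f x - g x" g h] f g by simp
  ultimately show ?thesis by simp
qed

lemma shift_error_tendsto_by_approximation:
  fixes f :: "'a::euclidean_space \<Rightarrow> 'b::euclidean_space"
  assumes f: "integrable lborel f"
    and g: "\<And>e. e > 0 \<Longrightarrow> \<exists>g. integrable lborel g \<and> (LINT x|lborel. norm (f x - g x)) < e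
              \<and> (\<lambda>n. shift_error g (h n)) \<longlonglongrightarrow> 0"
  shows "(\<lambda>n. shift_error f (h n)) \<longlonglongrightarrow> 0"
proof (rule order_tendstoI)
  fix e :: real assume "e > 0"
  then obtain g where g: "integrable lborel g" "(LINT x|lborel. norm (f x - g x)) < e / 4"
    "(\<lambda>n. shift_error g (h n)) \<longlonglongrightarrow> 0" using g[of "e/4"] by auto
  have "\<forall>\<^sub>F n in sequentially. shift_error g (h n) < e / 2"
    using g(3) \<open>e > 0\<close> by (intro order_tendstoD) auto
  then show "\<forall>\<^sub>F n in sequentially. shift_error f (h n) < e"
  proof eventually_elim
    case (elim n)
    then show ?case using shift_error_approx[OF f g(1), of "h n"] g(2) by linarith
  qed
next
  fix e :: real assume "e < 0"
  then show "\<forall>\<^sub>F n in sequentially. e < shift_error f (h n)"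
    by (intro always_eventually allI) (rule less_le_trans[OF _ shift_error_nonneg])
qed

text \<open>The set gained by translating U has the same measure as the set lost, and the indicator of the
  latter tends to 0 pointwise because U is open.\<close>

lemma shift_error_indicator_open:
  fixes U :: "'a::euclidean_space set" and c :: "'b::euclidean_space"
  assumes U: "open U" "emeasure lborel U < \<infinity>" and h: "h \<longlonglongrightarrow> 0"
  shows "(\<lambda>n. shift_error (\<lambda>x. indicator U x *\<^sub>R c) (h n)) \<longlonglongrightarrow> 0"
proof -
  let ?i = "indicator U :: 'a \<Rightarrow> real"
  have [measurable]: "U \<in> sets borel" using U by simp
  have int: "integrable lborel ?i" using U by simp
  have int2: "integrable lborel (\<lambda>x. ?i x * ?i (x + a))" for a
    by (rule Bochner_Integration.integrable_bound[OF int]) (auto simp: indicator_def)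
  have "shift_error (\<lambda>x. ?i x *\<^sub>R c) a = norm c * (2 * (LINT x|lborel. ?i x * (1 - ?i (x + a))))" for a
  proof -
    have "norm (?i (x + a) *\<^sub>R c - ?i x *\<^sub>R c)
        = norm c * (?i (x + a) + ?i x - 2 * (?i x * ?i (x + a)))" for x
      by (auto simp: indicator_def)
    then have "shift_error (\<lambda>x. ?i x *\<^sub>R c) a
        = norm c * (LINT x|lborel. ?i (x + a) + ?i x - 2 * (?i x * ?i (x + a)))"
      unfolding shift_error_def by simp
    also have "(LINT x|lborel. ?i (x + a) + ?i x - 2 * (?i x * ?i (x + a)))
       = (LINT x|lborel. ?i (x + a)) + (LINT x|lborel. ?i x) - 2 * (LINT x|lborel. ?i x * ?i (x + a))"
      using int int2 integrable_shift_lborel[OF int] by simp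
    also have "(LINT x|lborel. ?i (x + a)) = (LINT x|lborel. ?i x)"
      by (rule integral_lborel_shift) auto
    also have "(LINT x|lborel. ?i x) + (LINT x|lborel. ?i x) - 2 * (LINT x|lborel. ?i x * ?i (x + a))
      = 2 * (LINT x|lborel. ?i x * (1 - ?i (x + a)))"
      using int int2 by (simp add: right_diff_distrib)
    finally show ?thesis .
  qed
  moreover have "(\<lambda>n. LINT x|lborel. ?i x * (1 - ?i (x + h n))) \<longlonglongrightarrow> (LINT x|(lborel::'a measure). 0)"
  proof (rule integral_dominated_convergence[where w="?i"])
    show "AE x in lborel. (\<lambda>n. ?i x * (1 - ?i (x + h n))) \<longlonglongrightarrow> 0"
    proof (rule AE_I2)
      fix x
      show "(\<lambda>n. ?i x * (1 - ?i (x + h n))) \<longlonglongrightarrow> 0"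
      proof (cases "x \<in> U")
        case True
        have "(\<lambda>n. x + h n) \<longlonglongrightarrow> x" using tendsto_add[OF tendsto_const h, of x] by simp
        then have "\<forall>\<^sub>F n in sequentially. x + h n \<in> U" using U(1) True topological_tendstoD by blast
        then have "\<forall>\<^sub>F n in sequentially. ?i x * (1 - ?i (x + h n)) = 0" by eventually_elim simp
        then show ?thesis by (rule tendsto_eventually)
      qed simp
    qed
  qed (use int in \<open>auto simp: indicator_def\<close>)
  ultimately show ?thesis by (auto intro!: tendsto_eq_intros)
qed

text \<open>Translation is continuous in \<open>L\<^sup>1\<close>: outer regularity reduces indicators of Borel sets to open
  sets, and the property passes to limits in \<open>L\<^sup>1\<close>.\<close>

lemma shift_error_tendsto_0:
  fixes f :: "'a::euclidean_space \<Rightarrow> 'b::euclidean_space"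
  assumes "integrable lborel f" and h: "h \<longlonglongrightarrow> 0"
  shows "(\<lambda>n. shift_error f (h n)) \<longlonglongrightarrow> 0"
  using assms(1)
proof (induction f rule: integrable_induct)
  case (base A c)
  have A [measurable]: "A \<in> sets borel" using base by simp
  have intA: "integrable lborel (\<lambda>x. indicator A x *\<^sub>R c)" using base by simp
  show ?case
  proof (rule shift_error_tendsto_by_approximation[OF intA])
    fix e :: real assume "e > 0"
    define e' where "e' = e / (norm c + 1)"
    have ne: "norm c + 1 > 0" by (simp add: add_nonneg_pos)
    have e': "e' > 0" "e' * norm c < e" using \<open>e > 0\<close> ne by (auto simp: e'_def field_simps)
    obtain U where U: "open U" "A \<subseteq> U" "emeasure lborel (U - A) < e'"
      using outer_regular_lborel[OF A e'(1)] by metis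
    have [measurable]: "U \<in> sets borel" using U by simp
    have UA: "emeasure lborel U = emeasure lborel A + emeasure lborel (U - A)"
      using U by (subst plus_emeasure) (auto simp: Un_absorb1)
    have fin: "emeasure lborel U < \<infinity>" using base U unfolding UA
      by (auto simp: ennreal_add_less_top intro: less_trans[OF U(3)])
    have m: "measure lborel (U - A) < e'"
      using U(3) e' unfolding measure_def
      by (metis enn2real_leI enn2real_positive_iff ennreal_enn2real_if ennreal_less_iff
          enn2real_nonneg infinity_ennreal_def not_less_iff_gr_or_eq top.not_eq_extremum
          top_neq_ennreal)
    show "\<exists>g. integrable lborel g \<and> (LINT x|lborel. norm (indicator A x *\<^sub>R c - g x)) < e
              \<and> (\<lambda>n. shift_error g (h n)) \<longlonglongrightarrow> 0"
    proof (intro exI[of _ "\<lambda>x. indicator U x *\<^sub>R c"] conjI)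
      show "integrable lborel (\<lambda>x. indicator U x *\<^sub>R c)" using fin by simp
      have "norm (indicator A x *\<^sub>R c - indicator U x *\<^sub>R c) = indicator (U - A) x * norm c" for x
        using U(2) by (auto simp: indicator_def)
      then have "(LINT x|lborel. norm (indicator A x *\<^sub>R c - indicator U x *\<^sub>R c))
          = measure lborel (U - A) * norm c"
        by simp
      also have "\<dots> \<le> e' * norm c" using m by (intro mult_right_mono) auto
      finally show "(LINT x|lborel. norm (indicator A x *\<^sub>R c - indicator U x *\<^sub>R c)) < e" using e'
        by simp
    qed (rule shift_error_indicator_open[OF U(1) fin h])
  qed
next
  case (add f g)
  have "(\<lambda>n. shift_error f (h n) + shift_error g (h n)) \<longlonglongrightarrow> 0"
    using tendsto_add[OF add(3,4)] by simp
  then show ?case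
    by (rule tendsto_sandwich[OF _ _ tendsto_const, rotated 2])
       (auto intro!: always_eventually shift_error_nonneg shift_error_add add)
next
  case (lim f s)
  show ?case
  proof (rule shift_error_tendsto_by_approximation)
    show f: "integrable lborel f" by fact
    fix e :: real assume "e > 0"
    have "(\<lambda>i. LINT x|lborel. norm (f x - s i x)) \<longlonglongrightarrow> (LINT x|(lborel::'a measure). 0)"
    proof (rule integral_dominated_convergence[where w="\<lambda>x. 3 * norm (f x)"])
      show "AE x in lborel. (\<lambda>i. norm (f x - s i x)) \<longlonglongrightarrow> 0"
      proof (rule AE_I2)
        fix x
        have "(\<lambda>i. s i x) \<longlonglongrightarrow> f x" using lim by simp
        from tendsto_norm[OF tendsto_diff[OF tendsto_const this, of "f x"]]
        show "(\<lambda>i. norm (f x - s i x)) \<longlonglongrightarrow> 0" by simp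
      qed
      show "AE x in lborel. norm (norm (f x - s i x)) \<le> 3 * norm (f x)" for i
      proof (rule AE_I2)
        fix x
        have "norm (s i x) \<le> 2 * norm (f x)" using lim by simp
        then show "norm (norm (f x - s i x)) \<le> 3 * norm (f x)"
          using norm_triangle_ineq4[of "f x" "s i x"] by simp
      qed
    qed (use f lim in auto)
    then have "\<forall>\<^sub>F i in sequentially. (LINT x|lborel. norm (f x - s i x)) < e"
      using \<open>e > 0\<close> by (intro order_tendstoD) auto
    then obtain i where "(LINT x|lborel. norm (f x - s i x)) < e"
      using eventually_happens'[OF sequentially_bot] by blast
    then show "\<exists>g. integrable lborel g \<and> (LINT x|lborel. norm (f x - g x)) < e
              \<and> (\<lambda>n. shift_error g (h n)) \<longlonglongrightarrow> 0"
      by (intro exI[of _ "s i"]) (use lim in simp)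
  qed
qed

lemma shift_error_small:
  fixes f :: "'a::euclidean_space \<Rightarrow> 'b::euclidean_space"
  assumes f: "integrable lborel f" and "e > 0"
  shows "\<exists>d>0. \<forall>h. norm h \<le> d \<longrightarrow> shift_error f h \<le> e"
proof (rule ccontr)
  assume "\<not> ?thesis"
  then have "\<forall>d>0. \<exists>h. norm h \<le> d \<and> shift_error f h > e" by force
  then have "\<forall>n. \<exists>h. norm h \<le> 1 / real (Suc n) \<and> shift_error f h > e" by simp
  then obtain h where h: "\<And>n. norm (h n) \<le> 1 / real (Suc n)" "\<And>n. shift_error f (h n) > e" by metis
  have "h \<longlonglongrightarrow> 0"
    by (rule Lim_null_comparison[OF _ LIMSEQ_inverse_real_of_nat])
       (use h(1) in \<open>auto simp: inverse_eq_divide\<close>)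
  from shift_error_tendsto_0[OF f this] have "\<forall>\<^sub>F n in sequentially. shift_error f (h n) < e"
    using \<open>e > 0\<close> by (intro order_tendstoD)
  then obtain n where "shift_error f (h n) < e" using eventually_happens'[OF sequentially_bot] by blast
  with h(2)[of n] show False by simp
qed

definition conv :: "('a::euclidean_space \<Rightarrow> real) \<Rightarrow> ('a \<Rightarrow> 'b::euclidean_space) \<Rightarrow> 'a \<Rightarrow> 'b" where
  "conv k f x = (LINT y|lborel. k (x - y) *\<^sub>R f y)"

lemma
  fixes f :: "'a::euclidean_space \<Rightarrow> 'b::euclidean_space"
  assumes k: "integrable lborel k" and f: "integrable lborel f"
  shows conv_integrand_integrable: "integrable (lborel \<Otimes>\<^sub>M lborel) (\<lambda>(y, x). k (x - y) *\<^sub>R f y)"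
    and integrable_conv: "integrable lborel (conv k f)"
    and norm_conv_le: "(LINT x|lborel. norm (conv k f x))
        \<le> (LINT x|lborel. \<bar>k x\<bar>) * (LINT x|lborel. norm (f x))"
proof -
  have [measurable]: "k \<in> borel_measurable borel" "f \<in> borel_measurable borel" using k f by auto
  have kx: "integrable lborel (\<lambda>x. k (x - y))" for y
    using integrable_shift_lborel[OF k, of "-y"] by simp
  have nk: "(LINT x|lborel. \<bar>k (x - y)\<bar>) = (LINT x|lborel. \<bar>k x\<bar>)" for y
    using integral_lborel_shift[of "\<lambda>x. \<bar>k x\<bar>" "-y"] by simp
  have "(\<lambda>(y, x). k (x - y) *\<^sub>R f y) \<in> borel_measurable (lborel \<Otimes>\<^sub>M lborel)" by measurable
  then show I: "integrable (lborel \<Otimes>\<^sub>M lborel) (\<lambda>(y, x). k (x - y) *\<^sub>R f y)"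
    by (rule lborel_pair.Fubini_integrable) (use f kx in \<open>simp_all add: nk\<close>)
  have I': "integrable lborel (conv k f)"
    unfolding conv_def by (rule lborel_pair.integrable_snd[OF I])
  then show "integrable lborel (conv k f)" .
  have J: "integrable (lborel \<Otimes>\<^sub>M lborel) (\<lambda>(y, x). \<bar>k (x - y)\<bar> * norm (f y))"
    using integrable_norm[OF I] by (simp add: case_prod_unfold)
  have "(LINT x|lborel. norm (conv k f x)) \<le> (LINT x|lborel. LINT y|lborel. \<bar>k (x - y)\<bar> * norm (f y))"
    using integral_norm_bound[of lborel "\<lambda>y. k (x - y) *\<^sub>R f y" for x]
    by (intro integral_mono lborel_pair.integrable_snd[OF J] integrable_norm I') (simp add: conv_def)
  also have "\<dots> = (LINT y|lborel. LINT x|lborel. \<bar>k (x - y)\<bar> * norm (f y))"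
    by (rule lborel_pair.Fubini_integral[OF J])
  also have "\<dots> = (LINT x|lborel. \<bar>k x\<bar>) * (LINT x|lborel. norm (f x))" by (simp add: nk)
  finally show "(LINT x|lborel. norm (conv k f x))
      \<le> (LINT x|lborel. \<bar>k x\<bar>) * (LINT x|lborel. norm (f x))" .
qed

text \<open>Fubini's theorem moves the convolution from f to the bounded factor; all exchanges of \<open>u * \<eta>\<close>
  with a kernel or a derivative below are instances.\<close>

lemma integral_mult_conv:
  fixes f :: "'a::euclidean_space \<Rightarrow> real"
  assumes k: "integrable lborel k" and f: "integrable lborel f"
    and b [measurable]: "b \<in> borel_measurable borel" and B: "\<And>x. \<bar>b x\<bar> \<le> B"
  shows "(LINT x|lborel. b x * conv k f x) = (LINT y|lborel. f y * (LINT x|lborel. k (x - y) * b x))"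
proof -
  note I = conv_integrand_integrable[OF k f]
  have [measurable]: "k \<in> borel_measurable borel" "f \<in> borel_measurable borel" using k f by auto
  have I2: "integrable (lborel \<Otimes>\<^sub>M lborel) (\<lambda>(y, x). b x * (k (x - y) * f y))"
  proof (rule Bochner_Integration.integrable_bound[OF integrable_mult_right[OF I, of B]])
    show "AE z in lborel \<Otimes>\<^sub>M lborel. norm (case z of (y, x) \<Rightarrow> b x * (k (x - y) * f y))
        \<le> norm (B * (case z of (y, x) \<Rightarrow> k (x - y) *\<^sub>R f y))"
      using B by (auto intro!: AE_I2 simp: abs_mult mult_right_mono order_trans[OF B abs_ge_self]
          split: prod.split)
  qed measurable
  have "(LINT x|lborel. b x * conv k f x) = (LINT x|lborel. LINT y|lborel. b x * (k (x - y) * f y))"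
    by (simp add: conv_def)
  also have "\<dots> = (LINT y|lborel. LINT x|lborel. b x * (k (x - y) * f y))"
    by (rule lborel_pair.Fubini_integral[OF I2])
  also have "\<dots> = (LINT y|lborel. f y * (LINT x|lborel. k (x - y) * b x))"
    by (simp flip: Bochner_Integration.integral_mult_right_zero add: mult_ac)
  finally show ?thesis .
qed

text \<open>The convolution with a mollifier averages translates of f, so that its distance to f is at most
  the average of the translation errors over the support of the mollifier.\<close>

lemma mollify_close:
  fixes f :: "real^'n::finite \<Rightarrow> 'b::euclidean_space"
  assumes f: "integrable lborel f" and "e > 0"
  shows "\<exists>d>0. \<forall>\<eta>. mollifier d \<eta> \<longrightarrow> (LINT x|lborel. norm (conv \<eta> f x - f x)) \<le> e"
proof -
  obtain d where d: "d > 0" "\<And>h. norm h \<le> d \<Longrightarrow> shift_error f h \<le> e"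
    using shift_error_small[OF assms] by blast
  have "(LINT x|lborel. norm (conv \<eta> f x - f x)) \<le> e" if "mollifier d \<eta>" for \<eta>
  proof -
    have \<eta>: "test_function \<eta>" and pos: "\<And>x. \<eta> x \<ge> 0" and supp: "\<And>x. d < norm x \<Longrightarrow> \<eta> x = 0"
      and one: "(LINT x|lborel. \<eta> x) = 1" using that by (auto simp: mollifier_def)
    note int\<eta> = test_function_integrable[OF \<eta>]
    have [measurable]: "\<eta> \<in> borel_measurable borel" "f \<in> borel_measurable borel" using int\<eta> f by auto
    have ic: "integrable lborel (conv \<eta> f)" by (rule integrable_conv[OF int\<eta> f])
    then have [measurable]: "conv \<eta> f \<in> borel_measurable borel" by auto
    obtain B where B: "B > 0" "\<And>x. \<bar>\<eta> x\<bar> \<le> B" using test_function_bounded[OF \<eta>] by blast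
    have "norm (conv \<eta> f x - f x) \<le> (\<integral>\<^sup>+y. \<eta> y * norm (f (x - y) - f x) \<partial>lborel)" for x
    proof -
      have fx: "integrable lborel (\<lambda>y. f (x - y))" using integrable_lborel_reflect[of f x] f by simp
      have i1: "integrable lborel (\<lambda>y. \<eta> y *\<^sub>R f (x - y))"
        by (rule Bochner_Integration.integrable_bound[OF integrable_mult_right[OF integrable_norm[OF
            fx], of B]])
           (use B in \<open>auto intro!: AE_I2 mult_right_mono simp: abs_mult order_trans[OF B(2)
               abs_ge_self]\<close>)
      have "conv \<eta> f x = (LINT y|lborel. \<eta> y *\<^sub>R f (x - y))"
        unfolding conv_def using integral_lborel_reflect[of "\<lambda>y. \<eta> y *\<^sub>R f (x - y)" x] by simp
      moreover have "f x = (LINT y|lborel. \<eta> y *\<^sub>R f x)" using one int\<eta> by simp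
      ultimately have "conv \<eta> f x - f x = (LINT y|lborel. \<eta> y *\<^sub>R f (x - y) - \<eta> y *\<^sub>R f x)"
        using i1 int\<eta> by (simp add: Bochner_Integration.integral_diff)
      also have "norm \<dots> \<le> (\<integral>\<^sup>+y. norm (\<eta> y *\<^sub>R f (x - y) - \<eta> y *\<^sub>R f x) \<partial>lborel)"
        using i1 int\<eta> by (intro integral_norm_bound_ennreal) auto
      also have "\<dots> = (\<integral>\<^sup>+y. \<eta> y * norm (f (x - y) - f x) \<partial>lborel)"
        using pos by (simp flip: scaleR_diff_right)
      finally show ?thesis .
    qed
    then have "(\<integral>\<^sup>+x. norm (conv \<eta> f x - f x) \<partial>lborel)
        \<le> (\<integral>\<^sup>+x. \<integral>\<^sup>+y. \<eta> y * norm (f (x - y) - f x) \<partial>lborel \<partial>lborel)"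
      by (intro nn_integral_mono)
    also have "\<dots> = (\<integral>\<^sup>+y. \<integral>\<^sup>+x. \<eta> y * norm (f (x - y) - f x) \<partial>lborel \<partial>lborel)"
      by (rule lborel_pair.Fubini') measurable
    also have "\<dots> \<le> (\<integral>\<^sup>+y. \<eta> y * e \<partial>lborel)"
    proof (intro nn_integral_mono)
      fix y
      have "(\<integral>\<^sup>+x. \<eta> y * norm (f (x - y) - f x) \<partial>lborel) = ennreal (\<eta> y * shift_error f (- y))"
        unfolding shift_error_def using integrable_shift_lborel[OF f, of "-y"] f pos
        by (subst nn_integral_eq_integral) auto
      also have "\<dots> \<le> \<eta> y * e"
        using pos[of y] d(2)[of "-y"] supp[of y]
        by (cases "norm y \<le> d") (auto intro!: ennreal_leI mult_left_mono)
      finally show "(\<integral>\<^sup>+x. \<eta> y * norm (f (x - y) - f x) \<partial>lborel) \<le> \<eta> y * e" .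
    qed
    also have "\<dots> = ennreal e"
      using int\<eta> pos one \<open>e > 0\<close> by (subst nn_integral_eq_integral) auto
    finally show ?thesis
      using ic f \<open>e > 0\<close> by (subst (asm) nn_integral_eq_integral) auto
  qed
  with d(1) show ?thesis by blast
qed

definition test_field :: "(real^'n::finite \<Rightarrow> 'b::euclidean_space) \<Rightarrow> bool" where
  "test_field \<psi> \<longleftrightarrow> (\<forall>b\<in>Basis. test_function (\<lambda>x. \<psi> x \<bullet> b)) \<and> (\<forall>x. norm (\<psi> x) \<le> 1)"

lemma test_field_measurable: "test_field \<psi> \<Longrightarrow> \<psi> \<in> borel_measurable borel"
  unfolding test_field_def by (subst borel_measurable_euclidean_space)
      (auto dest: test_function_borel_measurable)

text \<open>The field \<open>G/|G|\<close>, cut off to a ball, would give equality but is not smooth. Its mollifications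
  are test fields, bounded by 1, and a subsequence converges to it almost everywhere, so the bound
  survives the limit by dominated convergence.\<close>

lemma L1_norm_le_by_duality_lborel:
  fixes G :: "real^'n::finite \<Rightarrow> 'b::euclidean_space"
  assumes G: "integrable lborel G"
    and C: "\<And>\<psi>. test_field \<psi> \<Longrightarrow> (LINT x|lborel. G x \<bullet> \<psi> x) \<le> C"
  shows "(LINT x|lborel. norm (G x)) \<le> C"
proof -
  have [measurable]: "G \<in> borel_measurable borel" using G by auto
  have R: "(LINT x|lborel. indicator (cball 0 R) x * norm (G x)) \<le> C" for R :: real
  proof -
    define S where "S x = indicat_real (cball 0 R) x *\<^sub>R sgn (G x)" for x
    have [measurable]: "S \<in> borel_measurable borel" unfolding S_def sgn_div_norm
      by (intro borel_measurable_scaleR borel_measurable_indicator borel_measurable_inverse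
        borel_measurable_norm) auto
    have nS: "norm (S x) \<le> indicator (cball 0 R) x" for x by (auto simp: S_def norm_sgn indicator_def)
    have ib: "integrable lborel (indicat_real (cball (0::real^'n) R))"
      using emeasure_lborel_cball_finite[of "0::real^'n" R] by (simp add: less_top)
    have intS: "integrable lborel S"
      by (rule Bochner_Integration.integrable_bound[OF ib]) (use nS in \<open>auto simp: order_trans[OF nS]\<close>)
    have "\<exists>\<eta>. mollifier (d::real) \<eta> \<and> (LINT x|lborel. norm (conv \<eta> S x - S x)) \<le> 1 / real (Suc n)"
      if "\<forall>\<eta>. mollifier d \<eta> \<longrightarrow> (LINT x|lborel. norm (conv \<eta> S x - S x)) \<le> 1 / real (Suc n)" "d > 0"
          for d n
      using that mollifier_exists[OF \<open>d > 0\<close>] by blast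
    then have "\<forall>n. \<exists>\<eta> d. mollifier (d::real) \<eta> \<and> (LINT x|lborel. norm (conv \<eta> S x - S x))
        \<le> 1 / real (Suc n)"
      using mollify_close[OF intS] by (metis divide_pos_pos of_nat_0_less_iff zero_less_Suc
          zero_less_one)
    then obtain \<eta> d where \<eta>: "\<And>n. mollifier (d n) (\<eta> n :: real^'n \<Rightarrow> real)"
      "\<And>n. (LINT x|lborel. norm (conv (\<eta> n) S x - S x)) \<le> 1 / real (Suc n)" by metis
    have t\<eta>: "test_function (\<eta> n)" "\<eta> n x \<ge> 0" "(LINT x|lborel. \<eta> n x) = 1" for n x
      using \<eta>(1)[of n] by (auto simp: mollifier_def)
    note int\<eta> = test_function_integrable[OF t\<eta>(1)]
    have [measurable]: "\<eta> n \<in> borel_measurable borel" for n using int\<eta>[of n] by auto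
    define \<psi> where "\<psi> n = conv (\<eta> n) S" for n
    have int\<psi>: "integrable lborel (\<psi> n)" for n unfolding \<psi>_def by (rule integrable_conv[OF int\<eta> intS])
    have ireal: "integrable lborel (\<lambda>y. \<eta> n (x - y))" for n x
      using integrable_lborel_reflect[of "\<eta> n" x] int\<eta>[of n] by simp
    have iS: "integrable lborel (\<lambda>y. \<eta> n (x - y) *\<^sub>R S y)" for n x
      by (rule Bochner_Integration.integrable_bound[OF ireal[of n x]])
         (use order_trans[OF nS indicator_le_1] t\<eta>(2) in \<open>auto simp: mult_left_le\<close>)
    have n\<psi>: "norm (\<psi> n x) \<le> 1" for n x
    proof -
      have "norm (\<psi> n x) \<le> (LINT y|lborel. norm (\<eta> n (x - y) *\<^sub>R S y))"
        unfolding \<psi>_def conv_def by (rule integral_norm_bound)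
      also have "\<dots> \<le> (LINT y|lborel. \<eta> n (x - y))"
        using order_trans[OF nS indicator_le_1] t\<eta>(2)
        by (intro integral_mono integrable_norm iS ireal) (auto simp: mult_left_le)
      also have "\<dots> = 1" using integral_lborel_reflect[of "\<eta> n" x] t\<eta>(3)[of n] by simp
      finally show ?thesis .
    qed
    have tf: "test_field (\<psi> n)" for n
      unfolding test_field_def
    proof (intro conjI ballI allI n\<psi>)
      fix b :: 'b assume "b \<in> Basis"
      have "(\<lambda>x. \<psi> n x \<bullet> b) = (\<lambda>x. LINT y|lborel. \<eta> n (x - y) * (S y \<bullet> b))"
        unfolding \<psi>_def conv_def using iS by (intro ext) (simp flip: integral_inner_left)
      moreover have "test_function (\<lambda>x. LINT y|lborel. \<eta> n (x - y) * (S y \<bullet> b))"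
      proof (rule test_function_superposition[OF t\<eta>(1)])
        show "norm y \<le> R" if "S y \<bullet> b \<noteq> 0" for y
          using that by (auto simp: S_def indicator_def split: if_splits)
      qed (use intS in auto)
      ultimately show "test_function (\<lambda>x. \<psi> n x \<bullet> b)" by simp
    qed
    have "(\<lambda>n. LINT x|lborel. norm (\<psi> n x - S x)) \<longlonglongrightarrow> 0"
      by (rule Lim_null_comparison[OF _ LIMSEQ_inverse_real_of_nat])
         (use \<eta>(2) in \<open>auto simp: inverse_eq_divide \<psi>_def\<close>)
    then obtain r where r: "strict_mono r" "AE x in lborel. (\<lambda>n. \<psi> (r n) x - S x) \<longlonglongrightarrow> 0"
      using tendsto_L1_AE_subseq[of lborel "\<lambda>n x. \<psi> n x - S x"] int\<psi> intS by auto
    have "(\<lambda>n. LINT x|lborel. G x \<bullet> \<psi> (r n) x) \<longlonglongrightarrow> (LINT x|lborel. G x \<bullet> S x)"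
    proof (rule integral_dominated_convergence[where w="\<lambda>x. norm (G x)"])
      show "AE x in lborel. (\<lambda>n. G x \<bullet> \<psi> (r n) x) \<longlonglongrightarrow> G x \<bullet> S x"
        using r(2)
      proof eventually_elim
        case (elim x)
        then have "(\<lambda>n. \<psi> (r n) x) \<longlonglongrightarrow> S x" by (simp add: LIM_zero_iff)
        then show ?case by (intro tendsto_intros)
      qed
      show "AE x in lborel. norm (G x \<bullet> \<psi> (r n) x) \<le> norm (G x)" for n
        using order_trans[OF Cauchy_Schwarz_ineq2 mult_left_le[OF n\<psi> norm_ge_zero]] by simp
      show "(\<lambda>x. G x \<bullet> \<psi> (r n) x) \<in> borel_measurable lborel" for n
        using int\<psi>[of "r n"] by measurable
    qed (use G in auto)
    then have "(LINT x|lborel. G x \<bullet> S x) \<le> C"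
      by (rule LIMSEQ_le_const2) (use C[OF tf] in auto)
    moreover have "G x \<bullet> S x = indicator (cball 0 R) x * norm (G x)" for x
      by (cases "G x = 0") (auto simp: S_def sgn_div_norm indicator_def dot_square_norm
          power2_eq_square)
    ultimately show ?thesis by simp
  qed
  have "(\<lambda>n. LINT x|lborel. indicator (cball 0 (real n)) x * norm (G x)) \<longlonglongrightarrow> (LINT x|lborel. norm (G x))"
  proof (rule integral_dominated_convergence[where w="\<lambda>x. norm (G x)"])
    show "AE x in lborel. (\<lambda>n. indicator (cball 0 (real n)) x * norm (G x)) \<longlonglongrightarrow> norm (G x)"
    proof (rule AE_I2)
      fix x :: "real^'n"
      have "\<forall>\<^sub>F n in sequentially. norm x \<le> real n"
        using eventually_ge_at_top[of "nat \<lceil>norm x\<rceil>"]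
        by eventually_elim (use real_nat_ceiling_ge[of "norm x"] in linarith)
      then have "\<forall>\<^sub>F n in sequentially. indicator (cball 0 (real n)) x * norm (G x) = norm (G x)"
        by eventually_elim simp
      then show "(\<lambda>n. indicator (cball 0 (real n)) x * norm (G x)) \<longlonglongrightarrow> norm (G x)"
        by (rule tendsto_eventually)
    qed
  qed (use G in \<open>auto simp: indicator_def\<close>)
  then show ?thesis by (rule LIMSEQ_le_const2) (use R in auto)
qed

lemma integrable_lebesgue_ex_borel:
  fixes G :: "'a::euclidean_space \<Rightarrow> 'b::euclidean_space"
  assumes G: "integrable lebesgue G"
  shows "\<exists>G'. integrable lborel G' \<and> (AE x in lebesgue. G x = G' x)"
proof -
  have "\<exists>g'\<in>borel_measurable lborel. (AE x in lborel. G x \<bullet> b = g' x)" for b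
    using G by (intro completion_ex_borel_measurable_real) auto
  then obtain g where g: "\<And>b. g b \<in> borel_measurable lborel" "\<And>b. AE x in lborel. G x \<bullet> b = g b x"
    by metis
  define G' where "G' x = (\<Sum>b\<in>Basis. g b x *\<^sub>R b)" for x
  have [measurable]: "G' \<in> borel_measurable lborel" unfolding G'_def using g(1) by measurable
  have "AE x in lborel. \<forall>b\<in>Basis. G x \<bullet> b = g b x" by (intro AE_finite_allI) (auto simp: g)
  then have "AE x in lborel. G x = G' x"
  proof eventually_elim
    case (elim x)
    have "G x = (\<Sum>b\<in>Basis. (G x \<bullet> b) *\<^sub>R b)" by (simp add: euclidean_representation)
    then show ?case using elim by (simp add: G'_def)
  qed
  then have ae: "AE x in lebesgue. G x = G' x" by (rule AE_completion)
  have "integrable lebesgue G'"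
    by (rule integrable_cong_AE_imp[OF G]) (use ae in \<open>auto intro: measurable_completion\<close>)
  then have "integrable lborel G'" by (subst (asm) integrable_completion) auto
  with ae show ?thesis by blast
qed

lemma L1_norm_le_by_duality:
  fixes G :: "real^'n::finite \<Rightarrow> 'b::euclidean_space"
  assumes G: "integrable lebesgue G"
    and C: "\<And>\<psi>. test_field \<psi> \<Longrightarrow> (LINT x|lebesgue. G x \<bullet> \<psi> x) \<le> C"
  shows "(LINT x|lebesgue. norm (G x)) \<le> C"
proof -
  obtain G' where G': "integrable lborel G'" "AE x in lebesgue. G x = G' x"
    using integrable_lebesgue_ex_borel[OF G] by blast
  have [measurable]: "G' \<in> borel_measurable borel" "G \<in> borel_measurable lebesgue" using G' G by auto
  have [measurable]: "G' \<in> borel_measurable lebesgue" by (auto intro: measurable_completion)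
  have "(LINT x|lborel. norm (G' x)) \<le> C"
  proof (rule L1_norm_le_by_duality_lborel[OF G'(1)])
    fix \<psi> :: "real^'n \<Rightarrow> 'b" assume \<psi>: "test_field \<psi>"
    note [measurable] = test_field_measurable[OF \<psi>]
    have [measurable]: "\<psi> \<in> borel_measurable lebesgue" by (auto intro: measurable_completion)
    have "(LINT x|lborel. G' x \<bullet> \<psi> x) = (LINT x|lebesgue. G' x \<bullet> \<psi> x)"
      by (subst integral_completion) auto
    also have "\<dots> = (LINT x|lebesgue. G x \<bullet> \<psi> x)"
      by (rule integral_cong_AE) (use G'(2) in auto)
    finally show "(LINT x|lborel. G' x \<bullet> \<psi> x) \<le> C" using C[OF \<psi>] by simp
  qed
  moreover have "(LINT x|lebesgue. norm (G x)) = (LINT x|lebesgue. norm (G' x))"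
    by (rule integral_cong_AE) (use G'(2) in auto)
  moreover have "(LINT x|lebesgue. norm (G' x)) = (LINT x|lborel. norm (G' x))"
    by (subst integral_completion) auto
  ultimately show ?thesis by simp
qed

section \<open>Radial kernels and their angular moments\<close>

lemma
  fixes f :: "'a::euclidean_space \<Rightarrow> ennreal"
  assumes [measurable]: "f \<in> borel_measurable borel"
  shows nn_integral_lborel_shift: "(\<integral>\<^sup>+x. f (x + a) \<partial>lborel) = (\<integral>\<^sup>+x. f x \<partial>lborel)"
    and nn_integral_lborel_reflect: "(\<integral>\<^sup>+x. f (a - x) \<partial>lborel) = (\<integral>\<^sup>+x. f x \<partial>lborel)"
proof -
  have s: "distr lborel borel (\<lambda>x. x + a) = lborel"
    using lborel_distr_affine_isometry[of 1 a] by (simp add: add.commute)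
  have r: "distr lborel borel (\<lambda>x. a - x) = lborel"
    using lborel_distr_affine_isometry[of "-1" a] by simp
  have "(\<integral>\<^sup>+x. f x \<partial>distr lborel borel (\<lambda>x. x + a)) = (\<integral>\<^sup>+x. f (x + a) \<partial>lborel)"
    by (rule nn_integral_distr) auto
  then show "(\<integral>\<^sup>+x. f (x + a) \<partial>lborel) = (\<integral>\<^sup>+x. f x \<partial>lborel)" unfolding s ..
  have "(\<integral>\<^sup>+x. f x \<partial>distr lborel borel (\<lambda>x. a - x)) = (\<integral>\<^sup>+x. f (a - x) \<partial>lborel)"
    by (rule nn_integral_distr) auto
  then show "(\<integral>\<^sup>+x. f (a - x) \<partial>lborel) = (\<integral>\<^sup>+x. f x \<partial>lborel)" unfolding r ..
qed

text \<open>Uniqueness of translation-invariant measures in two applications of Fubini's theorem. For the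
  unit ball B and a Borel set A, the double integral of \<open>1\<^sub>B(x) 1\<^sub>A(Qy + x)\<close> equals \<open>|B| |Q\<^sup>-\<^sup>1A|\<close>
  if the inner variable is y, by translating y by \<open>Q\<^sup>-\<^sup>1x\<close>, and \<open>|A| |B|\<close> after translating x by
  \<open>Qy\<close>, because Q preserves B.\<close>

lemma lborel_distr_orthogonal:
  fixes Q :: "'a::euclidean_space \<Rightarrow> 'a"
  assumes Q: "orthogonal_transformation Q"
  shows "distr lborel borel Q = lborel"
proof (rule measure_eqI)
  show "sets (distr lborel borel Q) = sets lborel" by simp
  have linQ: "linear Q" by (rule orthogonal_transformation_linear[OF Q])
  have [measurable]: "Q \<in> borel_measurable borel"
    using linQ by (intro borel_measurable_continuous_onI linear_continuous_on)
        (simp add: linear_conv_bounded_linear)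
  obtain P where P: "\<And>x. Q (P x) = x"
    using orthogonal_transformation_surj[OF Q] by (metis surj_f_inv_f)
  have nQ: "norm (Q x - Q y) = norm (x - y)" for x y
    using Q by (simp add: orthogonal_transformation linear_diff[symmetric])
  fix A assume "A \<in> sets (distr lborel borel Q)"
  then have [measurable]: "A \<in> sets borel" by simp
  define B where "B = ball (0::'a) 1"
  have [measurable]: "B \<in> sets borel" by (simp add: B_def)
  have V: "emeasure lborel B < \<infinity>" "emeasure lborel B \<noteq> 0"
    using emeasure_lborel_ball_finite[of "0::'a" 1] content_ball_pos[of 1 "0::'a"]
    by (auto simp: B_def measure_def)
  have shiftA: "(\<integral>\<^sup>+y. indicator A (Q y) \<partial>lborel) = (\<integral>\<^sup>+y. indicator A (Q y + x) \<partial>lborel)" for x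
  proof -
    have "(\<integral>\<^sup>+y. indicator A (Q y) \<partial>lborel) = (\<integral>\<^sup>+y. indicator A (Q (y + P x)) \<partial>lborel)"
      by (rule nn_integral_lborel_shift[symmetric]) measurable
    then show ?thesis using linQ by (simp add: linear_add P)
  qed
  have "(\<integral>\<^sup>+x. indicator B x \<partial>lborel) * (\<integral>\<^sup>+y. indicator A (Q y) \<partial>lborel)
      = (\<integral>\<^sup>+x. indicator B x * (\<integral>\<^sup>+y. indicator A (Q y) \<partial>lborel) \<partial>lborel)"
    by (simp add: nn_integral_multc)
  also have "\<dots> = (\<integral>\<^sup>+x. indicator B x * (\<integral>\<^sup>+y. indicator A (Q y + x) \<partial>lborel) \<partial>lborel)"
    by (simp only: shiftA[symmetric])
  also have "\<dots> = (\<integral>\<^sup>+x. \<integral>\<^sup>+y. indicator B x * indicator A (Q y + x) \<partial>lborel \<partial>lborel)"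
    by (intro nn_integral_cong nn_integral_cmult[symmetric]) measurable
  also have "\<dots> = (\<integral>\<^sup>+y. \<integral>\<^sup>+x. indicator B x * indicator A (Q y + x) \<partial>lborel \<partial>lborel)"
    by (rule lborel_pair.Fubini') measurable
  also have "\<dots> = (\<integral>\<^sup>+y. \<integral>\<^sup>+x. indicator B (x - Q y) * indicator A x \<partial>lborel \<partial>lborel)"
  proof (rule nn_integral_cong)
    fix y
    have "(\<integral>\<^sup>+x. indicator B ((x + Q y) - Q y) * indicator A (x + Q y) \<partial>lborel)
        = (\<integral>\<^sup>+x. indicator B (x - Q y) * indicator A x \<partial>lborel)"
      by (rule nn_integral_lborel_shift[where f="\<lambda>x. indicator B (x - Q y) * indicator A x"]) measurable
    then show "(\<integral>\<^sup>+x. indicator B x * indicator A (Q y + x) \<partial>lborel)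
        = (\<integral>\<^sup>+x. indicator B (x - Q y) * indicator A x \<partial>lborel)"
      by (simp add: add.commute)
  qed
  also have "\<dots> = (\<integral>\<^sup>+x. \<integral>\<^sup>+y. indicator B (x - Q y) * indicator A x \<partial>lborel \<partial>lborel)"
    by (rule lborel_pair.Fubini'[symmetric]) measurable
  also have "\<dots> = (\<integral>\<^sup>+x. (\<integral>\<^sup>+y. indicator B y \<partial>lborel) * indicator A x \<partial>lborel)"
  proof (rule nn_integral_cong)
    fix x
    have "x - Q y \<in> B \<longleftrightarrow> P x - y \<in> B" for y
      using nQ[of "P x" y] by (simp add: B_def P)
    then have "(\<integral>\<^sup>+y. indicator B (x - Q y) * indicator A x \<partial>lborel)
        = (\<integral>\<^sup>+y. indicator B (P x - y) * indicator A x \<partial>lborel)"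
      by (simp add: indicator_def)
    also have "\<dots> = (\<integral>\<^sup>+y. indicator B (P x - y) \<partial>lborel) * indicator A x"
      by (rule nn_integral_multc) measurable
    also have "(\<integral>\<^sup>+y. indicator B (P x - y) \<partial>lborel) = (\<integral>\<^sup>+y. indicator B y \<partial>lborel)"
      by (rule nn_integral_lborel_reflect) measurable
    finally show "(\<integral>\<^sup>+y. indicator B (x - Q y) * indicator A x \<partial>lborel)
        = (\<integral>\<^sup>+y. indicator B y \<partial>lborel) * indicator A x" .
  qed
  also have "\<dots> = (\<integral>\<^sup>+x. indicator B x \<partial>lborel) * (\<integral>\<^sup>+x. indicator A x \<partial>lborel)"
    by (rule nn_integral_cmult) measurable
  finally have "emeasure lborel B * (\<integral>\<^sup>+y. indicator A (Q y) \<partial>lborel)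
      = emeasure lborel B * emeasure lborel A" by simp
  then have "(\<integral>\<^sup>+y. indicator A (Q y) \<partial>lborel) = emeasure lborel A"
    using V by (auto simp: ennreal_mult_cancel_left)
  moreover have "emeasure (distr lborel borel Q) A = (\<integral>\<^sup>+y. indicator A (Q y) \<partial>lborel)"
    using nn_integral_distr[of Q lborel borel "indicator A"] by simp
  ultimately show "emeasure (distr lborel borel Q) A = emeasure lborel A" by simp
qed

lemma AE_lborel_orthogonal:
  fixes Q :: "'a::euclidean_space \<Rightarrow> 'a"
  assumes Q: "orthogonal_transformation Q" and P: "AE x in lborel. P x"
  shows "AE x in lborel. P (Q x)"
proof -
  have [measurable]: "Q \<in> borel_measurable borel"
    using orthogonal_transformation_linear[OF Q]
    by (intro borel_measurable_continuous_onI linear_continuous_on)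
        (simp add: linear_conv_bounded_linear)
  have "AE x in distr lborel borel Q. P x" unfolding lborel_distr_orthogonal[OF Q] by (rule P)
  then show ?thesis by (rule AE_distrD[rotated]) measurable
qed

text \<open>The value of f at \<open>sgn 0 = 0\<close> enters only on a null set.\<close>

definition angular_mean :: "('a::euclidean_space \<Rightarrow> real) \<Rightarrow> ('a \<Rightarrow> real) \<Rightarrow> real" where
  "angular_mean \<rho> f = (LINT h|lborel. \<rho> h * f (sgn h))"

text \<open>Radiality is a pointwise property that a Borel version \<open>\<rho>'\<close> of \<open>\<rho>\<close> can lose on a null set; the
  invariance of the angular means is what remains of it for \<open>\<rho>'\<close>.\<close>

lemma angular_mean_orthogonal:
  fixes \<rho> :: "real^'n::finite \<Rightarrow> real"
  assumes \<rho>: "radial \<rho>" and \<rho>': "\<rho>' \<in> borel_measurable borel" "AE x in lborel. \<rho> x = \<rho>' x"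
    and Q: "orthogonal_transformation Q" and f [measurable]: "f \<in> borel_measurable borel"
  shows "angular_mean \<rho>' (\<lambda>\<theta>. f (Q \<theta>)) = angular_mean \<rho>' f"
proof -
  have linQ: "linear Q" by (rule orthogonal_transformation_linear[OF Q])
  have [measurable]: "Q \<in> borel_measurable borel"
    using linQ by (intro borel_measurable_continuous_onI linear_continuous_on)
        (simp add: linear_conv_bounded_linear)
  note [measurable] = \<rho>'(1)
  have sgnQ: "sgn (Q x) = Q (sgn x)" for x
    using Q linQ by (simp add: sgn_div_norm orthogonal_transformation linear_cmul)
  have [measurable]: "(sgn :: real^'n \<Rightarrow> real^'n) \<in> borel_measurable borel"
    by (simp add: sgn_div_norm[abs_def])
  have "angular_mean \<rho>' f = (LINT h|distr lborel borel Q. \<rho>' h * f (sgn h))"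
    by (simp add: angular_mean_def lborel_distr_orthogonal[OF Q])
  also have "\<dots> = (LINT h|lborel. \<rho>' (Q h) * f (Q (sgn h)))"
    by (subst integral_distr) (auto simp: sgnQ)
  also have "\<dots> = (LINT h|lborel. \<rho>' h * f (Q (sgn h)))"
  proof (rule integral_cong_AE)
    have "AE h in lborel. \<rho> (Q h) = \<rho>' (Q h)" by (rule AE_lborel_orthogonal[OF Q \<rho>'(2)])
    with \<rho>'(2) show "AE h in lborel. \<rho>' (Q h) * f (Q (sgn h)) = \<rho>' h * f (Q (sgn h))"
    proof eventually_elim
      case (elim h)
      have "\<rho> (Q h) = \<rho> h" using \<rho>[unfolded radial_def, rule_format, of "Q h" h] Q
        by (simp add: orthogonal_transformation)
      with elim show ?case by simp
    qed
  qed measurable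
  finally show ?thesis by (simp add: angular_mean_def)
qed

text \<open>A Borel measurable probability density with the fourth angular moments of a rotation invariant
  one. Borel measurability makes Fubini's theorem applicable, and the moments are all that is used
  of radiality.\<close>

definition isotropic_kernel :: "(real^'n::finite \<Rightarrow> real) \<Rightarrow> bool" where
  "isotropic_kernel \<rho> \<longleftrightarrow> \<rho> \<in> borel_measurable borel \<and> (\<forall>x. \<rho> x \<ge> 0) \<and> integrable lborel \<rho>
     \<and> (LINT x|lborel. \<rho> x) = 1
     \<and> (\<forall>a b c d. angular_mean \<rho> (\<lambda>\<theta>. (a \<bullet> \<theta>) * (b \<bullet> \<theta>) * (c \<bullet> \<theta>) * (d \<bullet> \<theta>)) =
          ((a \<bullet> b) * (c \<bullet> d) + (a \<bullet> c) * (b \<bullet> d)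
              + (a \<bullet> d) * (b \<bullet> c)) / (real CARD('n) * (real CARD('n) + 2)))"

lemma norm_sgn_le_1: "norm (sgn x) \<le> 1" for x :: "'a::real_normed_vector"
  by (simp add: norm_sgn)

lemma borel_measurable_sgn_euclidean [measurable]:
  "(sgn :: 'a::euclidean_space \<Rightarrow> 'a) \<in> borel_measurable borel"
  by (simp add: sgn_div_norm[abs_def])

lemma angular_integrable:
  fixes f :: "'a::euclidean_space \<Rightarrow> real"
  assumes "integrable lborel \<rho>" and f: "continuous_on UNIV f"
  shows "integrable lborel (\<lambda>h. \<rho> h * f (sgn h))"
proof -
  have [measurable]: "f \<in> borel_measurable borel" using f by (rule borel_measurable_continuous_onI)
  have "compact (f ` cball 0 1)" using f
    by (intro compact_continuous_image) (auto intro: continuous_on_subset)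
  then have "bounded (f ` cball 0 1)" by (rule compact_imp_bounded)
  then obtain B where B: "\<forall>y\<in>f ` cball 0 1. norm y \<le> B" unfolding bounded_iff by blast
  have B': "\<bar>f (sgn h)\<bar> \<le> B" for h
    using B[rule_format, of "f (sgn h)"] norm_sgn_le_1[of h] by simp
  have [measurable]: "\<rho> \<in> borel_measurable borel" using assms by auto
  show ?thesis
    by (rule Bochner_Integration.integrable_bound[OF integrable_mult_left[OF assms(1), of B]])
       (auto intro!: AE_I2 mult_left_mono simp: abs_mult order_trans[OF B' abs_ge_self])
qed

text \<open>The quartic form \<open>a \<mapsto> E (a \<bullet> \<theta>)\<^sup>4\<close> is invariant under orthogonal maps, which act transitively on
  spheres, so it is \<open>\<kappa> |a|\<^sup>4\<close>. Polarising three times, each time by \<open>4xy = (x+y)\<^sup>2 - (x-y)\<^sup>2\<close> or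
  its analogue for fourth powers, yields all fourth moments up to the factor \<open>\<kappa>/3\<close>, and
  \<open>|\<theta>|\<^sup>4 = 1\<close> determines it.\<close>

lemma isotropic_kernel_of_radial:
  fixes \<rho> :: "real^'n::finite \<Rightarrow> real"
  assumes rad: "radial \<rho>" and nonneg: "\<And>x. \<rho> x \<ge> 0" and hb: "has_bochner_integral lebesgue \<rho> 1"
  shows "\<exists>\<rho>'. isotropic_kernel \<rho>' \<and> (AE x in lebesgue. \<rho> x = \<rho>' x)"
proof -
  have int: "integrable lebesgue \<rho>" and one: "(LINT x|lebesgue. \<rho> x) = 1"
    using hb by (auto simp: has_bochner_integral_iff)
  obtain g where g: "g \<in> borel_measurable lborel" "AE x in lborel. \<rho> x = g x"
    using completion_ex_borel_measurable_real[of \<rho> lborel] int by auto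
  \<comment> \<open>A Borel version is nonnegative only almost everywhere, hence the truncation.\<close>
  define \<rho>' where "\<rho>' x = max 0 (g x)" for x
  have m [measurable]: "\<rho>' \<in> borel_measurable borel" using g(1) unfolding \<rho>'_def by measurable
  have m' [measurable]: "\<rho>' \<in> borel_measurable lebesgue" using m by (auto intro: measurable_completion)
  have ae: "AE x in lborel. \<rho> x = \<rho>' x"
    using g(2) by eventually_elim (metis \<rho>'_def max_def nonneg)
  then have ae': "AE x in lebesgue. \<rho> x = \<rho>' x" by (rule AE_completion)
  have "integrable lebesgue \<rho>'" by (rule integrable_cong_AE_imp[OF int m']) (use ae' in auto)
  then have int': "integrable lborel \<rho>'" by (subst (asm) integrable_completion) auto
  have "(LINT x|lebesgue. \<rho>' x) = 1"
    using int ae' unfolding one[symmetric] by (intro integral_cong_AE) auto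
  then have one': "(LINT x|lborel. \<rho>' x) = 1" by (subst (asm) integral_completion) auto
  let ?E = "angular_mean \<rho>'"
  define N where "N = real CARD('n)"
  have cont: "continuous_on UNIV (\<lambda>\<theta>. ((a::real^'n) \<bullet> \<theta>) * (b \<bullet> \<theta>) * (c \<bullet> \<theta>) * (d \<bullet> \<theta>))" for a b c d
    by (intro continuous_intros)
  note I = angular_integrable[OF int' cont]
  define e where "e a b c d = ?E (\<lambda>\<theta>. (a \<bullet> \<theta>) * (b \<bullet> \<theta>) * (c \<bullet> \<theta>) * (d \<bullet> \<theta>))" for a b c d
  obtain k :: 'n where True by blast
  define \<kappa> where "\<kappa> = e (axis k 1) (axis k 1) (axis k 1) (axis k 1)"
  have scale: "e (r *\<^sub>R a) (r *\<^sub>R a) (r *\<^sub>R a) (r *\<^sub>R a) = r ^ 4 * e a a a a" for r a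
    unfolding e_def angular_mean_def
    by (simp add: power4_eq_xxxx mult_ac flip: Bochner_Integration.integral_mult_right_zero)
  have quartic: "e a a a a = \<kappa> * (a \<bullet> a)\<^sup>2" for a
  proof -
    have n: "norm (norm a *\<^sub>R axis k (1::real)) = norm a" by (simp add: norm_axis_1)
    obtain Q :: "real^'n \<Rightarrow> real^'n" where Q: "orthogonal_transformation Q" "Q (norm a *\<^sub>R axis k 1) = a"
      using orthogonal_transformation_exists[OF n] by blast
    have Qi: "a \<bullet> Q \<theta> = (norm a *\<^sub>R axis k 1) \<bullet> \<theta>" for \<theta>
      using Q(1)[unfolded orthogonal_transformation_def, THEN conjunct2, rule_format, of
          "norm a *\<^sub>R axis k 1" \<theta>]
      unfolding Q(2) .
    have "e a a a a = ?E (\<lambda>\<theta>. (a \<bullet> Q \<theta>) * (a \<bullet> Q \<theta>) * (a \<bullet> Q \<theta>) * (a \<bullet> Q \<theta>))"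
      unfolding e_def
      by (rule angular_mean_orthogonal[OF rad m ae Q(1), symmetric,
            where f="\<lambda>\<theta>. (a \<bullet> \<theta>) * (a \<bullet> \<theta>) * (a \<bullet> \<theta>) * (a \<bullet> \<theta>)"]) measurable
    also have "\<dots> = e (norm a *\<^sub>R axis k 1) (norm a *\<^sub>R axis k 1) (norm a *\<^sub>R axis k 1)
        (norm a *\<^sub>R axis k 1)"
      unfolding e_def Qi ..
    also have "\<dots> = \<kappa> * (a \<bullet> a)\<^sup>2" unfolding scale by (simp add: \<kappa>_def power2_norm_eq_inner[symmetric])
    finally show ?thesis .
  qed
  have s1: "12 * e a a b b = e (a+b) (a+b) (a+b) (a+b) + e (a-b) (a-b) (a-b) (a-b) - 2 * e a a a a
      - 2 * e b b b b" for a b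
  proof -
    have "e (a+b) (a+b) (a+b) (a+b) + e (a-b) (a-b) (a-b) (a-b) - 2 * e a a a a - 2 * e b b b b
      = (LINT h|lborel. \<rho>' h * (((a+b) \<bullet> sgn h) * ((a+b) \<bullet> sgn h) * ((a+b) \<bullet> sgn h) *
          ((a+b) \<bullet> sgn h)) + \<rho>' h * (((a-b) \<bullet> sgn h) * ((a-b) \<bullet> sgn h) * ((a-b) \<bullet> sgn h) *
          ((a-b) \<bullet> sgn h)) - 2 * (\<rho>' h * ((a \<bullet> sgn h) * (a \<bullet> sgn h) * (a \<bullet> sgn h) *
          (a \<bullet> sgn h))) - 2 * (\<rho>' h * ((b \<bullet> sgn h) * (b \<bullet> sgn h) * (b \<bullet> sgn h) * (b \<bullet> sgn h))))"
      unfolding e_def angular_mean_def using I by (simp del: mult_minus_left)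
    also have "\<dots> = (LINT h|lborel. 12 *
        (\<rho>' h * ((a \<bullet> sgn h) * (a \<bullet> sgn h) * (b \<bullet> sgn h) * (b \<bullet> sgn h))))"
      by (rule Bochner_Integration.integral_cong) (auto simp: inner_simps algebra_simps)
    finally show ?thesis unfolding e_def angular_mean_def by simp
  qed
  have q1: "e a a b b = \<kappa> * ((a \<bullet> a) * (b \<bullet> b) + 2 * (a \<bullet> b)\<^sup>2) / 3" for a b
    using s1[of a b] unfolding quartic
    by (simp add: inner_simps inner_commute power2_eq_square algebra_simps)
  have s2: "4 * e a b c c = e (a+b) (a+b) c c - e (a-b) (a-b) c c" for a b c d
  proof -
    have "e (a+b) (a+b) c c - e (a-b) (a-b) c c
        = (LINT h|lborel. \<rho>' h * (((a+b) \<bullet> sgn h) * ((a+b) \<bullet> sgn h) * (c \<bullet> sgn h) * (c \<bullet> sgn h))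
        - \<rho>' h * (((a-b) \<bullet> sgn h) * ((a-b) \<bullet> sgn h) * (c \<bullet> sgn h) * (c \<bullet> sgn h)))"
      unfolding e_def angular_mean_def using I by simp
    also have "\<dots> = (LINT h|lborel. 4 *
        (\<rho>' h * ((a \<bullet> sgn h) * (b \<bullet> sgn h) * (c \<bullet> sgn h) * (c \<bullet> sgn h))))"
      by (rule Bochner_Integration.integral_cong) (auto simp: inner_simps algebra_simps)
    finally show ?thesis unfolding e_def angular_mean_def by simp
  qed
  have q2: "e a b c c = \<kappa> * ((a \<bullet> b) * (c \<bullet> c) + 2 * (a \<bullet> c) * (b \<bullet> c)) / 3" for a b c
    using s2[of a b c] unfolding q1
    by (simp add: inner_simps inner_commute power2_eq_square field_simps)
  have s3: "4 * e a b c d = e a b (c+d) (c+d) - e a b (c-d) (c-d)" for a b c d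
  proof -
    have "e a b (c+d) (c+d) - e a b (c-d) (c-d)
        = (LINT h|lborel. \<rho>' h * ((a \<bullet> sgn h) * (b \<bullet> sgn h) * ((c+d) \<bullet> sgn h) * ((c+d) \<bullet> sgn h))
        - \<rho>' h * ((a \<bullet> sgn h) * (b \<bullet> sgn h) * ((c-d) \<bullet> sgn h) * ((c-d) \<bullet> sgn h)))"
      unfolding e_def angular_mean_def using I by simp
    also have "\<dots> = (LINT h|lborel. 4 *
        (\<rho>' h * ((a \<bullet> sgn h) * (b \<bullet> sgn h) * (c \<bullet> sgn h) * (d \<bullet> sgn h))))"
      by (rule Bochner_Integration.integral_cong) (auto simp: inner_simps algebra_simps)
    finally show ?thesis unfolding e_def angular_mean_def by simp
  qed
  have q3: "e a b c d = \<kappa> * ((a \<bullet> b) * (c \<bullet> d) + (a \<bullet> c) * (b \<bullet> d) + (a \<bullet> d) * (b \<bullet> c)) / 3" for a b c d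
    using s3[of a b c d] unfolding q2 by (simp add: inner_simps inner_commute field_simps)
  have "(\<Sum>i\<in>UNIV. \<Sum>j\<in>UNIV. e (axis i 1) (axis i 1) (axis j 1) (axis j 1)) = 1"
  proof -
    have "(\<Sum>i\<in>UNIV. \<Sum>j\<in>UNIV. e (axis i 1) (axis i 1) (axis j 1) (axis j 1))
       = (LINT h|lborel. (\<Sum>i\<in>UNIV. \<Sum>j\<in>UNIV. \<rho>' h * ((axis i 1 \<bullet> sgn h) * (axis i 1 \<bullet> sgn h) *
           (axis j 1 \<bullet> sgn h) * (axis j 1 \<bullet> sgn h))))"
      unfolding e_def angular_mean_def
      by (subst Bochner_Integration.integral_sum, intro Bochner_Integration.integrable_sum I)
         (subst Bochner_Integration.integral_sum, intro I, rule refl)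
    also have "\<dots> = (LINT h|lborel. \<rho>' h)"
    proof (rule integral_cong_AE)
      have "AE h in lborel. h \<noteq> (0::real^'n)" by (rule AE_lborel_singleton)
      then show "AE h in lborel. (\<Sum>i\<in>UNIV. \<Sum>j\<in>UNIV. \<rho>' h * ((axis i 1 \<bullet> sgn h) * (axis i 1 \<bullet> sgn h)
          * (axis j 1 \<bullet> sgn h) * (axis j 1 \<bullet> sgn h))) = \<rho>' h"
      proof eventually_elim
        case (elim h)
        have "(\<Sum>i\<in>UNIV. sgn h $ i * sgn h $ i) = 1"
        proof -
          have "sgn h \<bullet> sgn h = 1" using elim norm_sgn[of h] by (simp add: norm_eq_1)
          then show ?thesis by (simp add: inner_vec_def)
        qed
        moreover have "(\<Sum>i\<in>UNIV. \<Sum>j\<in>UNIV. \<rho>' h * ((axis i 1 \<bullet> sgn h) * (axis i 1 \<bullet> sgn h) *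
            (axis j 1 \<bullet> sgn h) * (axis j 1 \<bullet> sgn h)))
           = \<rho>' h * ((\<Sum>i\<in>UNIV. sgn h $ i * sgn h $ i) * (\<Sum>j\<in>UNIV. sgn h $ j * sgn h $ j))"
          by (simp add: inner_axis' sum_product sum_distrib_left mult_ac)
        ultimately show ?case by simp
      qed
    qed measurable
    also have "\<dots> = 1" by (rule one')
    finally show ?thesis .
  qed
  moreover have "(\<Sum>i\<in>UNIV. \<Sum>j\<in>UNIV. e (axis i 1) (axis i 1) (axis j 1) (axis j 1))
      = \<kappa> * (N * (N + 2)) / 3"
  proof -
    have "e (axis i 1) (axis i 1) (axis j 1) (axis j 1) = \<kappa> / 3 + (if i = j then 2 * \<kappa> / 3 else 0)"
        for i j :: 'n
      unfolding q3 by (auto simp: inner_axis_axis)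
    then show ?thesis
      by (simp add: N_def sum.distrib algebra_simps)
  qed
  ultimately have "\<kappa> / 3 * (N * (N + 2)) = 1" by simp
  moreover have "N * (N + 2) \<noteq> 0"
  proof -
    have "N > 0" by (simp add: N_def)
    then show ?thesis by simp
  qed
  ultimately have \<kappa>: "\<kappa> / 3 = 1 / (N * (N + 2))"
    by (metis nonzero_eq_divide_eq)
  have "e a b c d = ((a \<bullet> b) * (c \<bullet> d) + (a \<bullet> c) * (b \<bullet> d) + (a \<bullet> d) * (b \<bullet> c)) / (N * (N + 2))"
      for a b c d
  proof -
    have "e a b c d = (\<kappa> / 3) * ((a \<bullet> b) * (c \<bullet> d) + (a \<bullet> c) * (b \<bullet> d) + (a \<bullet> d) * (b \<bullet> c))"
      unfolding q3 by simp
    then show ?thesis unfolding \<kappa> by simp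
  qed
  moreover have "\<rho>' x \<ge> 0" for x by (simp add: \<rho>'_def)
  ultimately have "isotropic_kernel \<rho>'"
    unfolding isotropic_kernel_def using int' one' m by (auto simp: e_def N_def)
  with ae' show ?thesis by blast
qed

section \<open>Second difference quotients\<close>

definition second_diff :: "('a::real_normed_vector \<Rightarrow> real) \<Rightarrow> 'a \<Rightarrow> 'a \<Rightarrow> real" where
  "second_diff \<phi> h x = (\<phi> (x + h) - 2 * \<phi> x + \<phi> (x - h)) / (norm h)\<^sup>2"

definition directional_hess :: "(real^'n::finite \<Rightarrow> real) \<Rightarrow> real^'n \<Rightarrow> real^'n \<Rightarrow> real" where
  "directional_hess \<phi> h x = (\<Sum>k\<in>UNIV. \<Sum>l\<in>UNIV. sgn h $ k * sgn h $ l * hess \<phi> k l x)"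

text \<open>The error made in replacing the second difference quotient by the second derivative in the
  direction h. It vanishes for \<open>h = 0\<close>, where both terms are 0 by convention, so that bounds hold
  for all h.\<close>

definition taylor_error :: "(real^'n::finite \<Rightarrow> real) \<Rightarrow> real^'n \<Rightarrow> real^'n \<Rightarrow> real" where
  "taylor_error \<phi> h x = second_diff \<phi> h x - directional_hess \<phi> h x"

text \<open>Second-order Taylor formula for the even function \<open>t \<mapsto> \<phi>(x + th) + \<phi>(x - th)\<close>, whose first
  derivative vanishes at 0.\<close>

lemma second_diff_taylor:
  fixes \<phi> :: "real^'n::finite \<Rightarrow> real"
  assumes \<phi>: "test_function \<phi>"
  shows "\<exists>t. 0 < t \<and> t < 1 \<and>
    second_diff \<phi> h x = (directional_hess \<phi> h (x + t *\<^sub>R h) + directional_hess \<phi> h (x - t *\<^sub>R h)) / 2"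
proof -
  define S where "S y = (\<Sum>k\<in>UNIV. \<Sum>l\<in>UNIV. h $ k * h $ l * hess \<phi> k l y)" for y
  define D where "D k y = (\<Sum>i\<in>UNIV. k $ i * pderivative i \<phi> y)" for k y :: "real^'n"
  define diff where "diff m t = (if m = 0 then \<phi> (x + t *\<^sub>R h) + \<phi> (x + t *\<^sub>R (- h))
     else if m = Suc 0 then D h (x + t *\<^sub>R h) + D (- h) (x + t *\<^sub>R (- h))
     else S (x + t *\<^sub>R h) + S (x + t *\<^sub>R (- h)))" for m :: nat and t :: real
  have dD: "((\<lambda>t. D k (x + t *\<^sub>R k)) has_real_derivative
      (\<Sum>i\<in>UNIV. k $ i * (\<Sum>j\<in>UNIV. k $ j * hess \<phi> j i (x + t *\<^sub>R k)))) (at t)" for k t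
    unfolding D_def hess_def
    by (intro DERIV_sum DERIV_cmult test_function_line_derivative test_function_pderivative \<phi>)
  have S: "(\<Sum>i\<in>UNIV. k $ i * (\<Sum>j\<in>UNIV. k $ j * hess \<phi> j i y)) = S y" if "k = h \<or> k = - h" for k y
    using that unfolding S_def by (subst sum.swap) (auto simp: sum_distrib_left mult_ac sum_negf)
  have "\<exists>t>0. t < 1 \<and> diff 0 1 = (\<Sum>m<2. diff m 0 / fact m * 1 ^ m) + diff 2 t / fact 2 * 1 ^ 2"
  proof (rule Maclaurin)
    show "\<forall>m t. m < 2 \<and> 0 \<le> t \<and> t \<le> 1 \<longrightarrow> (diff m has_real_derivative diff (Suc m) t) (at t)"
    proof (intro allI impI)
      fix m :: nat and t :: real assume "m < 2 \<and> 0 \<le> t \<and> t \<le> 1"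
      then consider "m = 0" | "m = Suc 0" by linarith
      then show "(diff m has_real_derivative diff (Suc m) t) (at t)"
      proof cases
        case 1
        then show ?thesis
          using DERIV_add[OF test_function_line_derivative[OF \<phi>, of x h t]
              test_function_line_derivative[OF \<phi>, of x "-h" t]]
          unfolding diff_def D_def by simp
      next
        case 2
        have "((\<lambda>t. D h (x + t *\<^sub>R h) + D (- h) (x + t *\<^sub>R (- h))) has_real_derivative
           S (x + t *\<^sub>R h) + S (x + t *\<^sub>R (- h))) (at t)"
          using DERIV_add[OF dD[of h t] dD[of "-h" t]]
          unfolding S[OF disjI1[OF refl]] S[OF disjI2[OF refl]] .
        with 2 show ?thesis unfolding diff_def by simp
      qed
    qed
  qed auto
  then obtain t where t: "0 < t" "t < 1"
      and eq: "diff 0 1 = (\<Sum>m<2. diff m 0 / fact m * 1 ^ m) + diff 2 t / fact 2 * 1 ^ 2" by blast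
  have "D (-h) x = - D h x" by (simp add: D_def sum_negf)
  then have "\<phi> (x + h) - 2 * \<phi> x + \<phi> (x - h) = (S (x + t *\<^sub>R h) + S (x - t *\<^sub>R h)) / 2"
    using eq by (simp add: diff_def numeral_2_eq_2 field_simps)
  moreover have "S y / (norm h)\<^sup>2 = directional_hess \<phi> h y" for y
    unfolding S_def directional_hess_def sgn_div_norm
    by (simp add: sum_distrib_left sum_divide_distrib divide_inverse power2_eq_square mult_ac)
  ultimately have "second_diff \<phi> h x
      = (directional_hess \<phi> h (x + t *\<^sub>R h) + directional_hess \<phi> h (x - t *\<^sub>R h)) / 2"
    unfolding second_diff_def by (metis (no_types, lifting) add_divide_distrib divide_divide_eq_left
        mult.commute)
  with t show ?thesis by blast
qed

lemma abs_sgn_nth_le_1: "\<bar>sgn (h::real^'n::finite) $ k\<bar> \<le> 1"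
  by (rule order_trans[OF component_le_norm_cart norm_sgn_le_1])

lemma directional_hess_diff_le:
  fixes \<phi> :: "real^'n::finite \<Rightarrow> real"
  shows "\<bar>directional_hess \<phi> h y - directional_hess \<phi> h x\<bar>
      \<le> (\<Sum>k\<in>UNIV. \<Sum>l\<in>UNIV. \<bar>hess \<phi> k l y - hess \<phi> k l x\<bar>)"
proof -
  have "\<bar>directional_hess \<phi> h y - directional_hess \<phi> h x\<bar>
     = \<bar>\<Sum>k\<in>UNIV. \<Sum>l\<in>UNIV. sgn h $ k * sgn h $ l * (hess \<phi> k l y - hess \<phi> k l x)\<bar>"
    by (simp add: directional_hess_def sum_subtractf right_diff_distrib)
  also have "\<dots> \<le> (\<Sum>k\<in>UNIV. \<Sum>l\<in>UNIV. \<bar>sgn h $ k * sgn h $ l * (hess \<phi> k l y - hess \<phi> k l x)\<bar>)"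
    by (intro order_trans[OF sum_abs] sum_mono sum_abs)
  also have "\<dots> \<le> (\<Sum>k\<in>UNIV. \<Sum>l\<in>UNIV. \<bar>hess \<phi> k l y - hess \<phi> k l x\<bar>)"
    unfolding abs_mult by (intro sum_mono mult_left_le_one_le mult_le_one) (auto simp: abs_sgn_nth_le_1)
  finally show ?thesis .
qed

lemma directional_hess_abs_le:
  fixes \<phi> :: "real^'n::finite \<Rightarrow> real"
  shows "\<bar>directional_hess \<phi> h x\<bar> \<le> (\<Sum>k\<in>UNIV. \<Sum>l\<in>UNIV. \<bar>hess \<phi> k l x\<bar>)"
  unfolding directional_hess_def
  by (intro order_trans[OF sum_abs] sum_mono)
     (auto simp: abs_mult abs_sgn_nth_le_1 intro!: order_trans[OF sum_abs] sum_mono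
         mult_left_le_one_le mult_le_one)

lemma sum_hess_bounded:
  fixes \<phi> :: "real^'n::finite \<Rightarrow> real"
  assumes \<phi>: "test_function \<phi>"
  shows "\<exists>M>0. \<forall>x. (\<Sum>k\<in>UNIV. \<Sum>l\<in>UNIV. \<bar>hess \<phi> k l x\<bar>) \<le> M"
proof -
  have "\<exists>B>0. \<forall>x. \<bar>hess \<phi> k l x\<bar> \<le> B" for k l
    by (rule test_function_bounded[OF test_function_hess[OF \<phi>]])
  then obtain B where B: "\<And>k l. B k l > 0" "\<And>k l x. \<bar>hess \<phi> k l x\<bar> \<le> B k l" by metis
  then show ?thesis
    by (intro exI[of _ "\<Sum>k\<in>UNIV. \<Sum>l\<in>UNIV. B k l"]) (auto intro!: sum_pos sum_mono)
qed

lemma second_diff_bounded: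
  fixes \<phi> :: "real^'n::finite \<Rightarrow> real"
  assumes \<phi>: "test_function \<phi>"
  shows "\<exists>M>0. \<forall>h x. \<bar>second_diff \<phi> h x\<bar> \<le> M \<and> \<bar>directional_hess \<phi> h x\<bar> \<le> M \<and> \<bar>taylor_error \<phi> h x\<bar>
      \<le> 2 * M"
proof -
  obtain M where M: "M > 0" "\<And>x. (\<Sum>k\<in>UNIV. \<Sum>l\<in>UNIV. \<bar>hess \<phi> k l x\<bar>) \<le> M"
    using sum_hess_bounded[OF \<phi>] by blast
  have Q: "\<bar>directional_hess \<phi> h x\<bar> \<le> M" for h x
    by (rule order_trans[OF directional_hess_abs_le M(2)])
  have s: "\<bar>second_diff \<phi> h x\<bar> \<le> M" for h x
  proof -
    obtain t where "second_diff \<phi> h x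
        = (directional_hess \<phi> h (x + t *\<^sub>R h) + directional_hess \<phi> h (x - t *\<^sub>R h)) / 2"
      using second_diff_taylor[OF \<phi>] by blast
    moreover have "\<bar>(a + b) / 2\<bar> \<le> M" if "\<bar>a\<bar> \<le> M" "\<bar>b\<bar> \<le> M" for a b
      using that unfolding abs_le_iff by (auto simp: field_simps)
    ultimately show ?thesis using Q by presburger
  qed
  have "\<bar>taylor_error \<phi> h x\<bar> \<le> 2 * M" for h x using Q[of h x] s[of h x] unfolding taylor_error_def
    by linarith
  with Q s M(1) show ?thesis by blast
qed

lemma taylor_error_small:
  fixes \<phi> :: "real^'n::finite \<Rightarrow> real"
  assumes \<phi>: "test_function \<phi>" and "e > 0"
  shows "\<exists>d>0. \<forall>h x. norm h < d \<longrightarrow> \<bar>taylor_error \<phi> h x\<bar> \<le> e"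
proof -
  \<comment> \<open>Each of the \<open>N\<^sup>2\<close> entries of the Hessian contributes at most \<open>e'\<close>.\<close>
  define e' where "e' = e / (real CARD('n) * real CARD('n))"
  have e': "e' > 0" using \<open>e > 0\<close> by (simp add: e'_def)
  have "\<exists>d>0. \<forall>x y. norm (x - y) < d \<longrightarrow> \<bar>hess \<phi> k l x - hess \<phi> k l y\<bar> < e'" for k l
    by (rule test_function_uniformly_continuous[OF test_function_hess[OF \<phi>] e'])
  then obtain d where d: "\<And>k l. d k l > 0"
    "\<And>k l x y. norm (x - y) < d k l \<Longrightarrow> \<bar>hess \<phi> k l x - hess \<phi> k l y\<bar> < e'" by metis
  define \<delta> where "\<delta> = Min (range (\<lambda>(k, l). d k l))"
  have \<delta>: "\<delta> > 0" using d(1) by (auto simp: \<delta>_def)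
  have \<delta>': "\<delta> \<le> d k l" for k l unfolding \<delta>_def by (intro Min_le) auto
  have dh: "\<bar>directional_hess \<phi> h y - directional_hess \<phi> h x\<bar> \<le> e" if "norm (y - x) < \<delta>" for h x y
  proof -
    have "\<bar>directional_hess \<phi> h y - directional_hess \<phi> h x\<bar>
        \<le> (\<Sum>k\<in>UNIV. \<Sum>l\<in>UNIV. \<bar>hess \<phi> k l y - hess \<phi> k l x\<bar>)"
      by (rule directional_hess_diff_le)
    also have "\<dots> \<le> (\<Sum>k\<in>(UNIV::'n set). \<Sum>l\<in>(UNIV::'n set). e')"
      by (intro sum_mono less_imp_le d(2) less_le_trans[OF that \<delta>'])
    also have "\<dots> = e" by (simp add: e'_def)
    finally show ?thesis .
  qed
  have "\<bar>taylor_error \<phi> h x\<bar> \<le> e" if "norm h < \<delta>" for h x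
  proof -
    obtain t where t: "0 < t" "t < 1"
        and eq: "second_diff \<phi> h x = (directional_hess \<phi> h (x + t *\<^sub>R h)
        + directional_hess \<phi> h (x - t *\<^sub>R h)) / 2"
      using second_diff_taylor[OF \<phi>] by blast
    have "norm (t *\<^sub>R h) \<le> norm h" using t by (simp add: mult_left_le_one_le)
    then have "norm (t *\<^sub>R h) < \<delta>" using that by simp
    then have "\<bar>directional_hess \<phi> h (x + t *\<^sub>R h) - directional_hess \<phi> h x\<bar> \<le> e"
      "\<bar>directional_hess \<phi> h (x - t *\<^sub>R h) - directional_hess \<phi> h x\<bar> \<le> e"
      by (auto intro!: dh)
    moreover have "\<bar>(a + b) / 2 - c\<bar> \<le> e" if "\<bar>a - c\<bar> \<le> e" "\<bar>b - c\<bar> \<le> e" for a b c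
      using that unfolding abs_le_iff by (auto simp: field_simps)
    ultimately show ?thesis unfolding taylor_error_def eq by presburger
  qed
  with \<delta> show ?thesis by blast
qed

lemma borel_measurable_vec_nth_compose [measurable (raw)]:
  fixes f :: "'a \<Rightarrow> real^'n::finite"
  shows "f \<in> borel_measurable M \<Longrightarrow> (\<lambda>x. f x $ i) \<in> borel_measurable M"
  by (rule measurable_compose[OF _ borel_measurable_continuous_onI]) (auto intro: continuous_intros)

lemma borel_measurable_sgn_compose [measurable (raw)]:
  fixes f :: "'a \<Rightarrow> 'b::euclidean_space"
  shows "f \<in> borel_measurable M \<Longrightarrow> (\<lambda>x. sgn (f x)) \<in> borel_measurable M"
  by (rule measurable_compose[OF _ borel_measurable_sgn_euclidean])

lemma second_diff_measurable [measurable]: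
  fixes \<phi> :: "real^'n::finite \<Rightarrow> real"
  assumes [measurable]: "\<phi> \<in> borel_measurable borel"
  shows "(\<lambda>(h, x). second_diff \<phi> h x) \<in> borel_measurable (lborel \<Otimes>\<^sub>M lborel)"
  unfolding second_diff_def by measurable

lemma taylor_error_measurable:
  fixes \<phi> :: "real^'n::finite \<Rightarrow> real"
  assumes \<phi>: "test_function \<phi>"
  shows "(\<lambda>(h, x). taylor_error \<phi> h x) \<in> borel_measurable (lborel \<Otimes>\<^sub>M lborel)"
proof -
  have [measurable]: "\<phi> \<in> borel_measurable borel" using \<phi> by (rule test_function_borel_measurable)
  have [measurable]: "hess \<phi> k l \<in> borel_measurable borel" for k l
    using test_function_hess[OF \<phi>] by (rule test_function_borel_measurable)
  show ?thesis unfolding taylor_error_def second_diff_def directional_hess_def by measurable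
qed

text \<open>For \<open>|h| \<le> 1\<close> the error is supported in a fixed ball, so its \<open>L\<^sup>1\<close> norm is controlled by its
  supremum; for \<open>|h| > 1\<close> the quotient is bounded by the numerator, whose \<open>L\<^sup>1\<close> norm is
  translation invariant.\<close>

lemma taylor_error_L1:
  fixes \<phi> :: "real^'n::finite \<Rightarrow> real"
  assumes \<phi>: "test_function \<phi>"
  shows taylor_error_integrable: "integrable lborel (taylor_error \<phi> h)"
    and "\<exists>M>0. \<forall>h. (LINT x|lborel. \<bar>taylor_error \<phi> h x\<bar>) \<le> M"
    and "e > 0 \<Longrightarrow> \<exists>d>0. \<forall>h. norm h < d \<longrightarrow> (LINT x|lborel. \<bar>taylor_error \<phi> h x\<bar>) \<le> e"
proof -
  note int\<phi> = test_function_integrable[OF \<phi>]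
  have [measurable]: "\<phi> \<in> borel_measurable borel" using \<phi> by (rule test_function_borel_measurable)
  have inth: "integrable lborel (hess \<phi> k l)" for k l
    by (rule test_function_integrable[OF test_function_hess[OF \<phi>]])
  have ish: "integrable lborel (\<lambda>x. \<phi> (x + h))" "integrable lborel (\<lambda>x. \<phi> (x - h))" for h
    using integrable_shift_lborel[OF int\<phi>, of h] integrable_shift_lborel[OF int\<phi>, of "-h"] by auto
  have i: "integrable lborel (taylor_error \<phi> h)" for h
    unfolding taylor_error_def second_diff_def directional_hess_def
    using ish inth int\<phi> by (intro Bochner_Integration.integrable_diff Bochner_Integration.integrable_sum
      integrable_mult_right integrable_divide Bochner_Integration.integrable_add) auto
  then show "integrable lborel (taylor_error \<phi> h)" .
  obtain R where R: "R > 0" "\<And>x. R < norm x \<Longrightarrow> \<phi> x = 0" using test_function_vanishes[OF \<phi>] by metis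
  have hz: "hess \<phi> k l x = 0" if "R < norm x" for k l x
  proof -
    have "pderivative l \<phi> y = 0" if "R < norm y" for y
      using pderivative_vanishes[of R \<phi> y] R(2) that by blast
    then show ?thesis unfolding hess_def using pderivative_vanishes[of R "pderivative l \<phi>" x] that
      by blast
  qed
  have z: "taylor_error \<phi> h x = 0" if "norm h \<le> 1" "R + 1 < norm x" for h x
  proof -
    have "R < norm (x + h)" "R < norm (x - h)"
      using that norm_triangle_ineq2[of x "-h"] norm_triangle_ineq2[of x h] by auto
    then show ?thesis using that R(2) hz
      by (simp add: taylor_error_def second_diff_def directional_hess_def)
  qed
  define V where "V = measure lborel (cball (0::real^'n) (R+1))"
  have V: "V \<ge> 0" by (simp add: V_def)
  have small: "(LINT x|lborel. \<bar>taylor_error \<phi> h x\<bar>) \<le> B * V"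
      if "norm h \<le> 1" "\<And>x. \<bar>taylor_error \<phi> h x\<bar> \<le> B" for h B
  proof -
    have "(LINT x|lborel. \<bar>taylor_error \<phi> h x\<bar>)
        \<le> (LINT x|lborel. B * indicator (cball (0::real^'n) (R+1)) x)"
    proof (rule integral_mono)
      show "integrable lborel (\<lambda>x. B * indicat_real (cball (0::real^'n) (R+1)) x)"
        using emeasure_lborel_cball_finite[of "0::real^'n" "R+1"]
        by (intro integrable_mult_right integrable_real_indicator) auto
      show "\<bar>taylor_error \<phi> h x\<bar> \<le> B * indicat_real (cball (0::real^'n) (R+1)) x" for x
        using that z[of h x] by (auto simp: indicator_def)
    qed (use i in auto)
    then show ?thesis by (simp add: V_def)
  qed
  obtain M where M: "M > 0" "\<And>h x. \<bar>taylor_error \<phi> h x\<bar> \<le> 2 * M" using second_diff_bounded[OF \<phi>]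
    by blast
  define L where "L = 4 * (LINT x|lborel. \<bar>\<phi> x\<bar>) + (\<Sum>k\<in>UNIV. \<Sum>l\<in>UNIV. (LINT x|lborel. \<bar>hess \<phi> k l x\<bar>))"
  have L: "L \<ge> 0" unfolding L_def by (intro add_nonneg_nonneg sum_nonneg) auto
  have large: "(LINT x|lborel. \<bar>taylor_error \<phi> h x\<bar>) \<le> L" if h: "norm h > 1" for h
  proof -
    have nh: "(norm h)\<^sup>2 \<ge> 1" using h by simp
    have "(LINT x|lborel. \<bar>taylor_error \<phi> h x\<bar>)
        \<le> (LINT x|lborel. \<bar>\<phi> (x + h)\<bar> + 2 * \<bar>\<phi> x\<bar> + \<bar>\<phi> (x - h)\<bar> + (\<Sum>k\<in>UNIV. \<Sum>l\<in>UNIV. \<bar>hess \<phi> k l x\<bar>))"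
    proof (rule integral_mono)
      fix x
      have "\<bar>second_diff \<phi> h x\<bar> \<le> \<bar>\<phi> (x + h) - 2 * \<phi> x + \<phi> (x - h)\<bar>"
        using nh by (simp add: second_diff_def divide_le_eq mult_left_le mult_le_cancel_left1)
      then show "\<bar>taylor_error \<phi> h x\<bar>
          \<le> \<bar>\<phi> (x + h)\<bar> + 2 * \<bar>\<phi> x\<bar> + \<bar>\<phi> (x - h)\<bar> + (\<Sum>k\<in>UNIV. \<Sum>l\<in>UNIV. \<bar>hess \<phi> k l x\<bar>)"
        using directional_hess_abs_le[of \<phi> h x] unfolding taylor_error_def by linarith
    qed (use i ish int\<phi> inth in auto)
    also have "\<dots> = (LINT x|lborel. \<bar>\<phi> (x + h)\<bar>) + 2 * (LINT x|lborel. \<bar>\<phi> x\<bar>)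
        + (LINT x|lborel. \<bar>\<phi> (x - h)\<bar>)
        + (\<Sum>k\<in>UNIV. \<Sum>l\<in>UNIV. (LINT x|lborel. \<bar>hess \<phi> k l x\<bar>))"
      using ish int\<phi> inth by simp
    also have "\<dots> = L"
      using integral_lborel_shift[of "\<lambda>x. \<bar>\<phi> x\<bar>" h] integral_lborel_shift[of "\<lambda>x. \<bar>\<phi> x\<bar>" "-h"]
      by (simp add: L_def)
    finally show ?thesis .
  qed
  show "\<exists>M>0. \<forall>h. (LINT x|lborel. \<bar>taylor_error \<phi> h x\<bar>) \<le> M"
  proof (intro exI[of _ "2 * M * V + L + 1"] conjI allI)
    show "2 * M * V + L + 1 > 0" using M V L by (simp add: add_nonneg_pos)
    fix h
    have "2 * M * V \<ge> 0" using M V by simp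
    then show "(LINT x|lborel. \<bar>taylor_error \<phi> h x\<bar>) \<le> 2 * M * V + L + 1"
      using small[OF _ M(2), of h] large[of h] L by (cases "norm h \<le> 1") auto
  qed
  show "\<exists>d>0. \<forall>h. norm h < d \<longrightarrow> (LINT x|lborel. \<bar>taylor_error \<phi> h x\<bar>) \<le> e" if "e > 0"
  proof -
    have e': "e / (V + 1) > 0" "e / (V + 1) * V \<le> e" using that V by (auto simp: field_simps)
    obtain d where d: "d > 0" "\<And>h x. norm h < d \<Longrightarrow> \<bar>taylor_error \<phi> h x\<bar> \<le> e / (V + 1)"
      using taylor_error_small[OF \<phi> e'(1)] by blast
    have "(LINT x|lborel. \<bar>taylor_error \<phi> h x\<bar>) \<le> e" if "norm h < min d 1" for h
      using order_trans[OF small e'(2)] d(2) that by simp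
    then show ?thesis using d(1) by (intro exI[of _ "min d 1"]) simp
  qed
qed

section \<open>The non-local Hessian of a test function and its limit\<close>

text \<open>The matrix weight of the non-local Hessian, including the normalising factor, as a function of
  the direction of h alone.\<close>

definition kern :: "'n::finite \<Rightarrow> 'n \<Rightarrow> real^'n \<Rightarrow> real" where
  "kern i j h = real CARD('n) * (real CARD('n) + 2) / 2 *
     (sgn h $ i * sgn h $ j - (if i = j then 1 else 0) / (real CARD('n) + 2))"

text \<open>An entry of the non-local Hessian as a scalar integral over Borel sets, the form in which
  Fubini's theorem can be applied.\<close>

definition nlh :: "(real^'n::finite \<Rightarrow> real) \<Rightarrow> (real^'n \<Rightarrow> real) \<Rightarrow> 'n \<Rightarrow> 'n \<Rightarrow> real^'n \<Rightarrow> real" where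
  "nlh \<rho> \<phi> i j x = (LINT h|lborel. second_diff \<phi> h x * kern i j h * \<rho> h)"

definition tail :: "('a::euclidean_space \<Rightarrow> real) \<Rightarrow> real \<Rightarrow> real" where
  "tail \<rho> d = (LINT h|lborel. indicator {h. d < norm h} h * \<rho> h)"

lemma kern_measurable [measurable]: "kern i j \<in> borel_measurable borel"
  unfolding kern_def[abs_def] by measurable

lemma kern_bounded: "\<bar>kern i j (h::real^'n::finite)\<bar> \<le> real CARD('n) * (real CARD('n) + 2)"
proof -
  have "\<bar>sgn h $ i * sgn h $ j\<bar> \<le> 1" unfolding abs_mult by (intro mult_le_one abs_sgn_nth_le_1) auto
  moreover have "\<bar>(if i = j then 1 else 0) / (real CARD('n) + 2)\<bar> \<le> 1" by simp
  ultimately have "\<bar>sgn h $ i * sgn h $ j - (if i = j then 1 else 0) / (real CARD('n) + 2)\<bar> \<le> 2"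
    using abs_triangle_ineq4[of "sgn h $ i * sgn h $ j"
        "(if i = j then 1 else 0) / (real CARD('n) + 2)"] by linarith
  then have "real CARD('n) * (real CARD('n) + 2) / 2 * \<bar>sgn h $ i * sgn h $ j - (if i
      = j then 1 else 0) / (real CARD('n) + 2)\<bar>
     \<le> real CARD('n) * (real CARD('n) + 2) / 2 * 2" by (intro mult_left_mono) auto
  then show ?thesis by (simp add: kern_def abs_mult)
qed

lemma isotropic_kernelD:
  assumes "isotropic_kernel \<rho>"
  shows "\<rho> \<in> borel_measurable borel" "\<rho> x \<ge> 0" "integrable lborel \<rho>" "(LINT x|lborel. \<rho> x) = 1"
  using assms unfolding isotropic_kernel_def by auto

lemma isotropic_fourth_moment:
  fixes \<rho> :: "real^'n::finite \<Rightarrow> real"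
  assumes "isotropic_kernel \<rho>"
  shows "(LINT h|lborel. \<rho> h * (sgn h $ k * sgn h $ l * sgn h $ i * sgn h $ j)) =
    ((if k = l then 1 else 0) * (if i = j then 1 else 0) + (if k = i then 1 else 0) * (if l
        = j then 1 else 0)
      + (if k = j then 1 else 0) * (if l = i then 1 else 0)) / (real CARD('n) * (real CARD('n) + 2))"
proof -
  have "angular_mean \<rho> (\<lambda>\<theta>. (axis k 1 \<bullet> \<theta>) * (axis l 1 \<bullet> \<theta>) * (axis i 1 \<bullet> \<theta>) * (axis j 1 \<bullet> \<theta>)) =
     ((axis k 1 \<bullet> (axis l 1 :: real^'n)) * (axis i 1 \<bullet> (axis j 1 :: real^'n))
         + (axis k 1 \<bullet> (axis i 1 :: real^'n)) * (axis l 1 \<bullet> (axis j 1 :: real^'n))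
       + (axis k 1 \<bullet> (axis j 1 :: real^'n)) * (axis l 1 \<bullet> (axis i 1 :: real^'n))) /
           (real CARD('n) * (real CARD('n) + 2))"
    using assms unfolding isotropic_kernel_def by blast
  then show ?thesis
    unfolding angular_mean_def inner_axis_axis inner_axis'
    by (simp only: inner_real_def mult_1_left mult_1_right) (auto simp: axis_def)
qed

lemma sgn_monomial_integrable:
  fixes \<rho> :: "real^'n::finite \<Rightarrow> real"
  assumes "isotropic_kernel \<rho>"
  shows "integrable lborel (\<lambda>h. \<rho> h * (sgn h $ k * sgn h $ l * sgn h $ i * sgn h $ j))"
    and "integrable lborel (\<lambda>h. \<rho> h * (sgn h $ k * sgn h $ l))"
proof -
  have "continuous_on UNIV (\<lambda>\<theta>::real^'n. \<theta> $ k * \<theta> $ l * \<theta> $ i * \<theta> $ j)"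
      "continuous_on UNIV (\<lambda>\<theta>::real^'n. \<theta> $ k * \<theta> $ l)"
    by (intro continuous_intros)+
  from this[THEN angular_integrable[OF isotropic_kernelD(3)[OF assms]]]
  show "integrable lborel (\<lambda>h. \<rho> h * (sgn h $ k * sgn h $ l * sgn h $ i * sgn h $ j))"
    "integrable lborel (\<lambda>h. \<rho> h * (sgn h $ k * sgn h $ l))" by blast+
qed

lemma isotropic_second_moment:
  fixes \<rho> :: "real^'n::finite \<Rightarrow> real"
  assumes iso: "isotropic_kernel \<rho>"
  shows "(LINT h|lborel. \<rho> h * (sgn h $ k * sgn h $ l)) = (if k = l then 1 else 0) / real CARD('n)"
proof -
  note [measurable] = isotropic_kernelD(1)[OF iso]
  let ?\<delta> = "\<lambda>k l. if k = l then 1 else 0 :: real"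
  have "(LINT h|lborel. \<rho> h * (sgn h $ k * sgn h $ l))
    = (LINT h|lborel. (\<Sum>m\<in>UNIV. \<rho> h * (sgn h $ k * sgn h $ l * sgn h $ m * sgn h $ m)))"
  proof (rule integral_cong_AE)
    have "AE h in lborel. h \<noteq> (0::real^'n)" by (rule AE_lborel_singleton)
    then show "AE h in lborel. \<rho> h * (sgn h $ k * sgn h $ l)
        = (\<Sum>m\<in>UNIV. \<rho> h * (sgn h $ k * sgn h $ l * sgn h $ m * sgn h $ m))"
    proof eventually_elim
      case (elim h)
      have "sgn h \<bullet> sgn h = 1" using elim norm_sgn[of h] by (simp add: norm_eq_1)
      then have "(\<Sum>m\<in>UNIV. sgn h $ m * sgn h $ m) = 1" by (simp add: inner_vec_def)
      moreover have "(\<Sum>m\<in>UNIV. \<rho> h * (sgn h $ k * sgn h $ l * sgn h $ m * sgn h $ m))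
        = \<rho> h * (sgn h $ k * sgn h $ l) * (\<Sum>m\<in>UNIV. sgn h $ m * sgn h $ m)"
        by (simp add: sum_distrib_left mult_ac)
      ultimately show ?case by simp
    qed
  qed measurable
  also have "\<dots> = (\<Sum>m\<in>UNIV. (?\<delta> k l * ?\<delta> m m + ?\<delta> k m * ?\<delta> l m
      + ?\<delta> k m * ?\<delta> l m) / (real CARD('n) * (real CARD('n) + 2)))"
    using sgn_monomial_integrable(1)[OF iso] isotropic_fourth_moment[OF iso] by simp
  also have "\<dots> = (\<Sum>m\<in>UNIV. ?\<delta> k l * (1 + 2 * ?\<delta> k m) / (real CARD('n) * (real CARD('n) + 2)))"
    by (intro sum.cong) auto
  also have "\<dots> = ?\<delta> k l * (\<Sum>m\<in>UNIV. 1 + 2 * ?\<delta> k m) / (real CARD('n) * (real CARD('n) + 2))"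
    by (simp add: sum_distrib_left sum_divide_distrib)
  also have "(\<Sum>m\<in>UNIV. 1 + 2 * ?\<delta> k m) = real CARD('n) + 2"
    by (simp add: sum.distrib flip: sum_distrib_left)
  finally show ?thesis by simp
qed

text \<open>The moments turn the average of \<open>\<theta>\<^sub>k\<theta>\<^sub>l\<close> against the weight into
  \<open>(\<delta>\<^sub>k\<^sub>i\<delta>\<^sub>l\<^sub>j + \<delta>\<^sub>k\<^sub>j\<delta>\<^sub>l\<^sub>i) / 2\<close>: the trace part of the fourth moments cancels against the second
  moments. The result is the symmetrised derivative, and second derivatives commute.\<close>

lemma average_directional_hess:
  fixes \<rho> :: "real^'n::finite \<Rightarrow> real"
  assumes iso: "isotropic_kernel \<rho>" and \<phi>: "test_function \<phi>"
  shows "(LINT h|lborel. directional_hess \<phi> h x * kern i j h * \<rho> h) = hess \<phi> i j x"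
proof -
  let ?\<delta> = "\<lambda>k l. if k = l then 1 else 0 :: real"
  let ?A = "\<lambda>k l. hess \<phi> k l x"
  define N where "N = real CARD('n)"
  have N: "N > 0" by (simp add: N_def)
  have sum_if: "(\<Sum>l\<in>UNIV. if P then g l else 0) = (if P then (\<Sum>l\<in>UNIV. g l) else 0)" for P
      and g :: "'n \<Rightarrow> real"
    by simp
  have "directional_hess \<phi> h x * kern i j h * \<rho> h =
    (\<Sum>k\<in>UNIV. \<Sum>l\<in>UNIV. (N * (N + 2) / 2 * ?A k l) *
        (\<rho> h * (sgn h $ k * sgn h $ l * sgn h $ i * sgn h $ j))
       - (N / 2 * ?\<delta> i j * ?A k l) * (\<rho> h * (sgn h $ k * sgn h $ l)))" for h
  proof -
    have k: "kern i j h = N * (N + 2) / 2 * (sgn h $ i * sgn h $ j) - N / 2 * ?\<delta> i j"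
      using N unfolding kern_def N_def[symmetric] by (simp add: field_simps)
    have "directional_hess \<phi> h x * kern i j h * \<rho> h
      = (\<Sum>k\<in>UNIV. \<Sum>l\<in>UNIV. sgn h $ k * sgn h $ l * ?A k l * (N * (N
          + 2) / 2 * (sgn h $ i * sgn h $ j) - N / 2 * ?\<delta> i j) * \<rho> h)"
      unfolding directional_hess_def k by (simp only: sum_distrib_right)
    also have "\<dots> = (\<Sum>k\<in>UNIV. \<Sum>l\<in>UNIV. (N * (N
        + 2) / 2 * ?A k l) * (\<rho> h * (sgn h $ k * sgn h $ l * sgn h $ i * sgn h $ j))
       - (N / 2 * ?\<delta> i j * ?A k l) * (\<rho> h * (sgn h $ k * sgn h $ l)))"
      by (intro sum.cong refl) (simp add: algebra_simps del: mult_cancel_left mult_cancel_right)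
    finally show ?thesis .
  qed
  then have "(LINT h|lborel. directional_hess \<phi> h x * kern i j h * \<rho> h)
    = (\<Sum>k\<in>UNIV. \<Sum>l\<in>UNIV. (N * (N + 2) / 2 * ?A k l) *
        (LINT h|lborel. \<rho> h * (sgn h $ k * sgn h $ l * sgn h $ i * sgn h $ j))
       - (N / 2 * ?\<delta> i j * ?A k l) * (LINT h|lborel. \<rho> h * (sgn h $ k * sgn h $ l)))"
    using sgn_monomial_integrable[OF iso] by simp
  also have "\<dots> = (\<Sum>k\<in>UNIV. \<Sum>l\<in>UNIV. (if k = i then if l = j then ?A k l / 2 else 0 else 0)
       + (if k = j then if l = i then ?A k l / 2 else 0 else 0))"
    unfolding isotropic_fourth_moment[OF iso] isotropic_second_moment[OF iso] N_def[symmetric]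
  proof (intro sum.cong refl)
    have c1: "(p / 2 * a) * (r / p) = a / 2 * r" if "p \<noteq> 0" for p a r :: real using that by simp
    have c: "(N * (N + 2) / 2 * a) * (r / (N * (N + 2))) = a / 2 * r" "(N / 2 * d * a) * (r / N)
        = d * a / 2 * r" for a r d
      using c1[of "N * (N + 2)"] N by auto
    show "(N * (N + 2) / 2 * ?A k l) * ((?\<delta> k l * ?\<delta> i j + ?\<delta> k i * ?\<delta> l j
        + ?\<delta> k j * ?\<delta> l i) / (N * (N + 2)))
       - (N / 2 * ?\<delta> i j * ?A k l) * (?\<delta> k l / N)
      = (if k = i then if l = j then ?A k l / 2 else 0 else 0) + (if k = j then if l
          = i then ?A k l / 2 else 0 else 0)" for k l
      unfolding c by auto
  qed
  also have "\<dots> = (?A i j + ?A j i) / 2"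
    by (simp add: sum.distrib add_divide_distrib sum_if)
  also have "\<dots> = ?A i j" using hess_symmetric[OF \<phi>, of i j x] by simp
  finally show ?thesis .
qed

lemma integrable_matrixI:
  fixes F :: "'a \<Rightarrow> real^'n::finite^'m::finite"
  assumes "\<And>k l. integrable M (\<lambda>x. F x $ k $ l)"
  shows "integrable M F"
proof -
  have sum_if: "(\<Sum>l\<in>UNIV. if P then g l else 0) = (if P then (\<Sum>l\<in>UNIV. g l) else 0)" for P
      and g :: "'n \<Rightarrow> real"
    by simp
  have "F x = (\<Sum>k\<in>UNIV. \<Sum>l\<in>UNIV. (F x $ k $ l) *\<^sub>R axis k (axis l 1))" for x
    by (simp add: vec_eq_iff axis_def if_distrib[of "\<lambda>a. a $ _"] if_distrib[of
        "\<lambda>a. _ * a"] sum_if cong: if_cong)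
  then have "F = (\<lambda>x. \<Sum>k\<in>UNIV. \<Sum>l\<in>UNIV. (F x $ k $ l) *\<^sub>R axis k (axis l 1))" ..
  moreover have "integrable M (\<lambda>x. \<Sum>k\<in>UNIV. \<Sum>l\<in>UNIV. (F x $ k $ l) *\<^sub>R
      (axis k (axis l 1) :: real^'n^'m))"
    using assms by (intro Bochner_Integration.integrable_sum integrable_scaleR_left)
  ultimately show ?thesis by simp
qed

lemma nonlocal_hessian_component:
  fixes \<rho> :: "real^'n::finite \<Rightarrow> real"
  assumes iso: "isotropic_kernel \<rho>'"
      and \<rho>: "\<rho> \<in> borel_measurable lebesgue" "AE x in lebesgue. \<rho> x = \<rho>' x"
    and \<phi>: "test_function \<phi>"
  shows "nonlocal_hessian \<rho> \<phi> x $ i $ j = nlh \<rho>' \<phi> i j x"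
proof -
  note [measurable] = isotropic_kernelD(1)[OF iso] test_function_borel_measurable[OF \<phi>]
  let ?N = "real CARD('n)"
  let ?s = "\<lambda>h. (\<phi> (x + h) - 2 * \<phi> x + \<phi> (x - h)) / (norm h)\<^sup>2 * (1 / (norm h)\<^sup>2)"
  let ?T = "\<lambda>h::real^'n. outer h h - ((norm h)\<^sup>2 / (?N + 2)) *\<^sub>R mat 1"
  have T [measurable]: "?T \<in> borel_measurable borel"
    by (intro borel_measurable_continuous_onI continuous_intros)
        (simp_all add: outer_def continuous_intros)
  define F where "F h = (?s h * \<rho>' h) *\<^sub>R ?T h" for h
  have [measurable]: "F \<in> borel_measurable borel" unfolding F_def by measurable
  have leb: "f \<in> borel_measurable borel \<Longrightarrow> f \<in> borel_measurable lebesgue"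
      for f :: "real^'n \<Rightarrow> 'z::topological_space"
    by (auto intro: measurable_completion)
  have eq1: "(LINT h|lebesgue. (?s h * \<rho> h) *\<^sub>R ?T h) = (LINT h|lborel. F h)"
  proof -
    have "(LINT h|lebesgue. (?s h * \<rho> h) *\<^sub>R ?T h) = (LINT h|lebesgue. F h)"
    proof (rule integral_cong_AE)
      show "AE h in lebesgue. (?s h * \<rho> h) *\<^sub>R ?T h = F h"
        using \<rho>(2) by eventually_elim (simp add: F_def)
      have s: "?s \<in> borel_measurable lebesgue" by (rule leb) measurable
      show "(\<lambda>h. (?s h * \<rho> h) *\<^sub>R ?T h) \<in> borel_measurable lebesgue"
        by (rule borel_measurable_scaleR[OF borel_measurable_times[OF s \<rho>(1)] leb[OF T]])
      show "F \<in> borel_measurable lebesgue" by (rule leb) measurable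
    qed
    also have "\<dots> = (LINT h|lborel. F h)" by (subst integral_completion) auto
    finally show ?thesis .
  qed
  have comp: "?N * (?N + 2) / 2 * (F h $ k $ l) = second_diff \<phi> h x * kern k l h * \<rho>' h" for h k l
  proof (cases "h = 0")
    case True then show ?thesis by (simp add: F_def second_diff_def)
  next
    case False
    then have "(h $ k * h $ l - (norm h)\<^sup>2 / (?N + 2) * (if k = l then 1 else 0)) / (norm h)\<^sup>2
       = sgn h $ k * sgn h $ l - (if k = l then 1 else 0) / (?N + 2)"
      by (simp add: sgn_div_norm power2_eq_square field_simps)
    then have k: "kern k l h = ?N * (?N + 2) / 2 * ((h $ k * h $ l - (norm h)\<^sup>2 / (?N + 2) * (if k
        = l then 1 else 0)) / (norm h)\<^sup>2)"
      unfolding kern_def by simp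
    have Fkl: "F h $ k $ l = ?s h * \<rho>' h * (h $ k * h $ l - (norm h)\<^sup>2 / (?N + 2) * (if k
        = l then 1 else 0))"
      by (simp add: F_def outer_def mat_def)
    have "c * (D / p * (1 / p) * r * X) = D / p * (c * (X / p)) * r" for c D p r X :: real
      by (simp add: divide_inverse mult_ac)
    then show ?thesis unfolding Fkl k second_diff_def .
  qed
  obtain M where M: "M > 0" "\<And>h x. \<bar>second_diff \<phi> h x\<bar> \<le> M" using second_diff_bounded[OF \<phi>] by blast
  have intc: "integrable lborel (\<lambda>h. F h $ k $ l)" for k l
  proof -
    have "integrable lborel (\<lambda>h. second_diff \<phi> h x * kern k l h * \<rho>' h)"
    proof (rule Bochner_Integration.integrable_bound[OF integrable_mult_right[OF
        isotropic_kernelD(3)[OF iso], of "M * (?N * (?N + 2))"]])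
      show "AE h in lborel. norm (second_diff \<phi> h x * kern k l h * \<rho>' h)
          \<le> norm (M * (?N * (?N + 2)) * \<rho>' h)"
        using M kern_bounded[of k l] isotropic_kernelD(2)[OF iso]
        by (intro AE_I2) (simp add: abs_mult, intro mult_right_mono mult_mono, auto)
    qed (unfold second_diff_def, measurable)
    then have "integrable lborel (\<lambda>h. ?N * (?N + 2) / 2 * (F h $ k $ l))" unfolding comp .
    from integrable_mult_right[OF this, of "2 / (?N * (?N + 2))"]
    have "integrable lborel (\<lambda>h. 2 / (?N * (?N + 2)) * (?N * (?N + 2) / 2 * (F h $ k $ l)))" .
    moreover have "2 / c * (c / 2 * X) = X" if "c \<noteq> 0" for c X :: real using that by simp
    moreover have "?N * (?N + 2) \<noteq> 0" by (simp add: add_pos_pos less_imp_neq[symmetric])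
    ultimately show ?thesis by simp
  qed
  have "integrable lborel F" by (rule integrable_matrixI[OF intc])
  then have "(LINT h|lborel. F h) $ i $ j = (LINT h|lborel. F h $ i $ j)"
    using integral_bounded_linear[OF bounded_linear_compose[OF bounded_linear_vec_nth
        bounded_linear_vec_nth], of lborel F i j] by simp
  then show ?thesis
    unfolding nonlocal_hessian_def nlh_def eq1 comp[symmetric] by simp
qed

text \<open>Splitting at \<open>|h| = d\<close> the average of F is at most e plus M times the mass outside; the halved
  radius turns \<open>|h| \<ge> d\<close> into the strict inequality of the tail.\<close>

lemma kernel_average_le:
  assumes iso: "isotropic_kernel \<rho>" and F [measurable]: "F \<in> borel_measurable borel"
    and pos: "\<And>h. 0 \<le> F h" and M: "\<And>h. F h \<le> M" and e: "e \<ge> 0" "\<And>h. norm h < d \<Longrightarrow> F h \<le> e" and "d > 0"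
  shows "(LINT h|lborel. F h * \<rho> h) \<le> e + M * tail \<rho> (d/2)"
proof -
  note [measurable] = isotropic_kernelD(1)[OF iso] and \<rho>0 = isotropic_kernelD(2)[OF iso] and int
      = isotropic_kernelD(3)[OF iso]
  have M0: "M \<ge> 0" using pos[of 0] M[of 0] by linarith
  have i1: "integrable lborel (\<lambda>h. indicator {h. d/2 < norm h} h * \<rho> h)"
    by (rule Bochner_Integration.integrable_bound[OF int]) (auto simp: indicator_def)
  have i2: "integrable lborel (\<lambda>h. F h * \<rho> h)"
    by (rule Bochner_Integration.integrable_bound[OF integrable_mult_right[OF int, of M]])
       (use M0 pos M \<rho>0 in \<open>auto simp: abs_mult intro!: AE_I2 mult_right_mono\<close>)
  have "(LINT h|lborel. F h * \<rho> h)
      \<le> (LINT h|lborel. e * \<rho> h + M * (indicator {h. d/2 < norm h} h * \<rho> h))"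
  proof (rule integral_mono)
    fix h
    show "F h * \<rho> h \<le> e * \<rho> h + M * (indicator {h. d/2 < norm h} h * \<rho> h)"
    proof (cases "norm h < d")
      case True
      then have "F h * \<rho> h \<le> e * \<rho> h" using e(2) \<rho>0 by (intro mult_right_mono) auto
      moreover have "M * (indicator {h. d/2 < norm h} h * \<rho> h) \<ge> 0" using M0 \<rho>0 by simp
      ultimately show ?thesis by linarith
    next
      case False
      then have "d / 2 < norm h" using \<open>d > 0\<close> by linarith
      then have "F h * \<rho> h \<le> M * (indicator {h. d/2 < norm h} h * \<rho> h)" using M[of h] \<rho>0
        by (simp add: mult_right_mono)
      moreover have "e * \<rho> h \<ge> 0" using e \<rho>0 by simp
      ultimately show ?thesis by linarith
    qed
  qed (use i1 i2 int in auto)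
  also have "\<dots> = e + M * tail \<rho> (d/2)"
    using i1 int isotropic_kernelD(4)[OF iso] by (simp add: tail_def)
  finally show ?thesis .
qed

lemma kernel_product_integrable:
  fixes \<rho> :: "real^'n::finite \<Rightarrow> real"
  assumes iso: "isotropic_kernel \<rho>"
    and r [measurable]: "(\<lambda>(h, x). r h x) \<in> borel_measurable (lborel \<Otimes>\<^sub>M lborel)"
    and int: "\<And>h. integrable lborel (r h)" and M: "\<And>h. (LINT x|lborel. \<bar>r h x\<bar>) \<le> M"
  shows "integrable (lborel \<Otimes>\<^sub>M lborel) (\<lambda>(h, x). r h x * kern i j h * \<rho> h)"
proof (rule lborel_pair.Fubini_integrable)
  note [measurable] = isotropic_kernelD(1)[OF iso] and \<rho>0 = isotropic_kernelD(2)[OF iso]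
  show "(\<lambda>(h, x). r h x * kern i j h * \<rho> h) \<in> borel_measurable (lborel \<Otimes>\<^sub>M lborel)"
    by measurable
  have M0: "M \<ge> 0" using order_trans[OF _ M[of 0]] by simp
  let ?K = "real CARD('n) * (real CARD('n) + 2)"
  have eq: "(LINT x|lborel. norm (r h x * kern i j h * \<rho> h))
      = (LINT x|lborel. \<bar>r h x\<bar>) * (\<bar>kern i j h\<bar> * \<rho> h)" for h
    using \<rho>0 by (simp add: abs_mult mult.assoc)
  show "integrable lborel (\<lambda>h. LINT x|lborel. norm (case (h, x) of (h, x) \<Rightarrow> r h x * kern i j h * \<rho> h))"
    unfolding prod.case eq
  proof (rule Bochner_Integration.integrable_bound[OF integrable_mult_right[OF
      isotropic_kernelD(3)[OF iso], of "M * ?K"]])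
    show "(\<lambda>h. (LINT x|lborel. \<bar>r h x\<bar>) * (\<bar>kern i j h\<bar> * \<rho> h)) \<in> borel_measurable lborel" by measurable
    show "AE h in lborel. norm ((LINT x|lborel. \<bar>r h x\<bar>) * (\<bar>kern i j h\<bar> * \<rho> h)) \<le> norm (M * ?K * \<rho> h)"
    proof (rule AE_I2)
      fix h
      have "(LINT x|lborel. \<bar>r h x\<bar>) * (\<bar>kern i j h\<bar> * \<rho> h) \<le> M * (?K * \<rho> h)"
        using M0 \<rho>0 kern_bounded[of i j h] by (intro mult_mono M mult_right_mono) auto
      then show "norm ((LINT x|lborel. \<bar>r h x\<bar>) * (\<bar>kern i j h\<bar> * \<rho> h)) \<le> norm (M * ?K * \<rho> h)"
        using M0 \<rho>0 by (simp add: abs_mult mult.assoc)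
    qed
  qed
  show "AE h in lborel. integrable lborel (\<lambda>x. case (h, x) of (h, x) \<Rightarrow> r h x * kern i j h * \<rho> h)"
    unfolding prod.case by (intro AE_I2 integrable_mult_left int)
qed

lemma second_diff_L1:
  fixes \<phi> :: "real^'n::finite \<Rightarrow> real"
  assumes \<phi>: "test_function \<phi>"
  shows second_diff_integrable: "integrable lborel (second_diff \<phi> h)"
    and "\<exists>M. \<forall>h. (LINT x|lborel. \<bar>second_diff \<phi> h x\<bar>) \<le> M"
proof -
  have inth: "integrable lborel (hess \<phi> k l)" for k l
    by (rule test_function_integrable[OF test_function_hess[OF \<phi>]])
  have dh: "integrable lborel (directional_hess \<phi> h)" for h
    unfolding directional_hess_def using inth by auto
  note te = taylor_error_integrable[OF \<phi>]
  have s: "second_diff \<phi> h x = taylor_error \<phi> h x + directional_hess \<phi> h x" for h x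
    by (simp add: taylor_error_def)
  show i: "integrable lborel (second_diff \<phi> h)" for h
    using Bochner_Integration.integrable_add[OF te[of h] dh[of h]] by (simp add: s[symmetric])
  obtain M where M: "\<And>h. (LINT x|lborel. \<bar>taylor_error \<phi> h x\<bar>) \<le> M" using taylor_error_L1(2)[OF \<phi>]
    by blast
  define L where "L = (LINT x|lborel. (\<Sum>k\<in>UNIV. \<Sum>l\<in>UNIV. \<bar>hess \<phi> k l x\<bar>))"
  have "(LINT x|lborel. \<bar>second_diff \<phi> h x\<bar>) \<le> M + L" for h
  proof -
    have "(LINT x|lborel. \<bar>second_diff \<phi> h x\<bar>)
        \<le> (LINT x|lborel. \<bar>taylor_error \<phi> h x\<bar> + (\<Sum>k\<in>UNIV. \<Sum>l\<in>UNIV. \<bar>hess \<phi> k l x\<bar>))"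
    proof (rule integral_mono)
      show "\<bar>second_diff \<phi> h x\<bar> \<le> \<bar>taylor_error \<phi> h x\<bar> + (\<Sum>k\<in>UNIV. \<Sum>l\<in>UNIV. \<bar>hess \<phi> k l x\<bar>)" for x
        using directional_hess_abs_le[of \<phi> h x] unfolding s by linarith
    qed (use i te inth in auto)
    also have "\<dots> = (LINT x|lborel. \<bar>taylor_error \<phi> h x\<bar>) + L"
      unfolding L_def using te inth by (intro Bochner_Integration.integral_add) auto
    finally show ?thesis using M[of h] by linarith
  qed
  then show "\<exists>M. \<forall>h. (LINT x|lborel. \<bar>second_diff \<phi> h x\<bar>) \<le> M" by blast
qed

lemma second_diff_product_integrable:
  fixes \<phi> :: "real^'n::finite \<Rightarrow> real"
  assumes iso: "isotropic_kernel \<rho>" and \<phi>: "test_function \<phi>"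
  shows "integrable (lborel \<Otimes>\<^sub>M lborel) (\<lambda>(h, x). second_diff \<phi> h x * kern i j h * \<rho> h)"
proof -
  obtain M where M: "\<And>h. (LINT x|lborel. \<bar>second_diff \<phi> h x\<bar>) \<le> M" using second_diff_L1(2)[OF \<phi>]
    by blast
  show ?thesis
    by (rule kernel_product_integrable[OF iso _ second_diff_integrable[OF \<phi>] M])
       (rule second_diff_measurable[OF test_function_borel_measurable[OF \<phi>]])
qed

lemma nlh_integrable:
  assumes "isotropic_kernel \<rho>" and "test_function \<phi>"
  shows "integrable lborel (nlh \<rho> \<phi> i j)"
  unfolding nlh_def[abs_def] by (rule lborel_pair.integrable_snd[OF
      second_diff_product_integrable[OF assms]])

lemma
  fixes \<rho> :: "real^'n::finite \<Rightarrow> real"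
  assumes iso: "isotropic_kernel \<rho>" and \<phi>: "test_function \<phi>"
  shows nlh_integrand_integrable: "integrable lborel (\<lambda>h. second_diff \<phi> h x * kern i j h * \<rho> h)"
    and nlh_minus_hess: "nlh \<rho> \<phi> i j x - hess \<phi> i j x
        = (LINT h|lborel. taylor_error \<phi> h x * kern i j h * \<rho> h)"
proof -
  note [measurable] = isotropic_kernelD(1)[OF iso] test_function_borel_measurable[OF \<phi>]
  obtain M where M: "M > 0" "\<And>h x. \<bar>second_diff \<phi> h x\<bar> \<le> M" "\<And>h x. \<bar>directional_hess \<phi> h x\<bar> \<le> M"
    using second_diff_bounded[OF \<phi>] by blast
  let ?K = "real CARD('n) * (real CARD('n) + 2)"
  have b: "integrable lborel (\<lambda>h. f h * kern i j h * \<rho> h)"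
    if [measurable]: "f \<in> borel_measurable borel" and f: "\<And>h. \<bar>f h\<bar> \<le> M" for f
  proof (rule Bochner_Integration.integrable_bound[OF integrable_mult_right[OF
      isotropic_kernelD(3)[OF iso], of "M * ?K"]])
    show "AE h in lborel. norm (f h * kern i j h * \<rho> h) \<le> norm (M * ?K * \<rho> h)"
      using M f kern_bounded[of i j] isotropic_kernelD(2)[OF iso]
      by (intro AE_I2) (simp add: abs_mult, intro mult_right_mono mult_mono, auto)
  qed measurable
  show s: "integrable lborel (\<lambda>h. second_diff \<phi> h x * kern i j h * \<rho> h)"
    by (rule b) (use M in \<open>auto simp: second_diff_def\<close>)
  have d: "integrable lborel (\<lambda>h. directional_hess \<phi> h x * kern i j h * \<rho> h)"
    by (rule b) (use M in \<open>auto simp: directional_hess_def\<close>)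
  show "nlh \<rho> \<phi> i j x - hess \<phi> i j x = (LINT h|lborel. taylor_error \<phi> h x * kern i j h * \<rho> h)"
    unfolding nlh_def average_directional_hess[OF iso \<phi>, of x i j, symmetric]
    using s d by (simp add: taylor_error_def left_diff_distrib)
qed

lemma nlh_minus_hess_le:
  fixes \<rho> :: "real^'n::finite \<Rightarrow> real"
  assumes iso: "isotropic_kernel \<rho>" and \<phi>: "test_function \<phi>"
  shows "\<bar>nlh \<rho> \<phi> i j x - hess \<phi> i j x\<bar>
    \<le> real CARD('n) * (real CARD('n) + 2) * (LINT h|lborel. \<bar>taylor_error \<phi> h x\<bar> * \<rho> h)"
proof -
  note [measurable] = isotropic_kernelD(1)[OF iso] test_function_borel_measurable[OF \<phi>]
  let ?K = "real CARD('n) * (real CARD('n) + 2)"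
  obtain M where M: "M > 0" "\<And>h x. \<bar>taylor_error \<phi> h x\<bar> \<le> 2 * M" using second_diff_bounded[OF \<phi>]
    by blast
  have [measurable]: "(\<lambda>h. taylor_error \<phi> h x) \<in> borel_measurable borel"
    unfolding taylor_error_def second_diff_def directional_hess_def by measurable
  have i1: "integrable lborel (\<lambda>h. \<bar>taylor_error \<phi> h x\<bar> * \<rho> h)"
    by (rule Bochner_Integration.integrable_bound[OF integrable_mult_right[OF
        isotropic_kernelD(3)[OF iso], of "2 * M"]])
       (use M isotropic_kernelD(2)[OF iso] in \<open>auto intro!: AE_I2 mult_right_mono simp: abs_mult\<close>)
  have le: "\<bar>taylor_error \<phi> h x * kern i j h * \<rho> h\<bar> \<le> ?K * (\<bar>taylor_error \<phi> h x\<bar> * \<rho> h)" for h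
  proof -
    have "\<bar>taylor_error \<phi> h x * kern i j h * \<rho> h\<bar> = \<bar>kern i j h\<bar> * (\<bar>taylor_error \<phi> h x\<bar> * \<rho> h)"
      using isotropic_kernelD(2)[OF iso, of h] by (simp add: abs_mult)
    also have "\<dots> \<le> ?K * (\<bar>taylor_error \<phi> h x\<bar> * \<rho> h)"
      using isotropic_kernelD(2)[OF iso, of h] by (intro mult_right_mono kern_bounded) auto
    finally show ?thesis .
  qed
  have "\<bar>nlh \<rho> \<phi> i j x - hess \<phi> i j x\<bar> \<le> (LINT h|lborel. \<bar>taylor_error \<phi> h x * kern i j h * \<rho> h\<bar>)"
    unfolding nlh_minus_hess[OF iso \<phi>] by (rule integral_abs_bound)
  also have "\<dots> \<le> (LINT h|lborel. ?K * (\<bar>taylor_error \<phi> h x\<bar> * \<rho> h))"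
  proof (rule integral_mono)
    show "integrable lborel (\<lambda>h. \<bar>taylor_error \<phi> h x * kern i j h * \<rho> h\<bar>)"
      by (rule Bochner_Integration.integrable_bound[OF integrable_mult_right[OF i1, of ?K]])
         (use order_trans[OF le abs_ge_self] in auto)
  qed (use i1 le in auto)
  also have "\<dots> = ?K * (LINT h|lborel. \<bar>taylor_error \<phi> h x\<bar> * \<rho> h)" by simp
  finally show ?thesis .
qed

lemma eventually_small_average:
  fixes \<rho> :: "nat \<Rightarrow> 'a::euclidean_space \<Rightarrow> real"
  assumes tail: "\<And>\<gamma>. \<gamma> > 0 \<Longrightarrow> (\<lambda>n. tail (\<rho> n) \<gamma>) \<longlonglongrightarrow> 0" and e: "e > 0" and d: "d > 0"
  shows "\<forall>\<^sub>F n in sequentially. M * tail (\<rho> n) (d / 2) \<le> e"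
proof -
  have "(\<lambda>n. M * tail (\<rho> n) (d / 2)) \<longlonglongrightarrow> M * 0" using tail[of "d/2"] d by (intro tendsto_intros) auto
  then have "\<forall>\<^sub>F n in sequentially. M * tail (\<rho> n) (d / 2) < e" using e by (intro order_tendstoD) auto
  then show ?thesis by eventually_elim simp
qed

lemma nlh_tendsto_hess_uniformly:
  fixes \<rho> :: "nat \<Rightarrow> real^'n::finite \<Rightarrow> real"
  assumes iso: "\<And>n. isotropic_kernel (\<rho> n)" and tail: "\<And>\<gamma>. \<gamma> > 0 \<Longrightarrow> (\<lambda>n. tail (\<rho> n) \<gamma>) \<longlonglongrightarrow> 0"
    and \<phi>: "test_function \<phi>" and e: "e > 0"
  shows "\<forall>\<^sub>F n in sequentially. \<forall>x. \<bar>nlh (\<rho> n) \<phi> i j x - hess \<phi> i j x\<bar> \<le> e"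
proof -
  note [measurable] = test_function_borel_measurable[OF \<phi>]
  have [measurable]: "hess \<phi> k l \<in> borel_measurable borel" for k l
    using test_function_hess[OF \<phi>] by (rule test_function_borel_measurable)
  define K where "K = real CARD('n) * (real CARD('n) + 2)"
  have K: "K > 0" unfolding K_def by (intro mult_pos_pos add_pos_pos) auto
  obtain M where M: "M > 0" "\<And>h x. \<bar>taylor_error \<phi> h x\<bar> \<le> 2 * M" using second_diff_bounded[OF \<phi>]
    by blast
  define e' where "e' = e / (2 * K)"
  have e': "e' > 0" "K * (e' + e') = e" using K e by (auto simp: e'_def)
  obtain d where d: "d > 0" "\<And>h x. norm h < d \<Longrightarrow> \<bar>taylor_error \<phi> h x\<bar> \<le> e'"
    using taylor_error_small[OF \<phi> e'(1)] by blast
  have "\<forall>\<^sub>F n in sequentially. 2 * M * tail (\<rho> n) (d / 2) \<le> e'"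
    by (rule eventually_small_average[OF tail e'(1) d(1)])
  then show ?thesis
  proof eventually_elim
    case (elim n)
    show ?case
    proof
      fix x
      have "(LINT h|lborel. \<bar>taylor_error \<phi> h x\<bar> * \<rho> n h) \<le> e' + 2 * M * tail (\<rho> n) (d / 2)"
      proof (rule kernel_average_le[OF iso])
        show "(\<lambda>h. \<bar>taylor_error \<phi> h x\<bar>) \<in> borel_measurable borel"
          unfolding taylor_error_def second_diff_def directional_hess_def by measurable
      qed (use M d e' in auto)
      then have "K * (LINT h|lborel. \<bar>taylor_error \<phi> h x\<bar> * \<rho> n h) \<le> K * (e' + e')"
        using elim K by (intro mult_left_mono) auto
      then show "\<bar>nlh (\<rho> n) \<phi> i j x - hess \<phi> i j x\<bar> \<le> e"
        using nlh_minus_hess_le[OF iso \<phi>, of n i j x] e'(2) unfolding K_def by linarith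
    qed
  qed
qed

lemma nlh_tendsto_hess_L1:
  fixes \<rho> :: "nat \<Rightarrow> real^'n::finite \<Rightarrow> real"
  assumes iso: "\<And>n. isotropic_kernel (\<rho> n)" and tail: "\<And>\<gamma>. \<gamma> > 0 \<Longrightarrow> (\<lambda>n. tail (\<rho> n) \<gamma>) \<longlonglongrightarrow> 0"
    and \<phi>: "test_function \<phi>" and e: "e > 0"
  shows "\<forall>\<^sub>F n in sequentially. (LINT x|lborel. \<bar>nlh (\<rho> n) \<phi> i j x - hess \<phi> i j x\<bar>) \<le> e"
proof -
  note [measurable] = test_function_borel_measurable[OF \<phi>]
  define K where "K = real CARD('n) * (real CARD('n) + 2)"
  have K: "K > 0" unfolding K_def by (intro mult_pos_pos add_pos_pos) auto
  define F where "F h = (LINT x|lborel. \<bar>taylor_error \<phi> h x\<bar>)" for h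
  obtain M where M: "M > 0" "\<And>h. F h \<le> M" unfolding F_def using taylor_error_L1(2)[OF \<phi>] by blast
  have F: "F \<in> borel_measurable borel"
  proof -
    have "(\<lambda>h. LINT x|lborel. \<bar>taylor_error \<phi> h x\<bar>) \<in> borel_measurable lborel"
      using taylor_error_measurable[OF \<phi>] by measurable
    then show ?thesis by (simp add: F_def[abs_def])
  qed
  define e' where "e' = e / (2 * K)"
  have e': "e' > 0" "K * (e' + e') = e" using K e by (auto simp: e'_def)
  obtain d where d: "d > 0" "\<And>h. norm h < d \<Longrightarrow> F h \<le> e'"
    unfolding F_def using taylor_error_L1(3)[OF \<phi> e'(1)] by blast
  have "\<forall>\<^sub>F n in sequentially. M * tail (\<rho> n) (d / 2) \<le> e'"
    by (rule eventually_small_average[OF tail e'(1) d(1)])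
  then show ?thesis
  proof eventually_elim
    case (elim n)
    note [measurable] = isotropic_kernelD(1)[OF iso[of n]] taylor_error_measurable[OF \<phi>]
    have M': "(LINT x|lborel. \<bar>\<bar>taylor_error \<phi> h x\<bar>\<bar>) \<le> M" for h using M(2)[of h] by (simp add: F_def)
    have I: "integrable (lborel \<Otimes>\<^sub>M lborel) (\<lambda>(h, x). \<bar>taylor_error \<phi> h x\<bar> * \<rho> n h)"
    proof (rule lborel_pair.Fubini_integrable)
      show "(\<lambda>(h, x). \<bar>taylor_error \<phi> h x\<bar> * \<rho> n h) \<in> borel_measurable (lborel \<Otimes>\<^sub>M lborel)"
        by measurable
      have eq: "(LINT x|lborel. norm (\<bar>taylor_error \<phi> h x\<bar> * \<rho> n h)) = F h * \<rho> n h" for h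
        using isotropic_kernelD(2)[OF iso[of n], of h] by (simp add: abs_mult F_def)
      show "integrable lborel (\<lambda>h. LINT x|lborel. norm (case (h, x) of (h, x) \<Rightarrow> \<bar>taylor_error \<phi> h x\<bar>
          * \<rho> n h))"
        unfolding prod.case eq
        by (rule Bochner_Integration.integrable_bound[OF integrable_mult_right[OF
            isotropic_kernelD(3)[OF iso[of n]], of M]])
           (use M F isotropic_kernelD(1,2)[OF iso[of n]] in \<open>auto intro!: AE_I2 mult_right_mono
               simp: abs_mult F_def\<close>)
      show "AE h in lborel. integrable lborel (\<lambda>x. case (h, x) of (h, x) \<Rightarrow> \<bar>taylor_error \<phi> h x\<bar> * \<rho>
          n h)"
        unfolding prod.case by (intro AE_I2 integrable_mult_left integrable_abs
            taylor_error_integrable[OF \<phi>])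
    qed
    have "(LINT x|lborel. \<bar>nlh (\<rho> n) \<phi> i j x - hess \<phi> i j x\<bar>)
       \<le> (LINT x|lborel. K * (LINT h|lborel. \<bar>taylor_error \<phi> h x\<bar> * \<rho> n h))"
    proof (rule integral_mono)
      show "integrable lborel (\<lambda>x. \<bar>nlh (\<rho> n) \<phi> i j x - hess \<phi> i j x\<bar>)"
        by (intro integrable_abs Bochner_Integration.integrable_diff nlh_integrable iso \<phi>
            test_function_integrable test_function_hess)
      show "integrable lborel (\<lambda>x. K * (LINT h|lborel. \<bar>taylor_error \<phi> h x\<bar> * \<rho> n h))"
        by (intro integrable_mult_right lborel_pair.integrable_snd[OF I])
      show "\<bar>nlh (\<rho> n) \<phi> i j x - hess \<phi> i j x\<bar> \<le> K * (LINT h|lborel. \<bar>taylor_error \<phi> h x\<bar> * \<rho> n h)"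
          for x
        unfolding K_def by (rule nlh_minus_hess_le[OF iso \<phi>])
    qed
    also have "\<dots> = K * (LINT h|lborel. LINT x|lborel. \<bar>taylor_error \<phi> h x\<bar> * \<rho> n h)"
      using lborel_pair.Fubini_integral[OF I] by simp
    also have "\<dots> = K * (LINT h|lborel. F h * \<rho> n h)" by (simp add: F_def)
    also have "\<dots> \<le> K * (e' + M * tail (\<rho> n) (d / 2))"
      using K by (intro mult_left_mono kernel_average_le[OF iso F]) (use M d e' in \<open>auto simp: F_def\<close>)
    also have "\<dots> \<le> K * (e' + e')" using elim K by (intro mult_left_mono) auto
    finally show ?case using e'(2) by simp
  qed
qed

section \<open>Pairings with matrix-valued test fields\<close>

lemma integrable_mult_bounded:
  fixes u :: "'a \<Rightarrow> real"
  assumes u: "integrable M u" and b: "b \<in> borel_measurable M" "\<And>x. \<bar>b x\<bar> \<le> B"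
  shows "integrable M (\<lambda>x. u x * b x)"
proof (rule Bochner_Integration.integrable_bound[OF integrable_mult_right[OF u, of B]])
  show "(\<lambda>x. u x * b x) \<in> borel_measurable M" using u b(1) by measurable
  show "AE x in M. norm (u x * b x) \<le> norm (B * u x)"
    using b(2) by (intro AE_I2) (simp add: abs_mult mult.commute mult_right_mono order_trans[OF b(2)
        abs_ge_self])
qed

lemma borel_imp_lebesgue_measurable:
  fixes f :: "'a::euclidean_space \<Rightarrow> 'b::topological_space"
  shows "f \<in> borel_measurable borel \<Longrightarrow> f \<in> borel_measurable lebesgue"
  by (auto intro: measurable_completion)

lemma lebesgue_integrable_mult_test:
  fixes u :: "real^'n::finite \<Rightarrow> real"
  assumes "integrable lebesgue u" "test_function \<phi>"
  shows "integrable lebesgue (\<lambda>x. u x * \<phi> x)"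
proof -
  obtain B where "\<And>x. \<bar>\<phi> x\<bar> \<le> B" using test_function_bounded[OF assms(2)] by blast
  then show ?thesis
    using assms by (intro integrable_mult_bounded borel_imp_lebesgue_measurable
        test_function_borel_measurable)
qed

lemma test_field_matrix_iff:
  fixes \<psi> :: "real^'n::finite \<Rightarrow> real^'a::finite^'b::finite"
  shows "test_field \<psi> \<longleftrightarrow> (\<forall>i j. test_function (\<lambda>x. \<psi> x $ i $ j)) \<and> (\<forall>x. norm (\<psi> x) \<le> 1)"
  by (auto simp: test_field_def Basis_vec_def inner_axis)

lemma inner_matrix: "A \<bullet> B = (\<Sum>i\<in>UNIV. \<Sum>j\<in>UNIV. A $ i $ j * B $ i $ j)"
    for A B :: "real^'a::finite^'b::finite"
  by (simp add: inner_vec_def)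

definition hess_pairing :: "(real^'n::finite \<Rightarrow> real) \<Rightarrow> (real^'n \<Rightarrow> real^'n^'n) \<Rightarrow> real" where
  "hess_pairing u \<psi> = (\<Sum>i\<in>UNIV. \<Sum>j\<in>UNIV. LINT x|lebesgue. u x * hess (\<lambda>y. \<psi> y $ i $ j) i j x)"

lemma integral_inner_matrix:
  fixes G :: "real^'n::finite \<Rightarrow> real^'a::finite^'b::finite"
  assumes G: "integrable lebesgue G" and \<psi>: "test_field \<psi>"
  shows "(\<Sum>i\<in>UNIV. \<Sum>j\<in>UNIV. LINT x|lebesgue. G x $ i $ j * \<psi> x $ i $ j) = (LINT x|lebesgue. G x \<bullet> \<psi> x)"
proof -
  have "integrable lebesgue (\<lambda>x. G x $ i $ j)" for i j
    using integrable_bounded_linear[OF bounded_linear_compose[OF bounded_linear_vec_nth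
        bounded_linear_vec_nth] G] by simp
  then have "integrable lebesgue (\<lambda>x. G x $ i $ j * \<psi> x $ i $ j)" for i j
    using \<psi> by (intro lebesgue_integrable_mult_test) (auto simp: test_field_matrix_iff)
  then show ?thesis by (simp add: inner_matrix)
qed

lemma integral_inner_test_field_le:
  fixes G :: "real^'n::finite \<Rightarrow> 'b::euclidean_space"
  assumes G: "integrable lebesgue G" and \<psi>: "test_field \<psi>"
  shows "(LINT x|lebesgue. G x \<bullet> \<psi> x) \<le> (LINT x|lebesgue. norm (G x))"
proof -
  have le: "\<bar>G x \<bullet> \<psi> x\<bar> \<le> norm (G x)" for x
    using order_trans[OF Cauchy_Schwarz_ineq2 mult_left_le[OF _ norm_ge_zero]] \<psi>
    by (auto simp: test_field_def)
  have "\<psi> \<in> borel_measurable lebesgue" by (intro borel_imp_lebesgue_measurable test_field_measurable \<psi>)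
  then have "integrable lebesgue (\<lambda>x. G x \<bullet> \<psi> x)"
    using G le by (intro Bochner_Integration.integrable_bound[OF integrable_norm[OF G]]) auto
  then show ?thesis
    using G le by (intro integral_mono) (auto intro: order_trans[OF abs_ge_self])
qed

lemma nonlocal_energy_eq:
  assumes "represents_nonlocal_hessian \<rho> u G"
  obtains G' where "represents_nonlocal_hessian \<rho> u G'" "nonlocal_energy \<rho> u
      = ereal (LINT x|lebesgue. norm (G' x))"
proof
  show "represents_nonlocal_hessian \<rho> u (SOME G. represents_nonlocal_hessian \<rho> u G)"
    using someI[of "represents_nonlocal_hessian \<rho> u", OF assms] .
  show "nonlocal_energy \<rho> u = ereal
      (LINT x|lebesgue. norm ((SOME G. represents_nonlocal_hessian \<rho> u G) x))"
    using assms by (auto simp: nonlocal_energy_def)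
qed

lemma pairing_le_nonlocal_energy:
  fixes \<psi> :: "real^'n::finite \<Rightarrow> real^'n^'n"
  assumes \<psi>: "test_field \<psi>"
  shows "ereal (\<Sum>i\<in>UNIV. \<Sum>j\<in>UNIV. dist_nonlocal_hessian \<rho> u i j (\<lambda>x. \<psi> x $ i $ j))
      \<le> nonlocal_energy \<rho> u"
proof (cases "\<exists>G. represents_nonlocal_hessian \<rho> u G")
  case True
  then obtain G where G: "represents_nonlocal_hessian \<rho> u G"
    and E: "nonlocal_energy \<rho> u = ereal (LINT x|lebesgue. norm (G x))"
    using nonlocal_energy_eq by metis
  have "(\<Sum>i\<in>UNIV. \<Sum>j\<in>UNIV. dist_nonlocal_hessian \<rho> u i j (\<lambda>x. \<psi> x $ i $ j))
     = (\<Sum>i\<in>UNIV. \<Sum>j\<in>UNIV. LINT x|lebesgue. G x $ i $ j * \<psi> x $ i $ j)"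
    using G \<psi> by (simp add: represents_nonlocal_hessian_def test_field_matrix_iff)
  also have "\<dots> = (LINT x|lebesgue. G x \<bullet> \<psi> x)"
    using G \<psi> by (intro integral_inner_matrix) (auto simp: represents_nonlocal_hessian_def)
  also have "\<dots> \<le> (LINT x|lebesgue. norm (G x))"
    using G \<psi> by (intro integral_inner_test_field_le) (auto simp: represents_nonlocal_hessian_def)
  finally show ?thesis unfolding E by simp
qed (simp add: nonlocal_energy_def)

text \<open>Any two representing functions have the same pairings with test fields, hence, by duality, the
  same norm.\<close>

lemma nonlocal_energy_le:
  fixes u :: "real^'n::finite \<Rightarrow> real"
  assumes G: "represents_nonlocal_hessian \<rho> u G"
  shows "nonlocal_energy \<rho> u \<le> ereal (LINT x|lebesgue. norm (G x))"
proof -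
  obtain G' where G': "represents_nonlocal_hessian \<rho> u G'"
    and E: "nonlocal_energy \<rho> u = ereal (LINT x|lebesgue. norm (G' x))"
    using nonlocal_energy_eq[OF G] by metis
  have i: "integrable lebesgue G" "integrable lebesgue G'"
    using G G' by (auto simp: represents_nonlocal_hessian_def)
  have "(LINT x|lebesgue. norm (G' x)) \<le> (LINT x|lebesgue. norm (G x))"
  proof (rule L1_norm_le_by_duality[OF i(2)])
    fix \<psi> :: "real^'n \<Rightarrow> real^'n^'n" assume \<psi>: "test_field \<psi>"
    have "(LINT x|lebesgue. H x $ k $ l * \<psi> x $ k $ l)
        = dist_nonlocal_hessian \<rho> u k l (\<lambda>x. \<psi> x $ k $ l)"
      if "represents_nonlocal_hessian \<rho> u H" for H k l
      using that \<psi> by (simp add: represents_nonlocal_hessian_def test_field_matrix_iff)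
    from this[OF G] this[OF G'] have "(LINT x|lebesgue. G' x \<bullet> \<psi> x) = (LINT x|lebesgue. G x \<bullet> \<psi> x)"
      unfolding integral_inner_matrix[OF i(1) \<psi>, symmetric] integral_inner_matrix[OF i(2) \<psi>,
          symmetric] by simp
    then show "(LINT x|lebesgue. G' x \<bullet> \<psi> x) \<le> (LINT x|lebesgue. norm (G x))"
      using integral_inner_test_field_le[OF i(1) \<psi>] by simp
  qed
  then show ?thesis by (simp add: E)
qed

section \<open>The lower bound\<close>

text \<open>The product of \<open>us n \<longlongrightarrow> u\<close> in \<open>L\<^sup>1\<close> and of non-local Hessians that converge uniformly.\<close>

lemma dist_nonlocal_hessian_tendsto:
  fixes \<rho> :: "nat \<Rightarrow> real^'n::finite \<Rightarrow> real"
  assumes iso: "\<And>n. isotropic_kernel (\<rho>' n)" and tail: "\<And>\<gamma>. \<gamma> > 0 \<Longrightarrow> (\<lambda>n. tail (\<rho>' n) \<gamma>) \<longlonglongrightarrow> 0"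
    and \<rho>: "\<And>n. \<rho> n \<in> borel_measurable lebesgue" "\<And>n. AE x in lebesgue. \<rho> n x = \<rho>' n x"
    and us: "\<And>n. us n \<in> L1" "u \<in> L1" "(\<lambda>n. L1_dist (us n) u) \<longlonglongrightarrow> 0" and \<phi>: "test_function \<phi>"
  shows "(\<lambda>n. dist_nonlocal_hessian (\<rho> n) (us n) i j \<phi>) \<longlonglongrightarrow> (LINT x|lebesgue. u x * hess \<phi> i j x)"
proof (rule metric_LIMSEQ_I)
  fix e :: real assume "e > 0"
  obtain B where B: "B > 0" "\<And>x. \<bar>hess \<phi> i j x\<bar> \<le> B"
    using test_function_bounded[OF test_function_hess[OF \<phi>]] by blast
  define U where "U = (LINT x|lebesgue. \<bar>u x\<bar>)"
  have U: "U \<ge> 0" by (simp add: U_def)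
  define e1 where "e1 = min 1 (e / (2 * (U + 1)))"
  have e1: "e1 > 0" "e1 \<le> 1" "e1 * U < e / 2"
  proof -
    show "e1 > 0" "e1 \<le> 1" using \<open>e > 0\<close> U by (auto simp: e1_def)
    have "e1 * U \<le> e / (2 * (U + 1)) * U" unfolding e1_def using U by (intro mult_right_mono) auto
    also have "\<dots> < e / 2" using \<open>e > 0\<close> U by (simp add: field_simps)
    finally show "e1 * U < e / 2" .
  qed
  have "\<forall>\<^sub>F n in sequentially. \<forall>x. \<bar>nlh (\<rho>' n) \<phi> i j x - hess \<phi> i j x\<bar> \<le> e1"
    by (rule nlh_tendsto_hess_uniformly[OF iso tail \<phi> e1(1)])
  moreover have "\<forall>\<^sub>F n in sequentially. L1_dist (us n) u < e / (2 * (B + 1))"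
    using us(3) \<open>e > 0\<close> B by (intro order_tendstoD) auto
  ultimately have "\<forall>\<^sub>F n in sequentially. dist (dist_nonlocal_hessian (\<rho> n) (us n) i j \<phi>)
      (LINT x|lebesgue. u x * hess \<phi> i j x) < e"
  proof eventually_elim
    case (elim n)
    let ?N = "nlh (\<rho>' n) \<phi> i j" and ?H = "hess \<phi> i j"
    have Nb: "\<bar>?N x\<bar> \<le> B + 1" for x using elim(1) B(2)[of x] e1(2) by (smt (verit))
    have Nm: "?N \<in> borel_measurable lebesgue"
      using nlh_integrable[OF iso \<phi>, of n i j] by (intro borel_imp_lebesgue_measurable) auto
    have Hm: "?H \<in> borel_measurable lebesgue"
      by (intro borel_imp_lebesgue_measurable test_function_borel_measurable test_function_hess \<phi>)
    have iu: "integrable lebesgue (us n)" "integrable lebesgue u" using us by (auto simp: L1_def)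
    have i1: "integrable lebesgue (\<lambda>x. us n x * ?N x)" "integrable lebesgue (\<lambda>x. u x * ?H x)"
      using integrable_mult_bounded[OF iu(1) Nm Nb] integrable_mult_bounded[OF iu(2) Hm B(2)] by auto
    have i2: "integrable lebesgue (\<lambda>x. \<bar>us n x - u x\<bar> * (B + 1) + \<bar>u x\<bar> * e1)" using iu by auto
    have "dist_nonlocal_hessian (\<rho> n) (us n) i j \<phi> = (LINT x|lebesgue. us n x * ?N x)"
      unfolding dist_nonlocal_hessian_def nonlocal_hessian_component[OF iso \<rho> \<phi>] ..
    then have "dist (dist_nonlocal_hessian (\<rho> n) (us n) i j \<phi>) (LINT x|lebesgue. u x * ?H x)
       = \<bar>LINT x|lebesgue. us n x * ?N x - u x * ?H x\<bar>"
      using i1 by (simp add: dist_real_def)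
    also have "\<dots> \<le> (LINT x|lebesgue. \<bar>us n x * ?N x - u x * ?H x\<bar>)" by (rule integral_abs_bound)
    also have "\<dots> \<le> (LINT x|lebesgue. \<bar>us n x - u x\<bar> * (B + 1) + \<bar>u x\<bar> * e1)"
    proof (rule integral_mono)
      fix x
      have "us n x * ?N x - u x * ?H x = (us n x - u x) * ?N x + u x * (?N x - ?H x)"
        by (simp add: algebra_simps)
      also have "\<bar>\<dots>\<bar> \<le> \<bar>us n x - u x\<bar> * \<bar>?N x\<bar> + \<bar>u x\<bar> * \<bar>?N x - ?H x\<bar>"
        by (rule order_trans[OF abs_triangle_ineq]) (simp add: abs_mult)
      also have "\<dots> \<le> \<bar>us n x - u x\<bar> * (B + 1) + \<bar>u x\<bar> * e1"
        using Nb elim(1) by (intro add_mono mult_left_mono) auto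
      finally show "\<bar>us n x * ?N x - u x * ?H x\<bar> \<le> \<bar>us n x - u x\<bar> * (B + 1) + \<bar>u x\<bar> * e1" .
    qed (use i1 i2 in auto)
    also have "\<dots> = L1_dist (us n) u * (B + 1) + e1 * U"
      using iu by (simp add: L1_dist_def U_def)
    also have "\<dots> < e / 2 + e / 2"
    proof -
      have "L1_dist (us n) u * (B + 1) \<le> e / (2 * (B + 1)) * (B + 1)" using elim(2) B
        by (intro mult_right_mono) auto
      moreover have "e / (2 * p) * p = e / 2" if "p > 0" for p using that by simp
      from this[of "B + 1"] have "e / (2 * (B + 1)) * (B + 1) = e / 2" using B(1) by linarith
      ultimately show ?thesis using e1(3) by linarith
    qed
    finally show ?case by simp
  qed
  then show "\<exists>n0. \<forall>n\<ge>n0. dist (dist_nonlocal_hessian (\<rho> n) (us n) i j \<phi>)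
      (LINT x|lebesgue. u x * hess \<phi> i j x) < e"
    by (simp add: eventually_sequentially)
qed

lemma hess_pairing_le_liminf:
  fixes \<rho> :: "nat \<Rightarrow> real^'n::finite \<Rightarrow> real"
  assumes iso: "\<And>n. isotropic_kernel (\<rho>' n)" and tail: "\<And>\<gamma>. \<gamma> > 0 \<Longrightarrow> (\<lambda>n. tail (\<rho>' n) \<gamma>) \<longlonglongrightarrow> 0"
    and \<rho>: "\<And>n. \<rho> n \<in> borel_measurable lebesgue" "\<And>n. AE x in lebesgue. \<rho> n x = \<rho>' n x"
    and us: "\<And>n. us n \<in> L1" "u \<in> L1" "(\<lambda>n. L1_dist (us n) u) \<longlonglongrightarrow> 0" and \<psi>: "test_field \<psi>"
  shows "ereal (hess_pairing u \<psi>) \<le> liminf (\<lambda>n. nonlocal_energy (\<rho> n) (us n))"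
proof -
  have "(\<lambda>n. \<Sum>i\<in>UNIV. \<Sum>j\<in>UNIV. dist_nonlocal_hessian (\<rho> n) (us n) i j (\<lambda>x. \<psi> x $ i $ j))
      \<longlonglongrightarrow> hess_pairing u \<psi>"
    unfolding hess_pairing_def
    by (intro tendsto_sum dist_nonlocal_hessian_tendsto[OF iso tail \<rho> us])
        (use \<psi> in \<open>auto simp: test_field_matrix_iff\<close>)
  then have "(\<lambda>n. ereal (\<Sum>i\<in>UNIV. \<Sum>j\<in>UNIV. dist_nonlocal_hessian (\<rho> n) (us n) i j
      (\<lambda>x. \<psi> x $ i $ j))) \<longlonglongrightarrow> ereal (hess_pairing u \<psi>)"
    by simp
  from lim_imp_Liminf[OF _ this] have "ereal (hess_pairing u \<psi>)
      = liminf (\<lambda>n. ereal (\<Sum>i\<in>UNIV. \<Sum>j\<in>UNIV. dist_nonlocal_hessian (\<rho> n) (us n) i j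
          (\<lambda>x. \<psi> x $ i $ j)))" by simp
  also have "\<dots> \<le> liminf (\<lambda>n. nonlocal_energy (\<rho> n) (us n))"
    by (intro Liminf_mono always_eventually allI pairing_le_nonlocal_energy \<psi>)
  finally show ?thesis .
qed

section \<open>From a bound on the pairings to a gradient of bounded variation\<close>

lemma hess_cmult: "test_function \<phi> \<Longrightarrow> hess (\<lambda>x. c * \<phi> x) i j = (\<lambda>x. c * hess \<phi> i j x)"
  by (simp add: hess_def pderivative_cmult test_function_pderivative)

text \<open>The telescoping series converges almost everywhere and in \<open>L\<^sup>1\<close>; it is stated through integrals
  against bounded functions because this is how the limit is identified.\<close>

lemma L1_limit_of_summable_increments:
  fixes f :: "nat \<Rightarrow> 'a \<Rightarrow> real"
  assumes f: "\<And>k. integrable M (f k)" and s: "summable (\<lambda>k. LINT x|M. \<bar>f (Suc k) x - f k x\<bar>)"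
  shows "\<exists>g. integrable M g \<and> (\<forall>b B. b \<in> borel_measurable M \<longrightarrow> (\<forall>x. \<bar>b x\<bar> \<le> B) \<longrightarrow>
           (\<lambda>k. LINT x|M. f k x * b x) \<longlonglongrightarrow> (LINT x|M. g x * b x))"
proof -
  define v where "v k x = f (Suc k) x - f k x" for k x
  have v: "integrable M (v k)" for k using f by (simp add: v_def[abs_def])
  have sv: "summable (\<lambda>k. LINT x|M. norm (v k x))" using s by (simp add: v_def)
  have [measurable]: "v k \<in> borel_measurable M" for k using v[of k] by auto
  have ae: "AE x in M. summable (\<lambda>k. norm (v k x))"
  proof -
    have "(\<integral>\<^sup>+x. (\<Sum>k. ennreal (norm (v k x))) \<partial>M) = (\<Sum>k. \<integral>\<^sup>+x. norm (v k x) \<partial>M)"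
      by (rule nn_integral_suminf) auto
    also have "\<dots> = (\<Sum>k. ennreal (LINT x|M. norm (v k x)))"
      using v by (simp add: nn_integral_eq_integral)
    also have "\<dots> \<noteq> \<infinity>" using sv by (simp add: ennreal_suminf_neq_top)
    finally have "AE x in M. (\<Sum>k. ennreal (norm (v k x))) \<noteq> \<infinity>" by (intro nn_integral_PInf_AE) auto
    then show ?thesis by eventually_elim (auto intro: summable_suminf_not_top)
  qed
  define S where "S x = (\<Sum>k. v k x)" for x
  have S: "integrable M S" unfolding S_def by (rule integrable_suminf[OF v ae sv])
  show ?thesis
  proof (intro exI[of _ "\<lambda>x. f 0 x + S x"] conjI allI impI)
    show "integrable M (\<lambda>x. f 0 x + S x)" using f S by simp
    fix b :: "'a \<Rightarrow> real" and B assume b [measurable]: "b \<in> borel_measurable M" and B: "\<forall>x. \<bar>b x\<bar> \<le> B"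
    have B0: "B \<ge> 0" using B by (meson abs_ge_zero order_trans)
    have vb: "integrable M (\<lambda>x. v k x * b x)" "integrable M (\<lambda>x. f k x * b x)" for k
      using integrable_mult_bounded[OF v b] integrable_mult_bounded[OF f b] B by blast+
    have Sb: "integrable M (\<lambda>x. S x * b x)" using integrable_mult_bounded[OF S b] B by blast
    have ae': "AE x in M. summable (\<lambda>k. norm (v k x * b x))"
      using ae
    proof eventually_elim
      case (elim x)
      from summable_mult2[OF elim, of "norm (b x)"] show ?case by (simp add: abs_mult)
    qed
    have sv': "summable (\<lambda>k. LINT x|M. norm (v k x * b x))"
    proof (rule summable_comparison_test'[OF summable_mult[OF sv, of B]])
      fix k
      have "(LINT x|M. norm (v k x * b x)) \<le> (LINT x|M. B * norm (v k x))"
      proof (rule integral_mono)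
        show "norm (v k x * b x) \<le> B * norm (v k x)" for x
          using B by (simp add: abs_mult mult.commute mult_right_mono)
      qed (intro integrable_norm integrable_mult_right vb v)+
      then show "norm (LINT x|M. norm (v k x * b x)) \<le> B * (LINT x|M. norm (v k x))" by simp
    qed
    have "(\<lambda>k. LINT x|M. v k x * b x) sums (LINT x|M. (\<Sum>k. v k x * b x))"
      by (rule sums_integral[OF vb(1) ae' sv'])
    also have "(LINT x|M. (\<Sum>k. v k x * b x)) = (LINT x|M. S x * b x)"
    proof (rule integral_cong_AE)
      show "AE x in M. (\<Sum>k. v k x * b x) = S x * b x"
        using ae by eventually_elim (simp add: S_def suminf_mult2 summable_norm_cancel)
    qed (use Sb in \<open>auto\<close>)
    finally have "(\<lambda>K. \<Sum>k<K. LINT x|M. v k x * b x) \<longlonglongrightarrow> (LINT x|M. S x * b x)" by (simp add: sums_def)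
    moreover have "(\<Sum>k<K. LINT x|M. v k x * b x)
        = (LINT x|M. f K x * b x) - (LINT x|M. f 0 x * b x)" for K
    proof -
      have "(LINT x|M. v k x * b x) = (LINT x|M. f (Suc k) x * b x) - (LINT x|M. f k x * b x)" for k
        using vb(2) by (simp add: v_def left_diff_distrib)
      then show ?thesis using sum_lessThan_telescope[of "\<lambda>k. LINT x|M. f k x * b x" K] by simp
    qed
    ultimately have "(\<lambda>K. (LINT x|M. f K x * b x) - (LINT x|M. f 0 x * b x)
        + (LINT x|M. f 0 x * b x)) \<longlonglongrightarrow> (LINT x|M. S x * b x) + (LINT x|M. f 0 x * b x)"
      by (intro tendsto_add tendsto_const) simp
    moreover have "(LINT x|M. (f 0 x + S x) * b x) = (LINT x|M. S x * b x) + (LINT x|M. f 0 x * b x)"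
      using vb(2) Sb by (simp add: distrib_right)
    ultimately show "(\<lambda>k. LINT x|M. f k x * b x) \<longlonglongrightarrow> (LINT x|M. (f 0 x + S x) * b x)" by simp
  qed
qed

text \<open>Taylor's formula with integral remainder: the function is the average
  \<open>\<integral>\<^sub>0\<^sup>d (1 - t/d) \<phi>(x - t e\<^sub>i) dt\<close> of translates of \<open>\<phi>\<close>, and integrating its second derivative by
  parts produces the quotient and the first derivative.\<close>

lemma difference_quotient_as_second_derivative:
  fixes \<phi> :: "real^'n::finite \<Rightarrow> real"
  assumes \<phi>: "test_function \<phi>" and B: "\<And>x. \<bar>\<phi> x\<bar> \<le> 1" and d: "d > 0"
  shows "\<exists>\<Phi>. test_function \<Phi> \<and> (\<forall>x. \<bar>\<Phi> x\<bar> \<le> d) \<and>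
    (\<forall>x. hess \<Phi> i i x = (\<phi> (x - d *\<^sub>R axis i 1) - \<phi> x) / d + pderivative i \<phi> x)"
proof -
  let ?e = "axis i 1 :: real^'n"
  \<comment> \<open>The remainder kernel of Taylor's formula.\<close>
  define w where "w t = indicator {0..d} t * (1 - t / d)" for t
  define \<Phi> where "\<Phi> x = (LINT t|lborel. \<phi> (x - t *\<^sub>R ?e) * w t)" for x
  have w: "integrable lborel w"
  proof -
    have "continuous_on {0..d} (\<lambda>t. 1 - t / d)" using d by (intro continuous_intros) auto
    from borel_integrable_compact[OF compact_Icc this] show ?thesis by (simp add: w_def[abs_def])
  qed
  have T: "(\<lambda>t. t *\<^sub>R ?e) \<in> borel_measurable lborel" by measurable
  have R: "norm (t *\<^sub>R ?e) \<le> d" if "w t \<noteq> 0" for t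
    using that d by (auto simp: w_def indicator_def norm_axis_1 split: if_splits)
  have t\<Phi>: "test_function \<Phi>"
    unfolding \<Phi>_def by (rule test_function_superposition[OF \<phi> T w R])
  have h\<Phi>: "hess \<Phi> i i x = (LINT t|lborel. hess \<phi> i i (x - t *\<^sub>R ?e) * w t)" for x
    unfolding hess_def \<Phi>_def
    by (simp add: pderivative_superposition[OF \<phi> T w R] pderivative_superposition[OF
        test_function_pderivative[OF \<phi>] T w R])
  have w1: "\<bar>w t\<bar> \<le> indicator {0..d} t" for t using d by (auto simp: w_def indicator_def)
  have "\<bar>\<Phi> x\<bar> \<le> d" for x
  proof -
    have "\<bar>\<Phi> x\<bar> \<le> (LINT t|lborel. \<bar>\<phi> (x - t *\<^sub>R ?e) * w t\<bar>)" unfolding \<Phi>_def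
      by (rule integral_abs_bound)
    also have "\<dots> \<le> (LINT t|lborel. indicator {0..d} t)"
    proof (rule integral_mono)
      show "integrable lborel (\<lambda>t. \<bar>\<phi> (x - t *\<^sub>R ?e) * w t\<bar>)"
        by (intro integrable_abs superposition_integrable[OF \<phi> T w R])
      show "\<bar>\<phi> (x - t *\<^sub>R ?e) * w t\<bar> \<le> indicator {0..d} t" for t
        unfolding abs_mult using mult_mono[OF B w1] by simp
      show "integrable lborel (indicat_real {0..d})"
        by (intro integrable_real_indicator) (auto simp: emeasure_lborel_Icc_eq)
    qed
    also have "\<dots> = d" using d by simp
    finally show ?thesis .
  qed
  moreover have "hess \<Phi> i i x = (\<phi> (x - d *\<^sub>R ?e) - \<phi> x) / d + pderivative i \<phi> x" for x
  proof -
    have ax: "(\<Sum>k\<in>UNIV. (- axis i 1 :: real^'n) $ k * f k) = - f i" for f :: "'n \<Rightarrow> real"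
      by (simp add: axis_def if_distrib[of "\<lambda>a. a * _"] if_distrib[of uminus] sum_negf cong: if_cong)
    have p: "((\<lambda>t. \<phi> (x - t *\<^sub>R ?e)) has_real_derivative - pderivative i \<phi> (x - t *\<^sub>R ?e)) (at t)" for t
      using test_function_line_derivative[OF \<phi>, of x "- ?e" t] unfolding ax by simp
    have q: "((\<lambda>t. pderivative i \<phi> (x - t *\<^sub>R ?e)) has_real_derivative
        - hess \<phi> i i (x - t *\<^sub>R ?e)) (at t)" for t
      using test_function_line_derivative[OF test_function_pderivative[OF \<phi>], of i x "- ?e" t]
      unfolding ax hess_def by simp
    \<comment> \<open>An antiderivative of the integrand, found by integrating by parts.\<close>
    define F where "F t = - pderivative i \<phi> (x - t *\<^sub>R ?e) * (1 - t / d) + \<phi> (x - t *\<^sub>R ?e) / d" for t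
    have F: "(F has_real_derivative hess \<phi> i i (x - t *\<^sub>R ?e) * (1 - t / d)) (at t)" for t
      unfolding F_def using d by (auto intro!: derivative_eq_intros p q)
    have "hess \<Phi> i i x = (LINT t|lborel. indicator {0..d} t *\<^sub>R (hess \<phi> i i (x - t *\<^sub>R ?e) * (1
        - t / d)))"
      unfolding h\<Phi> by (rule Bochner_Integration.integral_cong) (auto simp: w_def)
    also have "\<dots> = F d - F 0"
    proof (rule integral_FTC_atLeastAtMost)
      show "(F has_vector_derivative hess \<phi> i i (x - t *\<^sub>R ?e) * (1 - t / d)) (at t within {0..d})"
          for t
        using F has_field_derivative_at_within has_real_derivative_iff_has_vector_derivative by blast
      show "continuous_on {0..d} (\<lambda>t. hess \<phi> i i (x - t *\<^sub>R ?e) * (1 - t / d))"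
        by (intro continuous_intros continuous_on_compose2[OF test_function_continuous[OF
            test_function_hess[OF \<phi>], of UNIV]]) (use d in auto)
    qed (use d in auto)
    also have "\<dots> = (\<phi> (x - d *\<^sub>R ?e) - \<phi> x) / d + pderivative i \<phi> x"
      using d by (simp add: F_def diff_divide_distrib)
    finally show ?thesis .
  qed
  ultimately show ?thesis using t\<Phi> by blast
qed

text \<open>By the previous lemma the pairing of \<open>\<phi>\<close> with the quotient of step d differs from its limit by
  at most \<open>C d\<close>, uniformly in \<open>|\<phi>| \<le> 1\<close>. Duality turns this into a Cauchy estimate in \<open>L\<^sup>1\<close>, and
  the steps \<open>2\<^sup>-\<^sup>k\<close> make the increments summable.\<close>

lemma weak_partial_derivative_exists:
  fixes u :: "real^'n::finite \<Rightarrow> real"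
  assumes u: "integrable lborel u"
    and C: "\<And>\<phi>. test_function \<phi> \<Longrightarrow> (\<And>x. \<bar>\<phi> x\<bar> \<le> 1) \<Longrightarrow> \<bar>LINT x|lborel. u x * hess \<phi> i i x\<bar> \<le> C"
  shows "\<exists>g. integrable lborel g \<and>
    (\<forall>\<phi>. test_function \<phi> \<longrightarrow> (LINT x|lborel. u x * pderivative i \<phi> x) = - (LINT x|lborel. g x * \<phi> x))"
proof -
  let ?e = "axis i 1 :: real^'n"
  define q where "q d x = (u (x + d *\<^sub>R ?e) - u x) / d" for d x
  have q: "integrable lborel (q d)" for d
    using u integrable_shift_lborel[OF u, of "d *\<^sub>R ?e"] by (simp add: q_def[abs_def])
  have [measurable]: "u \<in> borel_measurable borel" using u by auto
  have int: "integrable lborel (\<lambda>x. f x * b x)" if "integrable lborel f" "test_function b"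
      for f b :: "real^'n \<Rightarrow> real"
    using test_function_bounded[OF that(2)] test_function_borel_measurable[OF that(2)]
    by (auto intro: integrable_mult_bounded[OF that(1)])
  have C0: "C \<ge> 0" using C[OF test_function_zero] by simp
  have est: "\<bar>(LINT x|lborel. q d x * \<phi> x) + (LINT x|lborel. u x * pderivative i \<phi> x)\<bar> \<le> C * d"
    if \<phi>: "test_function \<phi>" "\<And>x. \<bar>\<phi> x\<bar> \<le> 1" and d: "d > 0" for \<phi> d
  proof -
    have [measurable]: "\<phi> \<in> borel_measurable borel" by (rule test_function_borel_measurable[OF \<phi>(1)])
    obtain \<Phi> where \<Phi>: "test_function \<Phi>" "\<And>x. \<bar>\<Phi> x\<bar> \<le> d"
      "\<And>x. hess \<Phi> i i x = (\<phi> (x - d *\<^sub>R ?e) - \<phi> x) / d + pderivative i \<phi> x"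
      using difference_quotient_as_second_derivative[OF \<phi> d] by blast
    have i1: "integrable lborel (\<lambda>x. u x * \<phi> (x - d *\<^sub>R ?e))"
      using \<phi>(2) by (intro integrable_mult_bounded[OF u]) auto
    have sh: "(LINT x|lborel. u (x + d *\<^sub>R ?e) * \<phi> x) = (LINT x|lborel. u x * \<phi> (x - d *\<^sub>R ?e))"
      using integral_lborel_shift[of "\<lambda>x. u x * \<phi> (x - d *\<^sub>R ?e)" "d *\<^sub>R ?e"] by simp
    have "(LINT x|lborel. q d x * \<phi> x)
        = ((LINT x|lborel. u (x + d *\<^sub>R ?e) * \<phi> x) - (LINT x|lborel. u x * \<phi> x)) / d"
      using int[OF integrable_shift_lborel[OF u] \<phi>(1)] int[OF u \<phi>(1)]
      by (simp add: q_def left_diff_distrib diff_divide_distrib)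
    also have "\<dots> = (LINT x|lborel. (u x * \<phi> (x - d *\<^sub>R ?e) - u x * \<phi> x) / d)"
      unfolding sh using i1 int[OF u \<phi>(1)] by simp
    finally have "(LINT x|lborel. q d x * \<phi> x) + (LINT x|lborel. u x * pderivative i \<phi> x)
       = (LINT x|lborel. (u x * \<phi> (x - d *\<^sub>R ?e) - u x * \<phi> x) / d + u x * pderivative i \<phi> x)"
      using i1 int[OF u \<phi>(1)] int[OF u test_function_pderivative[OF \<phi>(1)]] by simp
    also have "\<dots> = (LINT x|lborel. u x * hess \<Phi> i i x)"
      by (rule Bochner_Integration.integral_cong) (auto simp: \<Phi>(3) algebra_simps diff_divide_distrib)
    also have "\<dots> = (LINT x|lborel. d * (u x * hess (\<lambda>x. 1 / d * \<Phi> x) i i x))"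
      unfolding hess_cmult[OF \<Phi>(1)] using d by (intro Bochner_Integration.integral_cong) auto
    also have "\<bar>\<dots>\<bar> \<le> d * C"
    proof -
      have "\<bar>1 / d * \<Phi> x\<bar> \<le> 1" for x using \<Phi>(2)[of x] d by (simp add: abs_mult divide_le_eq)
      from C[OF test_function_cmult[OF \<Phi>(1)] this] show ?thesis using d by (simp add: abs_mult)
    qed
    finally show ?thesis by (simp add: mult.commute)
  qed
  have cauchy: "(LINT x|lborel. \<bar>q d x - q d' x\<bar>) \<le> C * (d + d')" if d: "d > 0" "d' > 0" for d d'
  proof -
    have "(LINT x|lborel. norm (q d x - q d' x)) \<le> C * (d + d')"
    proof (rule L1_norm_le_by_duality_lborel)
      show "integrable lborel (\<lambda>x. q d x - q d' x)" using q by simp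
      fix \<psi> :: "real^'n \<Rightarrow> real" assume "test_field \<psi>"
      then have \<psi>: "test_function \<psi>" "\<And>x. \<bar>\<psi> x\<bar> \<le> 1" by (auto simp: test_field_def)
      have "(LINT x|lborel. (q d x - q d' x) \<bullet> \<psi> x)
          = (LINT x|lborel. q d x * \<psi> x) - (LINT x|lborel. q d' x * \<psi> x)"
        using int[OF q \<psi>(1)] by (simp add: left_diff_distrib)
      then show "(LINT x|lborel. (q d x - q d' x) \<bullet> \<psi> x) \<le> C * (d + d')"
        using est[OF \<psi> d(1)] est[OF \<psi> d(2)] by (simp add: distrib_left)
    qed
    then show ?thesis by simp
  qed
  define f where "f k = q ((1/2) ^ k)" for k
  have "summable (\<lambda>k. LINT x|lborel. \<bar>f (Suc k) x - f k x\<bar>)"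
  proof (rule summable_comparison_test')
    show "summable (\<lambda>k. (2 * C) * (1/2 :: real) ^ k)" by (intro summable_mult summable_geometric) simp
    fix k :: nat
    have "(LINT x|lborel. \<bar>f (Suc k) x - f k x\<bar>) \<le> C * ((1/2) ^ Suc k + (1/2) ^ k)"
      unfolding f_def by (rule cauchy) auto
    also have "\<dots> \<le> C * (2 * (1/2) ^ k)" using C0 by (intro mult_left_mono) auto
    finally show "norm (LINT x|lborel. \<bar>f (Suc k) x - f k x\<bar>) \<le> (2 * C) * (1/2) ^ k" by simp
  qed
  then obtain g where g: "integrable lborel g"
    "\<And>b B. b \<in> borel_measurable lborel \<Longrightarrow> (\<And>x. \<bar>b x\<bar> \<le> B) \<Longrightarrow>
       (\<lambda>k. LINT x|lborel. f k x * b x) \<longlonglongrightarrow> (LINT x|lborel. g x * b x)"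
    using L1_limit_of_summable_increments[of lborel f] q unfolding f_def by blast
  have main: "(LINT x|lborel. u x * pderivative i \<phi> x) = - (LINT x|lborel. g x * \<phi> x)"
    if \<phi>: "test_function \<phi>" "\<And>x. \<bar>\<phi> x\<bar> \<le> 1" for \<phi>
  proof -
    have "\<phi> \<in> borel_measurable lborel" using test_function_borel_measurable[OF \<phi>(1)] by simp
    note 1 = g(2)[OF this \<phi>(2)]
    have "(\<lambda>k. (LINT x|lborel. f k x * \<phi> x) + (LINT x|lborel. u x * pderivative i \<phi> x)) \<longlonglongrightarrow> 0"
    proof (rule Lim_null_comparison)
      show "\<forall>\<^sub>F k in sequentially. norm ((LINT x|lborel. f k x * \<phi> x)
          + (LINT x|lborel. u x * pderivative i \<phi> x)) \<le> C * (1/2) ^ k"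
        unfolding f_def using est[OF \<phi>] by simp
      show "(\<lambda>k. C * (1/2) ^ k) \<longlonglongrightarrow> 0" by (intro tendsto_mult_right_zero LIMSEQ_power_zero) simp
    qed
    moreover have "(\<lambda>k. (LINT x|lborel. f k x * \<phi> x) + (LINT x|lborel. u x * pderivative i \<phi> x))
        \<longlonglongrightarrow> (LINT x|lborel. g x * \<phi> x) + (LINT x|lborel. u x * pderivative i \<phi> x)"
      by (intro tendsto_add 1 tendsto_const)
    ultimately show ?thesis using LIMSEQ_unique by fastforce
  qed
  have "(LINT x|lborel. u x * pderivative i \<phi> x) = - (LINT x|lborel. g x * \<phi> x)"
      if \<phi>: "test_function \<phi>" for \<phi>
  proof -
    obtain B where B: "B > 0" "\<And>x. \<bar>\<phi> x\<bar> \<le> B" using test_function_bounded[OF \<phi>] by blast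
    have "\<bar>1 / B * \<phi> x\<bar> \<le> 1" for x using B by (simp add: abs_mult divide_le_eq)
    from main[OF test_function_cmult[OF \<phi>] this]
    have "(LINT x|lborel. u x * (1 / B * pderivative i \<phi> x)) = - (LINT x|lborel. g x * (1 / B * \<phi> x))"
      unfolding pderivative_cmult[OF \<phi>] .
    moreover have "(LINT x|lborel. f x * (1 / B * h x)) = 1 / B * (LINT x|lborel. f x * h x)"
        for f h :: "real^'n \<Rightarrow> real"
      by (subst Bochner_Integration.integral_mult_right_zero[symmetric]) (simp add: mult_ac)
    ultimately show ?thesis using B(1) by (simp add: field_simps)
  qed
  with g(1) show ?thesis by blast
qed

lemma integral_lebesgue_mult_borel:
  fixes u :: "'a::euclidean_space \<Rightarrow> real"
  assumes u: "u \<in> borel_measurable lebesgue"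
      and u': "u' \<in> borel_measurable borel" "AE x in lebesgue. u x = u' x"
    and f: "f \<in> borel_measurable borel"
  shows "(LINT x|lebesgue. u x * f x) = (LINT x|lborel. u' x * f x)"
proof -
  have "(LINT x|lebesgue. u x * f x) = (LINT x|lebesgue. u' x * f x)"
    using u borel_imp_lebesgue_measurable[OF u'(1)] borel_imp_lebesgue_measurable[OF f]
    by (intro integral_cong_AE borel_measurable_times) (use u'(2) in auto)
  also have "\<dots> = (LINT x|lborel. u' x * f x)" using u' f by (subst integral_completion) auto
  finally show ?thesis .
qed

text \<open>Test the hypothesis with the field whose only entry is \<open>\<plusminus>\<phi>\<close> in position (i, i).\<close>

lemma pure_second_derivative_bound:
  fixes u :: "real^'n::finite \<Rightarrow> real"
  assumes C: "\<And>\<psi>. test_field \<psi> \<Longrightarrow> hess_pairing u \<psi> \<le> C"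
    and \<phi>: "test_function \<phi>" "\<And>x. \<bar>\<phi> x\<bar> \<le> 1"
  shows "\<bar>LINT x|lebesgue. u x * hess \<phi> i i x\<bar> \<le> C"
proof -
  have le: "(LINT x|lebesgue. u x * hess \<eta> i i x) \<le> C" if \<eta>: "test_function \<eta>" "\<And>x. \<bar>\<eta> x\<bar> \<le> 1"
      for \<eta> :: "real^'n \<Rightarrow> real"
  proof -
    define \<psi> :: "real^'n \<Rightarrow> real^'n^'n" where "\<psi> x = \<eta> x *\<^sub>R axis i (axis i 1)" for x
    have entry: "(\<lambda>x. \<psi> x $ k $ l) = (if k = i \<and> l = i then \<eta> else (\<lambda>_. 0))" for k l
      by (auto simp: \<psi>_def axis_def)
    have "norm (axis i (axis i (1::real)) :: real^'n^'n) = 1"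
      by (simp add: norm_eq_sqrt_inner inner_axis_axis)
    then have "test_field \<psi>"
      unfolding test_field_matrix_iff entry using \<eta> test_function_zero by (auto simp: \<psi>_def)
    moreover have "hess_pairing u \<psi> = (LINT x|lebesgue. u x * hess \<eta> i i x)"
    proof -
      have h0: "hess (\<lambda>_. 0) k l = (\<lambda>_. 0)" for k l :: 'n by (simp add: hess_def pderivative_const)
      have sum_if: "(\<Sum>l\<in>UNIV. if P then g l else 0) = (if P then (\<Sum>l\<in>UNIV. g l) else 0)" for P
          and g :: "'n \<Rightarrow> real"
        by simp
      have "(LINT x|lebesgue. u x * hess (if k = i \<and> l = i then \<eta> else (\<lambda>_. 0)) k l x)
         = (if k = i then if l = i then LINT x|lebesgue. u x * hess \<eta> i i x else 0 else 0)" for k l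
        by (auto simp: h0)
      then show ?thesis unfolding hess_pairing_def entry by (simp add: sum_if)
    qed
    ultimately show ?thesis using C by metis
  qed
  have "\<bar>- 1 * \<phi> x\<bar> \<le> 1" for x using \<phi>(2)[of x] by simp
  from le[OF test_function_cmult[OF \<phi>(1)] this] have "- (LINT x|lebesgue. u x * hess \<phi> i i x) \<le> C"
    unfolding hess_cmult[OF \<phi>(1)] by simp
  with le[OF \<phi>] show ?thesis by (simp add: abs_le_iff)
qed

text \<open>The sign comes from moving one derivative from the test field to u; it is harmless because test
  fields are symmetric under negation.\<close>

lemma divergence_pairing_eq_hess_pairing:
  fixes u :: "real^'n::finite \<Rightarrow> real"
  assumes g: "integrable lebesgue g" "is_weak_gradient u g"
      and \<psi>: "\<And>i j. test_function (\<lambda>x. \<psi> x $ i $ j)"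
  shows "(LINT x|lebesgue. (\<Sum>i\<in>UNIV. g x $ i * (\<Sum>j\<in>UNIV. pderivative j (\<lambda>y. \<psi> y $ i $ j) x)))
    = hess_pairing u (\<lambda>x. - \<psi> x)"
proof -
  have gi: "integrable lebesgue (\<lambda>x. g x $ i)" for i
    using integrable_bounded_linear[OF bounded_linear_vec_nth g(1)] .
  have I: "integrable lebesgue (\<lambda>x. g x $ i * pderivative j (\<lambda>y. \<psi> y $ i $ j) x)" for i j
    by (intro lebesgue_integrable_mult_test gi test_function_pderivative \<psi>)
  have "(LINT x|lebesgue. (\<Sum>i\<in>UNIV. g x $ i * (\<Sum>j\<in>UNIV. pderivative j (\<lambda>y. \<psi> y $ i $ j) x)))
    = (\<Sum>i\<in>UNIV. \<Sum>j\<in>UNIV. LINT x|lebesgue. g x $ i * pderivative j (\<lambda>y. \<psi> y $ i $ j) x)"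
    using I by (simp add: sum_distrib_left)
  also have "\<dots> = (\<Sum>i\<in>UNIV. \<Sum>j\<in>UNIV. LINT x|lebesgue. u x * hess (\<lambda>y. (- \<psi> y) $ i $ j) i j x)"
  proof (intro sum.cong refl)
    fix i j :: 'n
    have "(LINT x|lebesgue. u x * pderivative i (pderivative j (\<lambda>y. \<psi> y $ i $ j)) x)
      = - (LINT x|lebesgue. g x $ i * pderivative j (\<lambda>y. \<psi> y $ i $ j) x)"
      using g(2) test_function_pderivative[OF \<psi>[of i j], of j] unfolding is_weak_gradient_def by blast
    moreover have "hess (\<lambda>y. (- \<psi> y) $ i $ j) i j x
        = - pderivative i (pderivative j (\<lambda>y. \<psi> y $ i $ j)) x" for x
      using hess_cmult[OF \<psi>[of i j], of "-1" i j] by (simp add: hess_def fun_eq_iff)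
    ultimately show "(LINT x|lebesgue. g x $ i * pderivative j (\<lambda>y. \<psi> y $ i $ j) x)
      = (LINT x|lebesgue. u x * hess (\<lambda>y. (- \<psi> y) $ i $ j) i j x)" by simp
  qed
  finally show ?thesis by (simp add: hess_pairing_def)
qed

lemma test_field_uminus: "test_field (\<psi> :: real^'n::finite \<Rightarrow> real^'a::finite^'b::finite)
    \<Longrightarrow> test_field (\<lambda>x. - \<psi> x)"
  unfolding test_field_matrix_iff using test_function_cmult[where c="-1"] by auto

lemma weak_gradient_spec:
  assumes "u \<in> W11"
  shows "integrable lebesgue (weak_gradient u)" "is_weak_gradient u (weak_gradient u)"
  using someI_ex[of "\<lambda>g. integrable lebesgue g \<and> is_weak_gradient u g"] assms
  by (auto simp: W11_def weak_gradient_def)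

lemma total_variation_weak_gradient:
  assumes "u \<in> W11"
  shows "total_variation (weak_gradient u)
      = (SUP \<psi>\<in>Collect test_field. ereal (hess_pairing u (\<lambda>x. - \<psi> x)))"
  unfolding total_variation_def test_field_matrix_iff
  using divergence_pairing_eq_hess_pairing[OF weak_gradient_spec[OF assms]] by (intro SUP_cong) auto

lemma hess_pairing_le_D2_variation:
  fixes u :: "real^'n::finite \<Rightarrow> real"
  assumes u: "u \<in> BV2" and \<psi>: "test_field \<psi>"
  shows "ereal (hess_pairing u \<psi>) \<le> D2_variation u"
proof -
  have "u \<in> W11" using u by (simp add: BV2_def)
  then have "D2_variation u = (SUP \<psi>\<in>Collect test_field. ereal (hess_pairing u (\<lambda>x. - \<psi> x)))"
    using u by (simp add: D2_variation_def total_variation_weak_gradient)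
  then show ?thesis
    using SUP_upper[of "\<lambda>x. - \<psi> x" "Collect test_field"
        "\<lambda>\<psi>. ereal (hess_pairing u (\<lambda>x. - \<psi> x))"] test_field_uminus[OF \<psi>]
    by simp
qed

lemma D2_variation_le:
  fixes u :: "real^'n::finite \<Rightarrow> real"
  assumes u: "u \<in> L1" and C: "\<And>\<psi>. test_field \<psi> \<Longrightarrow> hess_pairing u \<psi> \<le> C"
  shows "D2_variation u \<le> ereal C"
proof -
  have iu: "integrable lebesgue u" using u by (simp add: L1_def)
  obtain u' where u': "integrable lborel u'" "AE x in lebesgue. u x = u' x"
    using integrable_lebesgue_ex_borel[OF iu] by blast
  have eq: "(LINT x|lebesgue. u x * f x) = (LINT x|lborel. u' x * f x)" if "test_function f" for f
  proof -
    have "u \<in> borel_measurable lebesgue" "u' \<in> borel_measurable borel" using iu u'(1) by auto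
    then show ?thesis by (rule integral_lebesgue_mult_borel[OF _ _ u'(2)
        test_function_borel_measurable[OF that]])
  qed
  have "\<exists>g. integrable lborel g \<and> (\<forall>\<phi>. test_function \<phi> \<longrightarrow> (LINT x|lborel. u' x * pderivative i \<phi> x)
      = - (LINT x|lborel. g x * \<phi> x))" for i
  proof (rule weak_partial_derivative_exists[OF u'(1)])
    fix \<phi> :: "real^'n \<Rightarrow> real" assume \<phi>: "test_function \<phi>" "\<And>x. \<bar>\<phi> x\<bar> \<le> 1"
    from pure_second_derivative_bound[OF C \<phi>] show "\<bar>LINT x|lborel. u' x * hess \<phi> i i x\<bar> \<le> C"
      by (simp add: eq[OF test_function_hess[OF \<phi>(1)]])
  qed
  then obtain g where g: "\<And>i. integrable lborel (g i)"
    "\<And>i \<phi>. test_function \<phi> \<Longrightarrow> (LINT x|lborel. u' x * pderivative i \<phi> x)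
        = - (LINT x|lborel. g i x * \<phi> x)" by metis
  define G where "G x = (\<chi> i. g i x)" for x
  have gl: "integrable lebesgue (g i)" for i using g(1)[of i] by (subst integrable_completion) auto
  have "integrable lebesgue G"
  proof -
    have "G = (\<lambda>x. \<Sum>i\<in>UNIV. g i x *\<^sub>R axis i 1)"
      by (intro ext) (simp add: G_def vec_eq_iff axis_def if_distrib[of "\<lambda>a. _ * a"] cong: if_cong)
    then show ?thesis using gl by (auto intro!: Bochner_Integration.integrable_sum
        integrable_scaleR_left)
  qed
  moreover have "is_weak_gradient u G"
    unfolding is_weak_gradient_def
  proof (intro allI impI)
    fix i and \<phi> :: "real^'n \<Rightarrow> real" assume \<phi>: "test_function \<phi>"
    have "(LINT x|lborel. g i x * \<phi> x) = (LINT x|lebesgue. g i x * \<phi> x)"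
      using g(1)[of i] test_function_borel_measurable[OF \<phi>] by (subst integral_completion) auto
    then show "(LINT x|lebesgue. u x * pderivative i \<phi> x) = - (LINT x|lebesgue. G x $ i * \<phi> x)"
      using g(2)[OF \<phi>, of i] eq[OF test_function_pderivative[OF \<phi>]] by (simp add: G_def)
  qed
  ultimately have W: "u \<in> W11" using iu by (auto simp: W11_def)
  have "total_variation (weak_gradient u) \<le> ereal C"
    unfolding total_variation_weak_gradient[OF W] using C test_field_uminus by (intro SUP_least) auto
  moreover from this have "u \<in> BV2"
    using W weak_gradient_spec[OF W] by (auto simp: BV2_def BV_def intro: le_less_trans)
  ultimately show ?thesis by (simp add: D2_variation_def)
qed

section \<open>The upper bound\<close>

lemma
  fixes \<phi> :: "real^'n::finite \<Rightarrow> real"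
  assumes \<phi>: "test_function \<phi>"
  shows test_function_shift: "test_function (\<lambda>x. \<phi> (x - a))"
    and pderivative_shift: "pderivative i (\<lambda>x. \<phi> (x - a)) = (\<lambda>x. pderivative i \<phi> (x - a))"
proof -
  have i: "integrable (count_space {()}) (\<lambda>_. 1 :: real)" by (simp add: integrable_count_space)
  show "test_function (\<lambda>x. \<phi> (x - a))"
    using test_function_superposition[OF \<phi> _ i, of "\<lambda>_. a" "norm a"] by simp
  show "pderivative i (\<lambda>x. \<phi> (x - a)) = (\<lambda>x. pderivative i \<phi> (x - a))"
    using pderivative_superposition[OF \<phi> _ i, of "\<lambda>_. a" "norm a" i] by simp
qed

lemma hess_shift: "test_function \<phi> \<Longrightarrow> hess (\<lambda>x. \<phi> (x - a)) i j x = hess \<phi> i j (x - a)"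
  by (simp add: hess_def pderivative_shift test_function_pderivative)

lemma nlh_shift: "nlh \<rho> (\<lambda>x. \<phi> (x - a)) i j x = nlh \<rho> \<phi> i j (x - a)"
proof -
  have "x + h - a = x - a + h" "x - h - a = x - a - h" for h by (simp_all add: algebra_simps)
  then show ?thesis unfolding nlh_def second_diff_def by (simp only:)
qed

lemma integrable_mult_test:
  fixes f :: "real^'n::finite \<Rightarrow> real"
  assumes "integrable lborel f" "test_function \<phi>"
  shows "integrable lborel (\<lambda>x. f x * \<phi> x)"
  using test_function_bounded[OF assms(2)] test_function_borel_measurable[OF assms(2)]
  by (auto intro: integrable_mult_bounded[OF assms(1)])

text \<open>Substituting \<open>x - h\<close> for x exchanges the forward and the backward translate.\<close>

lemma second_diff_self_adjoint:
  fixes \<phi> \<eta> :: "real^'n::finite \<Rightarrow> real"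
  assumes \<phi>: "test_function \<phi>" and \<eta>: "test_function \<eta>"
  shows "(LINT x|lborel. second_diff \<phi> h x * \<eta> x) = (LINT x|lborel. \<phi> x * second_diff \<eta> h x)"
proof -
  note [measurable] = test_function_borel_measurable[OF \<phi>] test_function_borel_measurable[OF \<eta>]
  note i\<phi> = test_function_integrable[OF \<phi>] and i\<eta> = test_function_integrable[OF \<eta>]
  have i: "integrable lborel (\<lambda>x. \<phi> (x + a) * \<eta> x)" "integrable lborel (\<lambda>x. \<phi> x * \<eta> (x + a))" for a
    using integrable_mult_test[OF integrable_shift_lborel[OF i\<phi>] \<eta>] integrable_mult_test[OF
        integrable_shift_lborel[OF i\<eta>] \<phi>]
    by (simp_all add: mult.commute)
  have s: "(LINT x|lborel. \<phi> (x + a) * \<eta> x) = (LINT x|lborel. \<phi> x * \<eta> (x - a))" for a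
    using integral_lborel_shift[of "\<lambda>x. \<phi> x * \<eta> (x - a)" a] by simp
  have "(LINT x|lborel. second_diff \<phi> h x * \<eta> x)
    = ((LINT x|lborel. \<phi> (x + h) * \<eta> x) - 2 * (LINT x|lborel. \<phi> x * \<eta> x)
        + (LINT x|lborel. \<phi> (x - h) * \<eta> x)) / (norm h)\<^sup>2"
    using i(1)[of h] i(1)[of "-h"] i(1)[of 0]
    by (simp add: second_diff_def left_diff_distrib distrib_right mult.assoc)
  also have "\<dots> = ((LINT x|lborel. \<phi> x * \<eta> (x - h)) - 2 * (LINT x|lborel. \<phi> x * \<eta> x)
      + (LINT x|lborel. \<phi> x * \<eta> (x + h))) / (norm h)\<^sup>2"
    using s[of h] s[of "-h"] by simp
  also have "\<dots> = (LINT x|lborel. \<phi> x * second_diff \<eta> h x)"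
    using i(2)[of h] i(2)[of "-h"] i(2)[of 0]
    by (simp add: second_diff_def right_diff_distrib distrib_left mult.left_commute[of _ 2])
  finally show ?thesis .
qed

lemma nlh_self_adjoint:
  fixes \<phi> \<eta> :: "real^'n::finite \<Rightarrow> real"
  assumes iso: "isotropic_kernel \<rho>" and \<phi>: "test_function \<phi>" and \<eta>: "test_function \<eta>"
  shows "(LINT x|lborel. nlh \<rho> \<phi> i j x * \<eta> x) = (LINT x|lborel. \<phi> x * nlh \<rho> \<eta> i j x)"
proof -
  have swap: "(LINT x|lborel. nlh \<rho> f i j x * g x)
      = (LINT h|lborel. (LINT x|lborel. second_diff f h x * g x) * (kern i j h * \<rho> h))"
    if f: "test_function f" and g: "test_function g" for f g :: "real^'n \<Rightarrow> real"
  proof -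
    note [measurable] = isotropic_kernelD(1)[OF iso] test_function_borel_measurable[OF g]
      second_diff_measurable[OF test_function_borel_measurable[OF f]]
    obtain B where B: "\<And>x. \<bar>g x\<bar> \<le> B" using test_function_bounded[OF g] by blast
    note I0 = second_diff_product_integrable[OF iso f, of i j]
    have I: "integrable (lborel \<Otimes>\<^sub>M lborel)
        (\<lambda>z. (case z of (h, x) \<Rightarrow> second_diff f h x * kern i j h * \<rho> h) * g (snd z))"
      by (rule integrable_mult_bounded[OF I0]) (use B in auto)
    then have I: "integrable (lborel \<Otimes>\<^sub>M lborel) (\<lambda>(h, x). second_diff f h x * kern i j h * \<rho> h * g x)"
      by (simp add: case_prod_unfold)
    have "(LINT x|lborel. nlh \<rho> f i j x * g x)
        = (LINT x|lborel. LINT h|lborel. second_diff f h x * kern i j h * \<rho> h * g x)"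
      by (simp add: nlh_def)
    also have "\<dots> = (LINT h|lborel. LINT x|lborel. second_diff f h x * kern i j h * \<rho> h * g x)"
      by (rule lborel_pair.Fubini_integral[OF I])
    also have "\<dots> = (LINT h|lborel. LINT x|lborel. (second_diff f h x * g x) * (kern i j h * \<rho> h))"
      by (simp add: mult_ac)
    finally show ?thesis by simp
  qed
  have "(LINT x|lborel. nlh \<rho> \<phi> i j x * \<eta> x) = (LINT x|lborel. nlh \<rho> \<eta> i j x * \<phi> x)"
    unfolding swap[OF \<phi> \<eta>] swap[OF \<eta> \<phi>] second_diff_self_adjoint[OF \<phi> \<eta>] by (simp add: mult.commute)
  then show ?thesis by (simp add: mult.commute)
qed

lemma L1_close_imp_pairing_close:
  fixes f g :: "real^'n::finite \<Rightarrow> real"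
  assumes f: "integrable lborel f" and g: "integrable lborel g" and \<phi>: "test_function \<phi>"
      and B: "\<And>x. \<bar>\<phi> x\<bar> \<le> B"
  shows "\<bar>(LINT x|lborel. f x * \<phi> x) - (LINT x|lborel. g x * \<phi> x)\<bar> \<le> B * (LINT x|lborel. \<bar>f x - g x\<bar>)"
proof -
  note i = integrable_mult_test[OF f \<phi>] integrable_mult_test[OF g \<phi>]
  have "(LINT x|lborel. f x * \<phi> x) - (LINT x|lborel. g x * \<phi> x)
      = (LINT x|lborel. f x * \<phi> x - g x * \<phi> x)"
    using i by simp
  also have "\<bar>\<dots>\<bar> \<le> (LINT x|lborel. \<bar>f x * \<phi> x - g x * \<phi> x\<bar>)" by (rule integral_abs_bound)
  also have "\<dots> \<le> (LINT x|lborel. B * \<bar>f x - g x\<bar>)"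
  proof (rule integral_mono)
    show "\<bar>f x * \<phi> x - g x * \<phi> x\<bar> \<le> B * \<bar>f x - g x\<bar>" for x
    proof -
      have "f x * \<phi> x - g x * \<phi> x = \<phi> x * (f x - g x)" by (simp add: algebra_simps)
      then show ?thesis using mult_right_mono[OF B[of x] abs_ge_zero[of "f x - g x"]]
        by (simp add: abs_mult)
    qed
  qed (use i f g in auto)
  finally show ?thesis by simp
qed

text \<open>Integration by parts, obtained as the limit of the self-adjointness of the non-local Hessians,
  where only translation invariance is needed.\<close>

lemma hess_self_adjoint:
  fixes \<rho> :: "nat \<Rightarrow> real^'n::finite \<Rightarrow> real" and \<phi> \<eta> :: "real^'n \<Rightarrow> real"
  assumes iso: "\<And>n. isotropic_kernel (\<rho> n)" and tail: "\<And>\<gamma>. \<gamma> > 0 \<Longrightarrow> (\<lambda>n. tail (\<rho> n) \<gamma>) \<longlonglongrightarrow> 0"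
    and \<phi>: "test_function \<phi>" and \<eta>: "test_function \<eta>"
  shows "(LINT x|lborel. hess \<phi> i j x * \<eta> x) = (LINT x|lborel. \<phi> x * hess \<eta> i j x)"
proof -
  have lim: "(\<lambda>n. LINT x|lborel. nlh (\<rho> n) f i j x * g x) \<longlonglongrightarrow> (LINT x|lborel. hess f i j x * g x)"
    if f: "test_function f" and g: "test_function g" for f g
  proof -
    obtain B where B: "B > 0" "\<And>x. \<bar>g x\<bar> \<le> B" using test_function_bounded[OF g] by blast
    show ?thesis
    proof (rule metric_LIMSEQ_I)
      fix e :: real assume "e > 0"
      then have "e / (2 * B) > 0" using B by simp
      have "\<forall>\<^sub>F n in sequentially. (LINT x|lborel. \<bar>nlh (\<rho> n) f i j x - hess f i j x\<bar>) \<le> e / (2 * B)"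
        by (rule nlh_tendsto_hess_L1[OF iso tail f \<open>e / (2 * B) > 0\<close>])
      then have "\<forall>\<^sub>F n in sequentially. dist (LINT x|lborel. nlh (\<rho> n) f i j x * g x)
          (LINT x|lborel. hess f i j x * g x) < e"
      proof eventually_elim
        case (elim n)
        have "dist (LINT x|lborel. nlh (\<rho> n) f i j x * g x) (LINT x|lborel. hess f i j x * g x)
            \<le> B * (LINT x|lborel. \<bar>nlh (\<rho> n) f i j x - hess f i j x\<bar>)"
          unfolding dist_real_def
          by (rule L1_close_imp_pairing_close[OF nlh_integrable[OF iso f]
              test_function_integrable[OF test_function_hess[OF f]] g B(2)])
        also have "\<dots> \<le> B * (e / (2 * B))" using elim B by (intro mult_left_mono) auto
        also have "\<dots> < e" using B \<open>e > 0\<close> by simp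
        finally show ?case .
      qed
      then show "\<exists>n0. \<forall>n\<ge>n0. dist (LINT x|lborel. nlh (\<rho> n) f i j x * g x)
          (LINT x|lborel. hess f i j x * g x) < e"
        by (simp add: eventually_sequentially)
    qed
  qed
  have "(\<lambda>n. LINT x|lborel. nlh (\<rho> n) \<phi> i j x * \<eta> x) \<longlonglongrightarrow> (LINT x|lborel. hess \<eta> i j x * \<phi> x)"
  proof -
    have "(LINT x|lborel. nlh (\<rho> n) \<phi> i j x * \<eta> x) = (LINT x|lborel. nlh (\<rho> n) \<eta> i j x * \<phi> x)" for n
      using nlh_self_adjoint[OF iso \<phi> \<eta>, of n i j] by (simp add: mult.commute)
    then show ?thesis using lim[OF \<eta> \<phi>] by (simp only:)
  qed
  from LIMSEQ_unique[OF lim[OF \<phi> \<eta>] this] show ?thesis by (simp add: mult.commute)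
qed

lemma nlh_bounded:
  fixes \<rho> :: "real^'n::finite \<Rightarrow> real"
  assumes iso: "isotropic_kernel \<rho>" and \<phi>: "test_function \<phi>"
  shows "\<exists>B. \<forall>x. \<bar>nlh \<rho> \<phi> i j x\<bar> \<le> B"
proof -
  let ?K = "real CARD('n) * (real CARD('n) + 2)"
  obtain M where M: "M > 0" "\<And>h x. \<bar>second_diff \<phi> h x\<bar> \<le> M" using second_diff_bounded[OF \<phi>] by blast
  have "\<bar>nlh \<rho> \<phi> i j x\<bar> \<le> M * ?K" for x
  proof -
    note I = nlh_integrand_integrable[OF iso \<phi>, of x i j]
    have "\<bar>nlh \<rho> \<phi> i j x\<bar> \<le> (LINT h|lborel. \<bar>second_diff \<phi> h x * kern i j h * \<rho> h\<bar>)"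
      unfolding nlh_def by (rule integral_abs_bound)
    also have "\<dots> \<le> (LINT h|lborel. M * ?K * \<rho> h)"
    proof (rule integral_mono)
      show "\<bar>second_diff \<phi> h x * kern i j h * \<rho> h\<bar> \<le> M * ?K * \<rho> h" for h
        unfolding abs_mult using M isotropic_kernelD(2)[OF iso, of h] kern_bounded[of i j h]
        by (simp, intro mult_right_mono mult_mono) auto
    qed (use I isotropic_kernelD(3)[OF iso] in auto)
    also have "\<dots> = M * ?K" using isotropic_kernelD(4)[OF iso] by simp
    finally show ?thesis .
  qed
  then show ?thesis by blast
qed

text \<open>The non-local Hessian passes from the test function to the mollifier, so that \<open>u * H\<^sub>n\<eta>\<close>
  represents the distributional non-local Hessian of \<open>u * \<eta>\<close>.\<close>

lemma mollified_nlh_pairing: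
  fixes u :: "real^'n::finite \<Rightarrow> real"
  assumes iso: "isotropic_kernel \<rho>" and u: "integrable lborel u" and \<eta>: "test_function \<eta>"
      and \<phi>: "test_function \<phi>"
  shows "(LINT x|lborel. conv (nlh \<rho> \<eta> i j) u x * \<phi> x) = (LINT x|lborel. conv \<eta> u x * nlh \<rho> \<phi> i j x)"
proof -
  obtain B where B: "\<And>x. \<bar>\<phi> x\<bar> \<le> B" using test_function_bounded[OF \<phi>] by blast
  obtain B' where B': "\<And>x. \<bar>nlh \<rho> \<phi> i j x\<bar> \<le> B'" using nlh_bounded[OF iso \<phi>] by blast
  have m: "nlh \<rho> \<phi> i j \<in> borel_measurable borel" using nlh_integrable[OF iso \<phi>, of i j] by auto
  have "(LINT x|lborel. \<phi> x * conv (nlh \<rho> \<eta> i j) u x)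
      = (LINT y|lborel. u y * (LINT x|lborel. nlh \<rho> \<eta> i j (x - y) * \<phi> x))"
    by (rule integral_mult_conv[OF nlh_integrable[OF iso \<eta>] u test_function_borel_measurable[OF \<phi>] B])
  also have "\<dots> = (LINT y|lborel. u y * (LINT x|lborel. \<eta> (x - y) * nlh \<rho> \<phi> i j x))"
    using nlh_self_adjoint[OF iso test_function_shift[OF \<eta>] \<phi>] by (simp add: nlh_shift)
  also have "\<dots> = (LINT x|lborel. nlh \<rho> \<phi> i j x * conv \<eta> u x)"
    by (rule integral_mult_conv[OF test_function_integrable[OF \<eta>] u m B', symmetric])
  finally show ?thesis by (simp add: mult.commute)
qed

text \<open>By duality it suffices to pair \<open>u * D\<^sup>2\<eta>\<close> with a test field \<open>\<psi>\<close>. Moving both derivatives and the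
  convolution onto \<open>\<psi>\<close> gives the pairing of u with the mollified field \<open>\<Psi>\<close>, again a test field
  since averaging does not increase the norm.\<close>

lemma conv_hess_L1_le:
  fixes \<rho> :: "nat \<Rightarrow> real^'n::finite \<Rightarrow> real" and u :: "real^'n \<Rightarrow> real"
  assumes iso: "\<And>n. isotropic_kernel (\<rho> n)" and tail: "\<And>\<gamma>. \<gamma> > 0 \<Longrightarrow> (\<lambda>n. tail (\<rho> n) \<gamma>) \<longlonglongrightarrow> 0"
    and u: "integrable lborel u'" "integrable lebesgue u" "AE x in lebesgue. u x = u' x"
    and V: "\<And>\<psi>. test_field \<psi> \<Longrightarrow> hess_pairing u \<psi> \<le> V" and \<eta>: "mollifier d \<eta>"
  shows "(LINT x|lborel. norm (\<chi> i j. conv (hess \<eta> i j) u' x)) \<le> V"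
proof -
  have t\<eta>: "test_function \<eta>" "\<And>x. \<eta> x \<ge> 0" "(LINT x|lborel. \<eta> x) = 1" "\<And>x. \<eta> x \<noteq> 0 \<Longrightarrow> norm (- x) \<le> d"
    using \<eta> by (auto simp: mollifier_def not_less[symmetric])
  note i\<eta> = test_function_integrable[OF t\<eta>(1)]
  have ih: "integrable lborel (hess \<eta> i j)" for i j
    by (rule test_function_integrable[OF test_function_hess[OF t\<eta>(1)]])
  show ?thesis
  proof (rule L1_norm_le_by_duality_lborel)
    show "integrable lborel (\<lambda>x. \<chi> i j. conv (hess \<eta> i j) u' x)"
      by (rule integrable_matrixI) (simp add: integrable_conv[OF ih u(1)])
    fix \<psi> :: "real^'n \<Rightarrow> real^'n^'n" assume \<psi>: "test_field \<psi>"
    have t\<psi>: "test_function (\<lambda>x. \<psi> x $ i $ j)" for i j using \<psi> by (simp add: test_field_matrix_iff)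
    have n\<psi>: "norm (\<psi> x) \<le> 1" for x using \<psi> by (simp add: test_field_def)
    \<comment> \<open>The mollified field. The double sign fits the form of a superposition of translates.\<close>
    define \<Psi> where "\<Psi> y = (\<chi> i j. LINT z|lborel. \<psi> (y - (- z)) $ i $ j * \<eta> z)" for y
    have um: "uminus \<in> borel_measurable (lborel :: (real^'n) measure)" by measurable
    have t\<Psi>: "test_function (\<lambda>y. \<Psi> y $ i $ j)" for i j
      using test_function_superposition[OF t\<psi>[of i j] um i\<eta> t\<eta>(4)] by (simp add: \<Psi>_def)
    have h\<Psi>: "hess (\<lambda>y. \<Psi> y $ i $ j) i j y
        = (LINT z|lborel. hess (\<lambda>y. \<psi> y $ i $ j) i j (y - (- z)) * \<eta> z)" for i j y
    proof -
      have "pderivative j (\<lambda>y. \<Psi> y $ i $ j)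
          = (\<lambda>x. LINT z|lborel. pderivative j (\<lambda>y. \<psi> y $ i $ j) (x - (- z)) * \<eta> z)"
        using pderivative_superposition[OF t\<psi>[of i j] um i\<eta> t\<eta>(4), of j] by (simp add: \<Psi>_def)
      then show ?thesis
        unfolding hess_def using pderivative_superposition[OF test_function_pderivative[OF t\<psi>[of i
            j], of j] um i\<eta> t\<eta>(4), of i]
        by simp
    qed
    have iv: "integrable lborel (\<lambda>z. \<eta> z *\<^sub>R \<psi> (y - (- z)))" for y
      by (rule integrable_matrixI) (use superposition_integrable[OF t\<psi> um i\<eta> t\<eta>(4), of y] in \<open>simp
          add: mult.commute\<close>)
    have \<Psi>v: "\<Psi> y = (LINT z|lborel. \<eta> z *\<^sub>R \<psi> (y - (- z)))" for y
    proof -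
      have "(LINT z|lborel. \<eta> z *\<^sub>R \<psi> (y - (- z))) $ i $ j = \<Psi> y $ i $ j" for i j
        using integral_bounded_linear[OF bounded_linear_compose[OF bounded_linear_vec_nth
            bounded_linear_vec_nth] iv[of y], of i j]
        by (simp add: \<Psi>_def mult.commute)
      then show ?thesis by (simp add: vec_eq_iff)
    qed
    have "norm (\<Psi> y) \<le> 1" for y
    proof -
      have "norm (\<Psi> y) \<le> (LINT z|lborel. norm (\<eta> z *\<^sub>R \<psi> (y - (- z))))"
        unfolding \<Psi>v by (rule integral_norm_bound)
      also have "\<dots> \<le> (LINT z|lborel. \<eta> z)"
      proof (rule integral_mono)
        show "integrable lborel (\<lambda>z. norm (\<eta> z *\<^sub>R \<psi> (y - (- z))))" by (rule integrable_norm[OF iv])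
        show "norm (\<eta> z *\<^sub>R \<psi> (y - (- z))) \<le> \<eta> z" for z using n\<psi> t\<eta>(2)[of z] by (simp add: mult_left_le)
      qed (rule i\<eta>)
      finally show ?thesis by (simp add: t\<eta>(3))
    qed
    then have "test_field \<Psi>" using t\<Psi> by (simp add: test_field_matrix_iff)
    from V[OF this] have le: "hess_pairing u \<Psi> \<le> V" .
    have entry: "(LINT x|lborel. conv (hess \<eta> i j) u' x * \<psi> x $ i $ j)
        = (LINT x|lebesgue. u x * hess (\<lambda>y. \<Psi> y $ i $ j) i j x)" for i j
    proof -
      obtain B where B: "\<And>x. \<bar>\<psi> x $ i $ j\<bar> \<le> B" using test_function_bounded[OF t\<psi>] by blast
      have "(LINT x|lborel. \<psi> x $ i $ j * conv (hess \<eta> i j) u' x)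
          = (LINT y|lborel. u' y * (LINT x|lborel. hess \<eta> i j (x - y) * \<psi> x $ i $ j))"
        by (rule integral_mult_conv[OF ih u(1) test_function_borel_measurable[OF t\<psi>] B])
      also have "\<dots> = (LINT y|lborel. u' y * hess (\<lambda>y. \<Psi> y $ i $ j) i j y)"
      proof (intro Bochner_Integration.integral_cong refl arg_cong2[where f="(*)"])
        fix y
        let ?h = "hess (\<lambda>y. \<psi> y $ i $ j) i j"
        note [measurable] = test_function_borel_measurable[OF t\<eta>(1)]
            test_function_borel_measurable[OF test_function_hess[OF t\<eta>(1)]]
          test_function_borel_measurable[OF t\<psi>] test_function_borel_measurable[OF
              test_function_hess[OF t\<psi>]]
        have "(LINT x|lborel. hess \<eta> i j (x - y) * \<psi> x $ i $ j)
            = (LINT x|lborel. hess \<eta> i j x * \<psi> (x + y) $ i $ j)"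
          using integral_lborel_shift[of "\<lambda>x. hess \<eta> i j (x - y) * \<psi> x $ i $ j" y] by simp
        also have "\<dots> = (LINT x|lborel. \<eta> x * hess (\<lambda>x. \<psi> (x - (- y)) $ i $ j) i j x)"
          using hess_self_adjoint[OF iso tail t\<eta>(1) test_function_shift[OF t\<psi>[of i j], of
              "-y"], of i j] by simp
        also have "\<dots> = (LINT x|lborel. ?h (x - (- y)) * \<eta> x)"
          by (simp only: hess_shift[OF t\<psi>[of i j], of "-y"] mult.commute)
        also have "\<dots> = hess (\<lambda>y. \<Psi> y $ i $ j) i j y" unfolding h\<Psi> by (simp add: add.commute)
        finally show "(LINT x|lborel. hess \<eta> i j (x - y) * \<psi> x $ i $ j)
            = hess (\<lambda>y. \<Psi> y $ i $ j) i j y" .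
      qed
      also have "\<dots> = (LINT x|lebesgue. u x * hess (\<lambda>y. \<Psi> y $ i $ j) i j x)"
        using u by (intro integral_lebesgue_mult_borel[symmetric] test_function_borel_measurable[OF
            test_function_hess[OF t\<Psi>]]) auto
      finally show ?thesis by (simp add: mult.commute)
    qed
    have "integrable lborel (\<lambda>x. conv (hess \<eta> i j) u' x * \<psi> x $ i $ j)" for i j
      by (rule integrable_mult_test[OF integrable_conv[OF ih u(1)] t\<psi>])
    then have "(LINT x|lborel. (\<chi> i j. conv (hess \<eta> i j) u' x) \<bullet> \<psi> x) = hess_pairing u \<Psi>"
      unfolding inner_matrix hess_pairing_def entry[symmetric] by simp
    with le show "(LINT x|lborel. (\<chi> i j. conv (hess \<eta> i j) u' x) \<bullet> \<psi> x) \<le> V" by simp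
  qed
qed

text \<open>The representing function \<open>u * H\<^sub>n\<eta>\<close> is compared with \<open>u * D\<^sup>2\<eta>\<close> entry by entry; the convolution
  with u costs the factor \<open>|u|\<^sub>1\<close>.\<close>

lemma nonlocal_energy_mollified_le:
  fixes u :: "real^'n::finite \<Rightarrow> real"
  assumes iso: "isotropic_kernel \<rho>'"
      and \<rho>: "\<rho> \<in> borel_measurable lebesgue" "AE x in lebesgue. \<rho> x = \<rho>' x"
    and u: "integrable lborel u" and \<eta>: "test_function \<eta>"
  shows "nonlocal_energy \<rho> (conv \<eta> u) \<le> ereal ((LINT x|lborel. norm (\<chi> i j. conv (hess \<eta> i j) u x))
    + (\<Sum>i\<in>UNIV. \<Sum>j\<in>UNIV. (LINT x|lborel. \<bar>nlh \<rho>' \<eta> i j x - hess \<eta> i j x\<bar>) * (LINT x|lborel. \<bar>u x\<bar>)))"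
proof -
  define G where "G x = (\<chi> i j. conv (nlh \<rho>' \<eta> i j) u x)" for x
  define H where "H x = (\<chi> i j. conv (hess \<eta> i j) u x)" for x
  define D where "D i j x = conv (\<lambda>x. nlh \<rho>' \<eta> i j x - hess \<eta> i j x) u x" for i j x
  have iN: "integrable lborel (nlh \<rho>' \<eta> i j)" for i j by (rule nlh_integrable[OF iso \<eta>])
  have iH: "integrable lborel (hess \<eta> i j)" for i j
    by (rule test_function_integrable[OF test_function_hess[OF \<eta>]])
  have iNH: "integrable lborel (\<lambda>x. nlh \<rho>' \<eta> i j x - hess \<eta> i j x)" for i j using iN iH by simp
  have G: "integrable lborel G" by (rule integrable_matrixI) (simp add: G_def integrable_conv[OF iN u])
  have Hint: "integrable lborel H"
    by (rule integrable_matrixI) (simp add: H_def integrable_conv[OF iH u])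
  have Dint: "integrable lborel (D i j)" for i j unfolding D_def[abs_def]
    using integrable_conv[OF iNH u] by simp
  have "represents_nonlocal_hessian \<rho> (conv \<eta> u) G"
    unfolding represents_nonlocal_hessian_def
  proof (intro conjI allI impI)
    show "integrable lebesgue G" using G by (subst integrable_completion) auto
    fix i j and \<phi> :: "real^'n \<Rightarrow> real" assume \<phi>: "test_function \<phi>"
    have m: "conv \<eta> u \<in> borel_measurable borel" "nlh \<rho>' \<phi> i j \<in> borel_measurable borel"
        "conv (nlh \<rho>' \<eta> i j) u \<in> borel_measurable borel"
      using integrable_conv[OF test_function_integrable[OF \<eta>] u] nlh_integrable[OF iso \<phi>, of i j]
          integrable_conv[OF iN u] by auto
    have "dist_nonlocal_hessian \<rho> (conv \<eta> u) i j \<phi> = (LINT x|lebesgue. conv \<eta> u x * nlh \<rho>' \<phi> i j x)"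
      unfolding dist_nonlocal_hessian_def nonlocal_hessian_component[OF iso \<rho> \<phi>] ..
    also have "\<dots> = (LINT x|lborel. conv \<eta> u x * nlh \<rho>' \<phi> i j x)"
      using m by (subst integral_completion) auto
    also have "\<dots> = (LINT x|lborel. conv (nlh \<rho>' \<eta> i j) u x * \<phi> x)"
      by (rule mollified_nlh_pairing[OF iso u \<eta> \<phi>, symmetric])
    also have "\<dots> = (LINT x|lebesgue. G x $ i $ j * \<phi> x)"
      using m test_function_borel_measurable[OF \<phi>] by (subst integral_completion) (auto simp: G_def)
    finally show "dist_nonlocal_hessian \<rho> (conv \<eta> u) i j \<phi> = (LINT x|lebesgue. G x $ i $ j * \<phi> x)" .
  qed
  from nonlocal_energy_le[OF this]
  have "nonlocal_energy \<rho> (conv \<eta> u) \<le> ereal (LINT x|lebesgue. norm (G x))" .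
  also have "(LINT x|lebesgue. norm (G x)) = (LINT x|lborel. norm (G x))"
    using G by (subst integral_completion) auto
  also have "\<dots> \<le> (LINT x|lborel. norm (H x) + (\<Sum>i\<in>UNIV. \<Sum>j\<in>UNIV. \<bar>D i j x\<bar>))"
  proof (rule integral_mono_AE)
    show "integrable lborel (\<lambda>x. norm (G x))" using G by simp
    show "integrable lborel (\<lambda>x. norm (H x) + (\<Sum>i\<in>UNIV. \<Sum>j\<in>UNIV. \<bar>D i j x\<bar>))" using Hint Dint by simp
    have ae: "AE x in lborel. \<forall>ij\<in>UNIV. conv (nlh \<rho>' \<eta> (fst ij) (snd ij)) u x
        - conv (hess \<eta> (fst ij) (snd ij)) u x = D (fst ij) (snd ij) x"
    proof (rule AE_finite_allI)
      fix ij :: "'n \<times> 'n"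
      have "AE x in lborel. integrable lborel (\<lambda>y. nlh \<rho>' \<eta> (fst ij) (snd ij) (x - y) *\<^sub>R u y)"
        using lborel_pair.AE_integrable_snd[OF conv_integrand_integrable[OF iN u]] .
      moreover have "AE x in lborel. integrable lborel (\<lambda>y. hess \<eta> (fst ij) (snd ij) (x - y) *\<^sub>R u y)"
        using lborel_pair.AE_integrable_snd[OF conv_integrand_integrable[OF iH u]] .
      ultimately show "AE x in lborel. conv (nlh \<rho>' \<eta> (fst ij) (snd ij)) u x
          - conv (hess \<eta> (fst ij) (snd ij)) u x = D (fst ij) (snd ij) x"
        by eventually_elim (simp add: D_def conv_def left_diff_distrib)
    qed simp
    then show "AE x in lborel. norm (G x) \<le> norm (H x) + (\<Sum>i\<in>UNIV. \<Sum>j\<in>UNIV. \<bar>D i j x\<bar>)"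
    proof eventually_elim
      case (elim x)
      have d: "(G x - H x) $ i $ j = D i j x" for i j
        using elim[rule_format, of "(i, j)"] by (simp add: G_def H_def)
      have "norm (G x - H x) \<le> (\<Sum>i\<in>UNIV. norm ((G x - H x) $ i))"
        by (simp add: norm_vec_def L2_set_le_sum)
      also have "\<dots> \<le> (\<Sum>i\<in>UNIV. \<Sum>j\<in>UNIV. \<bar>D i j x\<bar>)"
        unfolding d[symmetric] by (intro sum_mono norm_le_l1_cart)
      finally show ?case using norm_triangle_ineq2[of "G x" "H x"] by linarith
    qed
  qed
  also have "\<dots> = (LINT x|lborel. norm (H x)) + (\<Sum>i\<in>UNIV. \<Sum>j\<in>UNIV. LINT x|lborel. \<bar>D i j x\<bar>)"
    using Hint Dint by simp
  also have "\<dots> \<le> (LINT x|lborel. norm (H x))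
     + (\<Sum>i\<in>UNIV. \<Sum>j\<in>UNIV. (LINT x|lborel. \<bar>nlh \<rho>' \<eta> i j x - hess \<eta> i j x\<bar>) * (LINT x|lborel. \<bar>u x\<bar>))"
    using norm_conv_le[OF iNH u] by (intro add_left_mono sum_mono) (simp add: D_def)
  finally show ?thesis by (simp add: H_def)
qed

lemma eventually_nonlocal_energy_mollified_le:
  fixes \<rho> :: "nat \<Rightarrow> real^'n::finite \<Rightarrow> real"
  assumes iso: "\<And>n. isotropic_kernel (\<rho>' n)" and tail: "\<And>\<gamma>. \<gamma> > 0 \<Longrightarrow> (\<lambda>n. tail (\<rho>' n) \<gamma>) \<longlonglongrightarrow> 0"
    and \<rho>: "\<And>n. \<rho> n \<in> borel_measurable lebesgue" "\<And>n. AE x in lebesgue. \<rho> n x = \<rho>' n x"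
    and u: "integrable lborel u'" "integrable lebesgue u" "AE x in lebesgue. u x = u' x"
    and V: "\<And>\<psi>. test_field \<psi> \<Longrightarrow> hess_pairing u \<psi> \<le> V" and \<eta>: "mollifier d \<eta>" and e: "e > 0"
  shows "\<forall>\<^sub>F n in sequentially. nonlocal_energy (\<rho> n) (conv \<eta> u') \<le> ereal (V + e)"
proof -
  have t\<eta>: "test_function \<eta>" using \<eta> by (simp add: mollifier_def)
  define U where "U = (LINT x|lborel. \<bar>u' x\<bar>)"
  have U: "U \<ge> 0" by (simp add: U_def)
  define N where "N = real CARD('n)"
  have N: "N > 0" by (simp add: N_def)
  define e' where "e' = e / (N * N * (U + 1))"
  have e': "e' > 0" using e N U by (simp add: e'_def)
  have "N * N * (e' * U) \<le> e"
  proof -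
    have "e' * U \<le> e' * (U + 1)" using e' by simp
    then have "N * N * (e' * U) \<le> N * N * (e' * (U + 1))"
      using N mult_left_mono[of "e' * U" "e' * (U + 1)" "N * N"] by simp
    also have "\<dots> = e" using N U by (simp add: e'_def)
    finally show ?thesis .
  qed
  have "\<forall>\<^sub>F n in sequentially. \<forall>ij\<in>UNIV. (LINT x|lborel. \<bar>nlh (\<rho>' n) \<eta> (fst ij) (snd ij) x
      - hess \<eta> (fst ij) (snd ij) x\<bar>) \<le> e'"
    by (intro eventually_ball_finite ballI nlh_tendsto_hess_L1[OF iso tail t\<eta> e']) simp
  then show ?thesis
  proof eventually_elim
    case (elim n)
    have "(\<Sum>i\<in>UNIV. \<Sum>j\<in>UNIV. (LINT x|lborel. \<bar>nlh (\<rho>' n) \<eta> i j x - hess \<eta> i j x\<bar>) * U)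
        \<le> (\<Sum>i\<in>(UNIV::'n set). \<Sum>j\<in>(UNIV::'n set). e' * U)"
      using elim U by (intro sum_mono mult_right_mono) (auto dest: bspec[of _ _ "(_, _)"])
    also have "\<dots> = N * N * (e' * U)" by (simp add: N_def)
    also have "\<dots> \<le> e" by fact
    finally have "(\<Sum>i\<in>UNIV. \<Sum>j\<in>UNIV. (LINT x|lborel. \<bar>nlh (\<rho>' n) \<eta> i j x - hess \<eta> i j x\<bar>) * U) \<le> e" .
    moreover have "(LINT x|lborel. norm (\<chi> i j. conv (hess \<eta> i j) u' x)) \<le> V"
      by (rule conv_hess_L1_le[OF iso tail u V \<eta>])
    ultimately have "(LINT x|lborel. norm (\<chi> i j. conv (hess \<eta> i j) u' x))
        + (\<Sum>i\<in>UNIV. \<Sum>j\<in>UNIV. (LINT x|lborel. \<bar>nlh (\<rho>' n) \<eta> i j x - hess \<eta> i j x\<bar>) * U) \<le> V + e"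
      by simp
    then show ?case
      using nonlocal_energy_mollified_le[OF iso \<rho> u(1) t\<eta>, of n] unfolding U_def
      by (meson ereal_less_eq(3) order_trans)
  qed
qed

text \<open>The energies of the k-th approximation are good from some index N k on. At index n the
  approximation used is the last one with \<open>k \<le> n\<close> and \<open>N k \<le> n\<close>; it tends to infinity with n.\<close>

lemma diagonal_recovery_sequence:
  fixes E :: "nat \<Rightarrow> 'a \<Rightarrow> ereal" and L :: real
  assumes v: "\<And>k. v k \<in> X" "\<And>k. d (v k) x \<le> 1 / real (Suc k)" "\<And>k. d (v k) x \<ge> 0"
    and E: "\<And>k. \<forall>\<^sub>F n in sequentially. E n (v k) \<le> ereal (L + 1 / real (Suc k))"
  shows "\<exists>xs. (\<forall>n. xs n \<in> X) \<and> (\<lambda>n. d (xs n) x) \<longlonglongrightarrow> 0 \<and> limsup (\<lambda>n. E n (xs n)) \<le> ereal L"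
proof -
  obtain N where N: "\<And>k n. n \<ge> N k \<Longrightarrow> E n (v k) \<le> ereal (L + 1 / real (Suc k))"
    using E unfolding eventually_sequentially by metis
  \<comment> \<open>The element 0 keeps the set nonempty.\<close>
  define \<kappa> where "\<kappa> n = Max (insert 0 {k. k \<le> n \<and> N k \<le> n})" for n
  have fin: "finite (insert 0 {k. k \<le> n \<and> N k \<le> n})" for n by simp
  have \<kappa>in: "\<kappa> n \<in> insert 0 {k. k \<le> n \<and> N k \<le> n}" for n unfolding \<kappa>_def by (rule Max_in[OF fin]) simp
  have \<kappa>ge: "\<kappa> n \<ge> K" if "n \<ge> max K (N K)" for n K
    unfolding \<kappa>_def using that by (intro Max_ge[OF fin]) auto
  have top: "filterlim \<kappa> at_top sequentially"
    unfolding filterlim_at_top eventually_sequentially using \<kappa>ge by blast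
  have small: "(\<lambda>n. 1 / real (Suc (\<kappa> n))) \<longlonglongrightarrow> 0"
    using filterlim_compose[OF LIMSEQ_inverse_real_of_nat top] by (simp add: inverse_eq_divide)
  have "\<forall>\<^sub>F n in sequentially. E n (v (\<kappa> n)) \<le> ereal (L + 1 / real (Suc (\<kappa> n)))"
    using eventually_ge_at_top[of "N 0"]
  proof eventually_elim
    case (elim n)
    then have "N (\<kappa> n) \<le> n" using \<kappa>in[of n] by auto
    then show ?case by (rule N)
  qed
  then have "limsup (\<lambda>n. E n (v (\<kappa> n))) \<le> limsup (\<lambda>n. ereal (L + 1 / real (Suc (\<kappa> n))))"
    by (rule Limsup_mono)
  also have "\<dots> = ereal L"
  proof (rule lim_imp_Limsup)
    have "(\<lambda>n. L + 1 / real (Suc (\<kappa> n))) \<longlonglongrightarrow> L + 0" by (intro tendsto_add tendsto_const small)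
    then show "(\<lambda>n. ereal (L + 1 / real (Suc (\<kappa> n)))) \<longlonglongrightarrow> ereal L" by simp
  qed simp
  finally have "limsup (\<lambda>n. E n (v (\<kappa> n))) \<le> ereal L" .
  moreover have "(\<lambda>n. d (v (\<kappa> n)) x) \<longlonglongrightarrow> 0"
    by (rule tendsto_sandwich[OF _ _ tendsto_const small]) (use v in auto)
  ultimately show ?thesis using v(1) by (intro exI[of _ "\<lambda>n. v (\<kappa> n)"]) simp
qed

theorem theorem1p8:
  fixes \<rho> :: "nat \<Rightarrow> real^'n \<Rightarrow> real" and u :: "real^'n \<Rightarrow> real"
  assumes "\<And>n. radial (\<rho> n)"
    and "\<And>n x. \<rho> n x \<ge> 0"
    and "\<And>n. has_bochner_integral lebesgue (\<rho> n) 1"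
    and "\<And>\<gamma>. \<gamma> > 0 \<Longrightarrow> (\<lambda>n. LINT x:{x. norm x > \<gamma>}|lebesgue. \<rho> n x) \<longlonglongrightarrow> 0"
    and "u \<in> L1"
  shows "Gamma_lim_at L1 L1_dist (\<lambda>n. nonlocal_energy (\<rho> n)) D2_variation u"
proof -
  have "\<exists>\<rho>'. isotropic_kernel \<rho>' \<and> (AE x in lebesgue. \<rho> n x = \<rho>' x)" for n
    by (rule isotropic_kernel_of_radial[OF assms(1-3)])
  then obtain \<rho>' where iso: "\<And>n. isotropic_kernel (\<rho>' n)"
      and ae: "\<And>n. AE x in lebesgue. \<rho> n x = \<rho>' n x" by metis
  have \<rho>m: "\<rho> n \<in> borel_measurable lebesgue" for n using assms(3)[of n]
    by (auto simp: has_bochner_integral_iff)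
  have tail: "(\<lambda>n. tail (\<rho>' n) \<gamma>) \<longlonglongrightarrow> 0" if "\<gamma> > 0" for \<gamma>
  proof -
    have "(LINT x:{x. norm x > \<gamma>}|lebesgue. \<rho> n x) = tail (\<rho>' n) \<gamma>" for n
      using integral_lebesgue_mult_borel[OF \<rho>m isotropic_kernelD(1)[OF iso] ae, of
          "indicator {x. norm x > \<gamma>}"]
      by (simp add: tail_def set_lebesgue_integral_def mult.commute)
    then show ?thesis using assms(4)[OF that] by simp
  qed
  have lower: "D2_variation u \<le> liminf (\<lambda>n. nonlocal_energy (\<rho> n) (us n))"
    if us: "\<And>n. us n \<in> L1" "(\<lambda>n. L1_dist (us n) u) \<longlonglongrightarrow> 0" for us
  proof -
    define L where "L = liminf (\<lambda>n. nonlocal_energy (\<rho> n) (us n))"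
    have le: "ereal (hess_pairing u \<psi>) \<le> L" if "test_field \<psi>" for \<psi>
      unfolding L_def by (rule hess_pairing_le_liminf[OF iso tail \<rho>m ae us(1) assms(5) us(2) that])
    have "test_field (\<lambda>_. 0 :: real^'n^'n)" by (simp add: test_field_matrix_iff test_function_zero)
    from le[OF this] have "L \<noteq> -\<infinity>" by auto
    then consider C where "L = ereal C" | "L = \<infinity>" by (cases L) auto
    then show ?thesis unfolding L_def[symmetric]
    proof cases
      case 1
      then show "D2_variation u \<le> L" using le by (simp add: D2_variation_le[OF assms(5)])
    qed simp
  qed
  moreover have "\<exists>us. (\<forall>n. us n \<in> L1) \<and> (\<lambda>n. L1_dist (us n) u) \<longlonglongrightarrow> 0
      \<and> limsup (\<lambda>n. nonlocal_energy (\<rho> n) (us n)) \<le> D2_variation u"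
  proof (cases "u \<in> BV2")
    case False
    then show ?thesis
      using assms(5) by (intro exI[of _ "\<lambda>_. u"]) (simp add: L1_dist_def D2_variation_def)
  next
    case True
    have iu: "integrable lebesgue u" using assms(5) by (simp add: L1_def)
    obtain u' where u': "integrable lborel u'" "AE x in lebesgue. u x = u' x"
      using integrable_lebesgue_ex_borel[OF iu] by blast
    have "test_field (\<lambda>_. 0 :: real^'n^'n)" by (simp add: test_field_matrix_iff test_function_zero)
    from hess_pairing_le_D2_variation[OF True this] have "D2_variation u \<noteq> -\<infinity>" by auto
    moreover have "D2_variation u < \<infinity>" using True by (simp add: D2_variation_def BV2_def BV_def)
    ultimately obtain V where V: "D2_variation u = ereal V" by (cases "D2_variation u") auto
    have pair: "hess_pairing u \<psi> \<le> V" if "test_field \<psi>" for \<psi>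
      using hess_pairing_le_D2_variation[OF True that] by (simp add: V)
    have "\<exists>\<eta> d. mollifier d (\<eta> :: real^'n \<Rightarrow> real) \<and> (LINT x|lborel. \<bar>conv \<eta> u' x - u' x\<bar>)
        \<le> 1 / real (Suc k)" for k
    proof -
      have "1 / real (Suc k) > 0" by simp
      from mollify_close[OF u'(1) this] obtain d where d: "d > 0"
        "\<And>\<eta>. mollifier d \<eta> \<Longrightarrow> (LINT x|lborel. \<bar>conv \<eta> u' x - u' x\<bar>) \<le> 1 / real (Suc k)"
        unfolding real_norm_def by blast
      obtain \<eta> :: "real^'n \<Rightarrow> real" where "mollifier d \<eta>" using mollifier_exists[OF d(1)] by blast
      with d(2)[OF this] show ?thesis by blast
    qed
    then obtain \<eta> d where \<eta>: "\<And>k. mollifier (d k) (\<eta> k :: real^'n \<Rightarrow> real)"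
      "\<And>k. (LINT x|lborel. \<bar>conv (\<eta> k) u' x - u' x\<bar>) \<le> 1 / real (Suc k)" by metis
    have iv: "integrable lborel (conv (\<eta> k) u')" for k
      using \<eta>(1)[of k] by (intro integrable_conv u'(1) test_function_integrable)
          (simp add: mollifier_def)
    have "\<exists>us. (\<forall>n. us n \<in> L1) \<and> (\<lambda>n. L1_dist (us n) u) \<longlonglongrightarrow> 0
        \<and> limsup (\<lambda>n. nonlocal_energy (\<rho> n) (us n)) \<le> ereal V"
    proof (rule diagonal_recovery_sequence[where v="\<lambda>k. conv (\<eta> k) u'"])
      fix k
      show "conv (\<eta> k) u' \<in> L1" unfolding L1_def using iv[of k]
        by (simp add: integrable_completion borel_measurable_integrable)
      have m: "conv (\<eta> k) u' \<in> borel_measurable lebesgue" "u' \<in> borel_measurable lebesgue"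
          "u \<in> borel_measurable lebesgue"
        using iv[of k] u'(1) iu by (auto intro: borel_imp_lebesgue_measurable)
      have "L1_dist (conv (\<eta> k) u') u = (LINT x|lebesgue. \<bar>conv (\<eta> k) u' x - u' x\<bar>)"
        unfolding L1_dist_def by (rule integral_cong_AE) (use m u'(2) in auto)
      also have "\<dots> = (LINT x|lborel. \<bar>conv (\<eta> k) u' x - u' x\<bar>)"
        using iv[of k] u'(1) by (subst integral_completion) auto
      finally show "L1_dist (conv (\<eta> k) u') u \<le> 1 / real (Suc k)" using \<eta>(2)[of k] by simp
      show "L1_dist (conv (\<eta> k) u') u \<ge> 0" by (simp add: L1_dist_def)
      show "\<forall>\<^sub>F n in sequentially. nonlocal_energy (\<rho> n) (conv (\<eta> k) u') \<le> ereal (V + 1 / real (Suc k))"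
        by (rule eventually_nonlocal_energy_mollified_le[OF iso tail \<rho>m ae u'(1) iu u'(2) pair
            \<eta>(1)]) auto
    qed
    then show ?thesis by (simp add: V)
  qed
  ultimately show ?thesis unfolding Gamma_lim_at_def by blast
qed

end
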